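(* Let $|\alpha|<1$, $T>0$, and for each integer $N\ge 3$ let $(\eta_t)_{t\in[0,T]}$ be the Markov process on $\Sigma_N=\{0,1\}^{\Lambda_N}$ with generator $N^2\mathcal L_N$, where $$\mathcal L_N f(\eta)=\sum_{(x,y)\in E_N}c_{x,y}(\eta)[f(\eta^{x,y})-f(\eta)],\qquad c_{x,y}(\eta)=\eta(x)(1-\eta(y))+\eta(x)\left[\tau_{\mathfrak f^+(x,y)}g(\eta)-\tau_{\mathfrak f^-(x,y)}g(\eta)\right],$$ started from a probability measure $\mu_N$ on $\Sigma_N$; let $\mathbb P_{\mu_N}$ be its law. Suppose that the sequence $\mu_N$ is associated to a measurable density profile $\rho^*:\Lambda\to[0,1]$. Then for every $t\in[0,T]$, every $f\in C(\Lambda)$ and every $\epsilon>0$, $$\lim_{N\to+\infty}\mathbb P_{\mu_N}\left(\left|\int_\Lambda f(u)\,\pi^N(\eta_t,du)-\int_\Lambda f(u)\rho_t(u)\,du\right|>\epsilon\right)=0,$$ where $\rho_t(u)$ is the unique weak solution of the Cauchy problem $\partial_t\rho_t(u)=\Delta\rho_t(u)$ for $u\in\Lambda$, $t>0$, with $\rho_0(u)=\rho^*(u)$ for $u\in\Lambda$.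
   Context: Lattice: $\Lambda=\mathbb R^2/\mathbb Z^2$ is the continuous torus and $\Lambda_N:=\frac1N(\mathbb Z^2/N\mathbb Z^2)\subset\Lambda$ is the discrete torus with mesh $1/N$; $e^{(1)}=(1/N,0)$, $e^{(2)}=(0,1/N)$; $E_N$ is the set of ordered pairs $(x,y)$ of nearest-neighbour sites of $\Lambda_N$ (i.e. $y=x\pm e^{(i)}$). An unoriented face is a set $\mathfrak f=\{x,x+e^{(1)},x+e^{(1)}+e^{(2)},x+e^{(2)}\}$; its anticlockwise orientation is the cycle $(x,x+e^{(1)},x+e^{(1)}+e^{(2)},x+e^{(2)},x)$ and its clockwise orientation is the reversed cycle. For $(x,y)\in E_N$, $\mathfrak f^+(x,y)$ is the unique face whose anticlockwise cycle traverses the edge from $x$ to $y$, and $\mathfrak f^-(x,y)$ is the unique face whose clockwise cycle traverses the edge from $x$ to $y$. Configurations: $\eta(x)\in\{0,1\}$ is the occupation number of $x$; $\eta^{x,y}$ is $\eta$ with the values at $x$ and $y$ exchanged. Translations: $[\tau_x\eta](z)=\eta(z-x)$ and $[\tau_x h](\eta)=h(\tau_{-x}\eta)$ for functions $h$ on $\Sigma_N$; for the face $\mathfrak f=\{x,x+e^{(1)},x+e^{(1)}+e^{(2)},x+e^{(2)}\}$ one sets $\tau_{\mathfrak f}:=\tau_x$. The function $g:\Sigma_N\to\mathbb R$: $g(\eta)=\alpha$ if $\eta(0)=\eta(e^{(1)}+e^{(2)})=1$ and $\eta(e^{(1)})=\eta(e^{(2)})=0$; $g(\eta)=\alpha$ if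 $\eta(e^{(1)})=\eta(e^{(2)})=1$ and $\eta(0)=\eta(e^{(1)}+e^{(2)})=0$; $g(\eta)=0$ otherwise. Empirical measure: $\pi^N(\eta,du)=\frac1{N^2}\sum_{x\in\Lambda_N}\eta(x)\delta_x(du)$. A sequence of probability measures $\mu_N$ on $\Sigma_N$ is associated to $\rho^*$ if for every $f\in C(\Lambda)$ and $\epsilon>0$, $\lim_{N\to\infty}\mu_N\left(\left|\int_\Lambda f\,\pi^N(\eta,du)-\int_\Lambda f\rho^*\,du\right|>\epsilon\right)=0$. Weak solution: a bounded measurable $\rho$ with $\int_\Lambda f\rho_t\,du=\int_\Lambda f\rho^*\,du+\int_0^t\int_\Lambda\rho_s\Delta f\,du\,ds$ for all $f\in C^2(\Lambda)$ and $t\in[0,T]$. *)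

theory Defs
  imports "HOL-Probability.Probability"
begin

section \<open>The continuous torus\<close>

text \<open>Functions on the torus are functions on the plane that are 1-periodic in each
  coordinate; integrals over the torus are taken over the fundamental domain
  \<open>torus_cell\<close>.\<close>

definition torus_fun :: "(real \<times> real \<Rightarrow> real) \<Rightarrow> bool" where
  "torus_fun f \<longleftrightarrow> (\<forall>x y. f (x + 1, y) = f (x, y) \<and> f (x, y + 1) = f (x, y))"

definition torus_cell :: "(real \<times> real) set" where
  "torus_cell = {0..<1} \<times> {0..<1}"

definition torus_C :: "(real \<times> real \<Rightarrow> real) set" where
  "torus_C = {f. torus_fun f \<and> continuous_on UNIV f}"

definition pd1 :: "(real \<times> real \<Rightarrow> real) \<Rightarrow> real \<times> real \<Rightarrow> real" where
  "pd1 f u = deriv (\<lambda>s. f (s, snd u)) (fst u)"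

definition pd2 :: "(real \<times> real \<Rightarrow> real) \<Rightarrow> real \<times> real \<Rightarrow> real" where
  "pd2 f u = deriv (\<lambda>s. f (fst u, s)) (snd u)"

definition C1 :: "(real \<times> real \<Rightarrow> real) \<Rightarrow> bool" where
  "C1 f \<longleftrightarrow>
     (\<forall>u. (\<lambda>s. f (s, snd u)) differentiable at (fst u) \<and>
          (\<lambda>s. f (fst u, s)) differentiable at (snd u)) \<and>
     continuous_on UNIV (pd1 f) \<and> continuous_on UNIV (pd2 f)"

definition torus_C2 :: "(real \<times> real \<Rightarrow> real) set" where
  "torus_C2 = {f. torus_fun f \<and> C1 f \<and> C1 (pd1 f) \<and> C1 (pd2 f)}"

definition laplacian :: "(real \<times> real \<Rightarrow> real) \<Rightarrow> real \<times> real \<Rightarrow> real" where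
  "laplacian f u = pd1 (pd1 f) u + pd2 (pd2 f) u"

definition weak_solution ::
  "real \<Rightarrow> (real \<times> real \<Rightarrow> real) \<Rightarrow> (real \<Rightarrow> real \<times> real \<Rightarrow> real) \<Rightarrow> bool" where
  "weak_solution T r \<rho> \<longleftrightarrow>
     (\<forall>t\<in>{0..T}. torus_fun (\<rho> t)) \<and>
     set_borel_measurable borel ({0..T} \<times> UNIV) (\<lambda>(t, u). \<rho> t u) \<and>
     (\<exists>C. \<forall>t\<in>{0..T}. \<forall>u. \<bar>\<rho> t u\<bar> \<le> C) \<and>
     (\<forall>f\<in>torus_C2. \<forall>t\<in>{0..T}.
        (LINT u:torus_cell|lborel. f u * \<rho> t u) =
        (LINT u:torus_cell|lborel. f u * r u) +
        (LINT s:{0..t}|lborel. (LINT u:torus_cell|lborel. \<rho> s u * laplacian f u)))"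


section \<open>The discrete torus\<close>

text \<open>The site \<open>(i, j)\<close> stands for the point \<open>(i / N, j / N)\<close> of the torus; see \<open>embed\<close>.\<close>

type_synonym site = "int \<times> int"
type_synonym config = "site \<Rightarrow> nat"

definition sites :: "nat \<Rightarrow> site set" where
  "sites N = {0..<int N} \<times> {0..<int N}"

definition embed :: "nat \<Rightarrow> site \<Rightarrow> real \<times> real" where
  "embed N x = (of_int (fst x) / of_nat N, of_int (snd x) / of_nat N)"

definition site_add :: "nat \<Rightarrow> site \<Rightarrow> site \<Rightarrow> site" where
  "site_add N x y = ((fst x + fst y) mod int N, (snd x + snd y) mod int N)"

definition site_diff :: "nat \<Rightarrow> site \<Rightarrow> site \<Rightarrow> site" where
  "site_diff N x y = ((fst x - fst y) mod int N, (snd x - snd y) mod int N)"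

definition e1 :: site where "e1 = (1, 0)"

definition e2 :: site where "e2 = (0, 1)"

definition edges :: "nat \<Rightarrow> (site \<times> site) set" where
  "edges N = {(x, y). x \<in> sites N \<and>
     y \<in> {site_add N x e1, site_diff N x e1, site_add N x e2, site_diff N x e2}}"

text \<open>A face is represented by its corner \<open>x\<close>, so that the translation by a face is the
  translation by its representative. For \<open>N \<ge> 3\<close> distinct corners give distinct faces.\<close>

definition anticlockwise :: "nat \<Rightarrow> site \<Rightarrow> site list" where
  "anticlockwise N x =
     [x, site_add N x e1, site_add N (site_add N x e1) e2, site_add N x e2, x]"

definition clockwise :: "nat \<Rightarrow> site \<Rightarrow> site list" where
  "clockwise N x = rev (anticlockwise N x)"

definition traverses :: "site list \<Rightarrow> site \<Rightarrow> site \<Rightarrow> bool" where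
  "traverses c x y \<longleftrightarrow> (\<exists>i. Suc i < length c \<and> c ! i = x \<and> c ! Suc i = y)"

definition face_plus :: "nat \<Rightarrow> site \<Rightarrow> site \<Rightarrow> site" where
  "face_plus N x y = (THE z. z \<in> sites N \<and> traverses (anticlockwise N z) x y)"

definition face_minus :: "nat \<Rightarrow> site \<Rightarrow> site \<Rightarrow> site" where
  "face_minus N x y = (THE z. z \<in> sites N \<and> traverses (clockwise N z) x y)"


section \<open>Configurations and the generator\<close>

definition configs :: "nat \<Rightarrow> config set" where
  "configs N = sites N \<rightarrow>\<^sub>E {0, 1}"

definition exchange :: "config \<Rightarrow> site \<Rightarrow> site \<Rightarrow> config" where
  "exchange \<eta> x y = \<eta>(x := \<eta> y, y := \<eta> x)"

definition translate :: "nat \<Rightarrow> site \<Rightarrow> config \<Rightarrow> config" where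
  "translate N x \<eta> = (\<lambda>z\<in>sites N. \<eta> (site_diff N z x))"

definition translate_fun :: "nat \<Rightarrow> site \<Rightarrow> (config \<Rightarrow> real) \<Rightarrow> config \<Rightarrow> real" where
  "translate_fun N x h \<eta> = h (translate N (site_diff N (0, 0) x) \<eta>)"

definition g :: "real \<Rightarrow> config \<Rightarrow> real" where
  "g \<alpha> \<eta> =
     (if \<eta> (0, 0) = 1 \<and> \<eta> (1, 1) = 1 \<and> \<eta> e1 = 0 \<and> \<eta> e2 = 0 then \<alpha>
      else if \<eta> e1 = 1 \<and> \<eta> e2 = 1 \<and> \<eta> (0, 0) = 0 \<and> \<eta> (1, 1) = 0 then \<alpha>
      else 0)"

definition rate :: "real \<Rightarrow> nat \<Rightarrow> site \<Rightarrow> site \<Rightarrow> config \<Rightarrow> real" where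
  "rate \<alpha> N x y \<eta> =
     real (\<eta> x) * (1 - real (\<eta> y)) +
     real (\<eta> x) * (translate_fun N (face_plus N x y) (g \<alpha>) \<eta> -
                   translate_fun N (face_minus N x y) (g \<alpha>) \<eta>)"

definition gen :: "real \<Rightarrow> nat \<Rightarrow> (config \<Rightarrow> real) \<Rightarrow> config \<Rightarrow> real" where
  "gen \<alpha> N f \<eta> = (\<Sum>(x, y)\<in>edges N. rate \<alpha> N x y \<eta> * (f (exchange \<eta> x y) - f \<eta>))"

definition empirical :: "nat \<Rightarrow> config \<Rightarrow> (real \<times> real) measure" where
  "empirical N \<eta> =
     distr (point_measure (sites N) (\<lambda>x. ennreal (real (\<eta> x) / (real N)\<^sup>2))) borel (embed N)"

definition associated :: "(nat \<Rightarrow> config pmf) \<Rightarrow> (real \<times> real \<Rightarrow> real) \<Rightarrow> bool" where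
  "associated \<mu> r \<longleftrightarrow>
     (\<forall>f\<in>torus_C. \<forall>\<epsilon>>0.
        (\<lambda>N. measure_pmf.prob (\<mu> N)
           {\<eta>. \<bar>(LINT u|empirical N \<eta>. f u) - (LINT u:torus_cell|lborel. f u * r u)\<bar> > \<epsilon>})
        \<longlonglongrightarrow> 0)"


section \<open>Continuous-time Markov processes on a finite state space\<close>

definition transition_semigroup :: "'s set \<Rightarrow> (real \<Rightarrow> 's \<Rightarrow> 's pmf) \<Rightarrow> bool" where
  "transition_semigroup S p \<longleftrightarrow>
     (\<forall>t\<ge>0. \<forall>x\<in>S. set_pmf (p t x) \<subseteq> S) \<and>
     (\<forall>x\<in>S. p 0 x = return_pmf x) \<and>
     (\<forall>s\<ge>0. \<forall>t\<ge>0. \<forall>x\<in>S. p (s + t) x = bind_pmf (p s x) (p t))"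

definition has_generator ::
  "'s set \<Rightarrow> (real \<Rightarrow> 's \<Rightarrow> 's pmf) \<Rightarrow> (('s \<Rightarrow> real) \<Rightarrow> 's \<Rightarrow> real) \<Rightarrow> bool" where
  "has_generator S p L \<longleftrightarrow>
     (\<forall>f. \<forall>x\<in>S. ((\<lambda>t. (measure_pmf.expectation (p t x) f - f x) / t) \<longlongrightarrow> L f x) (at_right 0))"

definition natural_filtration ::
  "'w measure \<Rightarrow> 's set \<Rightarrow> (real \<Rightarrow> 'w \<Rightarrow> 's) \<Rightarrow> real \<Rightarrow> 'w measure" where
  "natural_filtration M S X s =
     sigma (space M) {X u -` A \<inter> space M |u A. u \<in> {0..s} \<and> A \<subseteq> S}"

text \<open>\<open>X\<close>, on the probability space \<open>M\<close>, is a Markov process on \<open>[0,T]\<close> with finite state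
  space \<open>S\<close>, generator \<open>L\<close> and initial law \<open>\<mu>\<close>. No path regularity is required: the
  finite-dimensional distributions are already determined.\<close>

definition markov_process ::
  "'w measure \<Rightarrow> 's set \<Rightarrow> (('s \<Rightarrow> real) \<Rightarrow> 's \<Rightarrow> real) \<Rightarrow> 's pmf \<Rightarrow> real \<Rightarrow>
   (real \<Rightarrow> 'w \<Rightarrow> 's) \<Rightarrow> bool" where
  "markov_process M S L \<mu> T X \<longleftrightarrow>
     prob_space M \<and> finite S \<and>
     (\<forall>t\<in>{0..T}. X t \<in> measurable M (count_space S)) \<and>
     (\<forall>x\<in>S. measure M {\<omega> \<in> space M. X 0 \<omega> = x} = pmf \<mu> x) \<and>
     (\<exists>p. transition_semigroup S p \<and> has_generator S p L \<and>
        (\<forall>s\<in>{0..T}. \<forall>t\<in>{s..T}. \<forall>f :: 's \<Rightarrow> real.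
           AE \<omega> in M. real_cond_exp M (natural_filtration M S X s) (\<lambda>\<omega>. f (X t \<omega>)) \<omega> =
                       measure_pmf.expectation (p (t - s) (X s \<omega>)) f))"

end

theory Submission
  imports Defs
begin

text \<open>
  Since the extra rates are a discrete curl, they cancel in the drift of linear statistics: for
  \<open>e(u) = cos (2\<pi> k \<cdot> u + \<theta>)\<close> the empirical average \<open>F = \<langle>\<pi>\<^sup>N, e\<rangle>\<close> is an exact eigenfunction of the
  accelerated generator, whose eigenvalue converges to \<open>-4 \<pi>\<^sup>2 \<bar>k\<bar>\<^sup>2\<close>, while the carre du champ of \<open>F\<close> is
  \<open>O(N\<^sup>-\<^sup>2)\<close>. Integrating the two differential equations for \<open>P\<^sub>t F\<close> and \<open>P\<^sub>t F\<^sup>2\<close> yields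
  \<open>L\<^sup>2\<close> convergence of every Fourier mode, so neither martingales nor tightness are needed, and
  Stone-Weierstrass passes from trigonometric polynomials to continuous functions. The limit profile is
  the Gaussian average \<open>\<rho>\<^sub>t(u) = E \<rho>\<^sup>*(u + \<surd>(2t) Z)\<close>. That it is a weak solution, and the only one,
  reduces to modes because a bounded function with vanishing Fourier coefficients is null.
\<close>

section \<open>Drift and fluctuations of linear statistics\<close>

text \<open>The cancellation rests on two facts: reversing an edge exchanges its two faces, and
  \<open>g\<close> vanishes on a face unless the occupation numbers alternate around it, hence
  unless the two ends of each of its edges differ. The factor \<open>\<eta> x\<close> in front of
  the face terms therefore disappears once both directions of an edge are added, and each face value
  ends up multiplied by the increments of the test function around a closed cycle. What remains is
  the plain gradient with coefficient one per unordered edge; this is why the limit carries the full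
  Laplacian and the Gaussian has variance \<open>2 * t\<close> in each coordinate.

  The profile is only bounded and measurable, so no derivative may fall on it. The evolution
  identity is proved for Gaussian averages of the test function, by comparing Fourier coefficients,
  and is moved to the profile by adjointness. The constant mode has decay rate zero, so the
  estimates and time integrals are arranged without dividing by the rate.\<close>

lemma mod_succ:
  fixes a n :: int
  assumes "0 \<le> a" "a < n"
  shows "(a + 1) mod n = (if a + 1 = n then 0 else a + 1)"
    "(1 + a) mod n = (if a + 1 = n then 0 else a + 1)"
  using assms by (auto simp: add.commute)

lemma mod_pred:
  fixes a n :: int
  assumes "0 \<le> a" "a < n"
  shows "(a - 1) mod n = (if a = 0 then n - 1 else a - 1)"
  using assms by (auto simp: zmod_minus1)

section \<open>Arithmetic of the discrete torus and sums over oriented edges\<close>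

lemma sitesE:
  assumes "x \<in> sites N"
  obtains a b where "x = (a, b)" "0 \<le> a" "a < int N" "0 \<le> b" "b < int N"
  using assms by (auto simp: sites_def)

lemma site_add_sites [simp]: "N > 0 \<Longrightarrow> site_add N x a \<in> sites N"
  by (simp add: sites_def site_add_def)

lemma site_diff_sites [simp]: "N > 0 \<Longrightarrow> site_diff N x a \<in> sites N"
  by (simp add: sites_def site_diff_def)

lemma finite_sites [simp]: "finite (sites N)"
  by (simp add: sites_def)

lemma card_sites: "card (sites N) = N\<^sup>2"
  by (simp add: sites_def card_cartesian_product power2_eq_square)

lemma site_add_diff [simp]: "x \<in> sites N \<Longrightarrow> site_add N (site_diff N x a) a = x"
  by (erule sitesE) (simp add: site_add_def site_diff_def mod_add_left_eq)

lemma site_diff_add [simp]: "x \<in> sites N \<Longrightarrow> site_diff N (site_add N x a) a = x"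
  by (erule sitesE) (simp add: site_add_def site_diff_def mod_diff_left_eq)

lemma site_add_commute:
  "site_add N (site_add N x a) b = site_add N (site_add N x b) a"
  by (simp add: site_add_def mod_simps ac_simps)

lemma sum_site_add:
  assumes "N > 0"
  shows "(\<Sum>x\<in>sites N. h (site_add N x a)) = (\<Sum>x\<in>sites N. h x)"
  by (rule sum.reindex_bij_witness[where i = "\<lambda>x. site_diff N x a" and j = "\<lambda>x. site_add N x a"])
     (use assms in auto)

lemma edges_Sigma:
  "edges N = Sigma (sites N) (\<lambda>x. {site_add N x e1, site_diff N x e1, site_add N x e2, site_diff N x e2})"
  by (auto simp: edges_def)

text \<open>At \<open>N = 2\<close> the step by \<open>e1\<close> and its opposite reach the same
  site. From \<open>N = 3\<close> on the four neighbours differ, so a sum over the set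
  \<open>edges N\<close> splits into four sums over \<open>sites N\<close>, and the direction of an
  edge determines its faces.\<close>

lemma steps_distinct:
  assumes "x \<in> sites N" "N \<ge> 3"
  shows "distinct [site_add N x e1, site_diff N x e1, site_add N x e2, site_diff N x e2]"
  using assms
  by (elim sitesE) (auto simp: site_add_def site_diff_def e1_def e2_def mod_succ mod_pred)

lemma sum_edges:
  fixes h :: "site \<Rightarrow> site \<Rightarrow> real"
  assumes "N \<ge> 3"
  shows "(\<Sum>(x, y)\<in>edges N. h x y) =
    (\<Sum>x\<in>sites N. h x (site_add N x e1) + h x (site_diff N x e1) +
                   h x (site_add N x e2) + h x (site_diff N x e2))"
proof -
  have "(\<Sum>(x, y)\<in>edges N. h x y) =
    (\<Sum>x\<in>sites N. \<Sum>y\<in>{site_add N x e1, site_diff N x e1, site_add N x e2, site_diff N x e2}. h x y)"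
    unfolding edges_Sigma by (subst sum.Sigma) auto
  also have "\<dots> = (\<Sum>x\<in>sites N. h x (site_add N x e1) + h x (site_diff N x e1) +
                   h x (site_add N x e2) + h x (site_diff N x e2))"
    using steps_distinct[OF _ assms] by (intro sum.cong refl) (simp add: add.assoc)
  finally show ?thesis .
qed

section \<open>The faces on the two sides of an oriented edge\<close>

lemma ex_less_4:
  "(\<exists>i<Suc (Suc (Suc (Suc 0))). P i) \<longleftrightarrow>
    P 0 \<or> P (Suc 0) \<or> P (Suc (Suc 0)) \<or> P (Suc (Suc (Suc 0)))"
  by (auto simp: less_Suc_eq)

lemma traverses_anticlockwise:
  "traverses (anticlockwise N z) x y \<longleftrightarrow>
     x = z \<and> y = site_add N z e1 \<or>
     x = site_add N z e1 \<and> y = site_add N (site_add N z e1) e2 \<or>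
     x = site_add N (site_add N z e1) e2 \<and> y = site_add N z e2 \<or>
     x = site_add N z e2 \<and> y = z"
  unfolding traverses_def anticlockwise_def
  by (simp add: ex_less_4 eq_commute[of x] eq_commute[of y] disj_assoc)

lemma traverses_clockwise:
  "traverses (clockwise N z) x y \<longleftrightarrow> traverses (anticlockwise N z) y x"
  unfolding traverses_anticlockwise
  unfolding traverses_def clockwise_def anticlockwise_def
  by (simp add: ex_less_4 eq_commute[of x] eq_commute[of y]) blast

text \<open>The four sides of an oriented face point in four different directions, so the direction
  of an edge tells which side of the face it is, and hence where the corner lies. This is the
  uniqueness behind the definite descriptions \<open>face_plus\<close> and
  \<open>face_minus\<close>.\<close>

lemma traverses_corner:
  assumes "traverses (anticlockwise N z) x y" "z \<in> sites N" "N > 0"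
  shows "y = site_add N x e1 \<and> z = x \<or>
    y = site_add N x e2 \<and> z = site_diff N x e1 \<or>
    y = site_diff N x e1 \<and> z = site_diff N (site_diff N x e2) e1 \<or>
    y = site_diff N x e2 \<and> z = site_diff N x e2"
proof -
  have "site_diff N (site_add N (site_add N z e1) e2) e1 = site_add N z e2"
    using assms by (simp add: site_add_commute[of N z e1])
  then show ?thesis
    using assms unfolding traverses_anticlockwise by auto
qed

lemma face_eqI:
  assumes "z \<in> sites N" "traverses (anticlockwise N z) x y" "N \<ge> 3"
  shows "face_plus N x y = z" "face_minus N y x = z"
proof -
  have "x \<in> sites N"
    using assms by (auto simp: traverses_anticlockwise)
  note d = steps_distinct[OF this assms(3)]
  \<comment> \<open>Each candidate corner prescribes a direction from \<open>x\<close> to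
    \<open>y\<close>; by \<open>d\<close> both prescribe the same one, and then the corners
    agree.\<close>
  have *: "z' = z" if "z' \<in> sites N \<and> traverses (anticlockwise N z') x y" for z'
  proof -
    have "N > 0" "z' \<in> sites N" "traverses (anticlockwise N z') x y"
      using that assms by auto
    from traverses_corner[OF this(3,2,1)] traverses_corner[OF assms(2,1) this(1)] d
    show ?thesis by (elim disjE conjE) simp_all
  qed
  show "face_plus N x y = z"
    unfolding face_plus_def by (rule the_equality) (use assms * in blast)+
  show "face_minus N y x = z"
    unfolding face_minus_def traverses_clockwise by (rule the_equality) (use assms * in blast)+
qed

lemma face_step1:
  assumes "x \<in> sites N" "N \<ge> 3"
  shows "face_plus N x (site_add N x e1) = x" "face_minus N (site_add N x e1) x = x"
    "face_minus N x (site_add N x e1) = site_diff N x e2"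
    "face_plus N (site_add N x e1) x = site_diff N x e2"
proof -
  have "site_add N (site_add N (site_diff N x e2) e1) e2 = site_add N x e1"
    using assms by (subst site_add_commute) simp
  then have "traverses (anticlockwise N (site_diff N x e2)) (site_add N x e1) x"
    using assms by (simp add: traverses_anticlockwise)
  moreover have "traverses (anticlockwise N x) x (site_add N x e1)"
    by (simp add: traverses_anticlockwise)
  ultimately show "face_plus N x (site_add N x e1) = x" "face_minus N (site_add N x e1) x = x"
    "face_minus N x (site_add N x e1) = site_diff N x e2"
    "face_plus N (site_add N x e1) x = site_diff N x e2"
    using assms by (auto intro!: face_eqI)
qed

lemma face_step2:
  assumes "x \<in> sites N" "N \<ge> 3"
  shows "face_plus N x (site_add N x e2) = site_diff N x e1"
    "face_minus N (site_add N x e2) x = site_diff N x e1"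
    "face_minus N x (site_add N x e2) = x"
    "face_plus N (site_add N x e2) x = x"
proof -
  have "traverses (anticlockwise N (site_diff N x e1)) x (site_add N x e2)"
    using assms by (simp add: traverses_anticlockwise)
  moreover have "traverses (anticlockwise N x) (site_add N x e2) x"
    by (simp add: traverses_anticlockwise)
  ultimately show "face_plus N x (site_add N x e2) = site_diff N x e1"
    "face_minus N (site_add N x e2) x = site_diff N x e1"
    "face_minus N x (site_add N x e2) = x"
    "face_plus N (site_add N x e2) x = x"
    using assms by (auto intro!: face_eqI)
qed

section \<open>Currents through edges and the generator on linear statistics\<close>

definition face_g :: "real \<Rightarrow> nat \<Rightarrow> config \<Rightarrow> site \<Rightarrow> real" where
  "face_g \<alpha> N \<eta> x =
     (let a = \<eta> x; b = \<eta> (site_add N x e1); c = \<eta> (site_add N (site_add N x e1) e2);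
          d = \<eta> (site_add N x e2)
      in if a = 1 \<and> c = 1 \<and> b = 0 \<and> d = 0 \<or> b = 1 \<and> d = 1 \<and> a = 0 \<and> c = 0 then \<alpha> else 0)"

lemma translate_fun_g:
  assumes "x \<in> sites N" "N \<ge> 3"
  shows "translate_fun N x (g \<alpha>) \<eta> = face_g \<alpha> N \<eta> x"
proof -
  have *: "translate N (site_diff N (0, 0) x) \<eta> z = \<eta> (site_add N x z)" if "z \<in> sites N" for z
    using that by (simp add: translate_def site_diff_def site_add_def mod_diff_right_eq add.commute)
  have "site_add N x (0, 0) = x"
    using assms(1) by (elim sitesE) (simp add: site_add_def)
  moreover have "site_add N x (1, 1) = site_add N (site_add N x e1) e2"
    by (simp add: site_add_def e1_def e2_def mod_add_left_eq)
  moreover have "(0, 0) \<in> sites N" "(1, 1) \<in> sites N" "e1 \<in> sites N" "e2 \<in> sites N"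
    using assms(2) by (auto simp: sites_def e1_def e2_def)
  ultimately show ?thesis
    unfolding translate_fun_def g_def face_g_def Let_def by (simp add: *)
qed

lemma configs_01: "\<eta> \<in> configs N \<Longrightarrow> x \<in> sites N \<Longrightarrow> \<eta> x = 0 \<or> \<eta> x = 1"
  by (auto simp: configs_def)

text \<open>The reversed edge has \<open>p\<close> and \<open>m\<close> exchanged, so its face term
  is the opposite difference with prefactor \<open>\<eta> y\<close>. If the two ends agree, both
  sides vanish because neither face alternates; if they differ, exactly one direction is active, and
  the factor \<open>\<eta> x - \<eta> y\<close> restores the sign that the reversal changed. The
  result is a gradient plus a difference of two face values, with no occupation number multiplying
  the latter.\<close>

lemma symmetrized_rate:
  assumes "\<eta> x = 0 \<or> \<eta> x = 1" "\<eta> y = 0 \<or> \<eta> y = 1"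
    and "face_plus N x y = p" "face_minus N y x = p" "face_minus N x y = m" "face_plus N y x = m"
    and "p \<in> sites N" "m \<in> sites N" "N \<ge> 3"
    and "\<eta> x = \<eta> y \<Longrightarrow> face_g \<alpha> N \<eta> p = 0" "\<eta> x = \<eta> y \<Longrightarrow> face_g \<alpha> N \<eta> m = 0"
  shows "(real (\<eta> x) - real (\<eta> y)) * (rate \<alpha> N x y \<eta> + rate \<alpha> N y x \<eta>) =
    real (\<eta> x) - real (\<eta> y) + face_g \<alpha> N \<eta> p - face_g \<alpha> N \<eta> m"
  using assms(1,2,10,11) unfolding rate_def assms(3-6)
  by (auto simp: translate_fun_g assms(7-9) algebra_simps)

lemma current1:
  assumes "x \<in> sites N" "N \<ge> 3" "\<eta> \<in> configs N"
  defines "y \<equiv> site_add N x e1"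
  shows "(real (\<eta> x) - real (\<eta> y)) * (rate \<alpha> N x y \<eta> + rate \<alpha> N y x \<eta>) =
    real (\<eta> x) - real (\<eta> y) + face_g \<alpha> N \<eta> x - face_g \<alpha> N \<eta> (site_diff N x e2)"
proof -
  have "site_add N (site_add N (site_diff N x e2) e1) e2 = site_add N x e1"
    using assms by (subst site_add_commute) simp
  then show ?thesis
    unfolding y_def using assms(1,2) face_step1[OF assms(1,2)]
    by (intro symmetrized_rate configs_01[OF assms(3)]) (auto simp: face_g_def Let_def)
qed

lemma current2:
  assumes "x \<in> sites N" "N \<ge> 3" "\<eta> \<in> configs N"
  defines "y \<equiv> site_add N x e2"
  shows "(real (\<eta> x) - real (\<eta> y)) * (rate \<alpha> N x y \<eta> + rate \<alpha> N y x \<eta>) =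
    real (\<eta> x) - real (\<eta> y) + face_g \<alpha> N \<eta> (site_diff N x e1) - face_g \<alpha> N \<eta> x"
    unfolding y_def using assms(1,2) face_step2[OF assms(1,2)]
    by (intro symmetrized_rate configs_01[OF assms(3)])
       (auto simp: face_g_def Let_def site_add_commute[of N _ e1 e2])

text \<open>Backward steps are re-indexed as reversals of forward steps, so both orientations of an
  edge stand in one summand, which is the form in which the rates symmetrize.\<close>

lemma sum_edges_sym:
  fixes h :: "site \<Rightarrow> site \<Rightarrow> real"
  assumes "N \<ge> 3"
  shows "(\<Sum>(x, y)\<in>edges N. h x y) =
    (\<Sum>x\<in>sites N. h x (site_add N x e1) + h (site_add N x e1) x +
                   (h x (site_add N x e2) + h (site_add N x e2) x))"
proof -
  have "(\<Sum>x\<in>sites N. h x (site_diff N x a)) = (\<Sum>x\<in>sites N. h (site_add N x a) x)" for a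
    using assms by (subst sum_site_add[symmetric, where a = a]) auto
  then show ?thesis
    by (simp add: sum_edges[OF assms] sum.distrib)
qed

definition linear_stat :: "nat \<Rightarrow> (site \<Rightarrow> real) \<Rightarrow> config \<Rightarrow> real" where
  "linear_stat N a \<eta> = (\<Sum>x\<in>sites N. a x * real (\<eta> x))"

lemma linear_stat_exchange:
  assumes "x \<in> sites N" "y \<in> sites N"
  shows "linear_stat N a (exchange \<eta> x y) - linear_stat N a \<eta> =
    (a y - a x) * (real (\<eta> x) - real (\<eta> y))"
proof (cases "x = y")
  case False
  have "linear_stat N a (exchange \<eta> x y) = (\<Sum>z\<in>sites N. a z * real (\<eta> z) +
      (if x = z then a x * (real (\<eta> y) - real (\<eta> x)) else 0) +
      (if y = z then a y * (real (\<eta> x) - real (\<eta> y)) else 0))"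
    unfolding linear_stat_def using False
    by (intro sum.cong) (auto simp: exchange_def algebra_simps)
  also have "\<dots> = linear_stat N a \<eta> + a x * (real (\<eta> y) - real (\<eta> x)) +
      a y * (real (\<eta> x) - real (\<eta> y))"
    using assms by (simp add: sum.distrib linear_stat_def)
  finally show ?thesis by (simp add: algebra_simps)
qed (simp add: exchange_def)

text \<open>The current through an edge is a discrete gradient plus a discrete curl; the curl drops out
  after summation by parts, so linear statistics evolve as for the symmetric exclusion process.\<close>

lemma gen_linear_stat:
  assumes N: "N \<ge> 3" and \<eta>: "\<eta> \<in> configs N"
  shows "gen \<alpha> N (linear_stat N a) \<eta> = linear_stat N (\<lambda>x.
    a (site_add N x e1) + a (site_diff N x e1) + a (site_add N x e2) + a (site_diff N x e2) - 4 * a x) \<eta>"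
proof -
  have pos: "N > 0" using N by simp
  let ?s1 = "\<lambda>x. site_add N x e1" and ?s2 = "\<lambda>x. site_add N x e2"
  let ?G = "face_g \<alpha> N \<eta>" and ?h = "\<lambda>x. real (\<eta> x)"
  define h where "h x y = rate \<alpha> N x y \<eta> * ((a y - a x) * (?h x - ?h y))" for x y
  have "gen \<alpha> N (linear_stat N a) \<eta> = (\<Sum>(x, y)\<in>edges N. h x y)"
    unfolding gen_def h_def
    by (intro sum.cong refl) (use pos in \<open>auto simp: edges_Sigma linear_stat_exchange\<close>)
  also have "\<dots> = (\<Sum>x\<in>sites N.
      (a (?s1 x) - a x) * ((?h x - ?h (?s1 x)) * (rate \<alpha> N x (?s1 x) \<eta> + rate \<alpha> N (?s1 x) x \<eta>)) +
      (a (?s2 x) - a x) * ((?h x - ?h (?s2 x)) * (rate \<alpha> N x (?s2 x) \<eta> + rate \<alpha> N (?s2 x) x \<eta>)))"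
    unfolding sum_edges_sym[OF N] h_def by (intro sum.cong refl) algebra
  also have "\<dots> = (\<Sum>x\<in>sites N.
      (a (?s1 x) - a x) * (?h x - ?h (?s1 x) + ?G x - ?G (site_diff N x e2)) +
      (a (?s2 x) - a x) * (?h x - ?h (?s2 x) + ?G (site_diff N x e1) - ?G x))"
    by (intro sum.cong refl) (simp add: current1 current2 N \<eta>)
  also have "\<dots> = (\<Sum>x\<in>sites N. (a (?s1 x) - a x) * (?h x - ?h (?s1 x))) +
      (\<Sum>x\<in>sites N. (a (?s2 x) - a x) * (?h x - ?h (?s2 x))) +
      ((\<Sum>x\<in>sites N. (a (?s1 x) - a x) * ?G x - (a (?s2 x) - a x) * ?G x) -
       (\<Sum>x\<in>sites N. (a (?s1 x) - a x) * ?G (site_diff N x e2)) +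
       (\<Sum>x\<in>sites N. (a (?s2 x) - a x) * ?G (site_diff N x e1)))"
    by (simp add: sum.distrib[symmetric] sum_subtractf[symmetric] algebra_simps)
  \<comment> \<open>Both remaining sums are shifted so that every face value is attached to its own
    corner.\<close>
  also have "(\<Sum>x\<in>sites N. (a (?s1 x) - a x) * ?G (site_diff N x e2)) =
      (\<Sum>x\<in>sites N. (a (?s1 (?s2 x)) - a (?s2 x)) * ?G x)"
    by (subst sum_site_add[OF pos, symmetric, where a = e2]) simp
  also have "(\<Sum>x\<in>sites N. (a (?s2 x) - a x) * ?G (site_diff N x e1)) =
      (\<Sum>x\<in>sites N. (a (?s1 (?s2 x)) - a (?s1 x)) * ?G x)"
    by (subst sum_site_add[OF pos, symmetric, where a = e1]) (simp add: site_add_commute[of N _ e1 e2])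
  \<comment> \<open>The coefficient of \<open>?G x\<close> is now the sum of the increments of
    \<open>a\<close> along the anticlockwise cycle of the face at \<open>x\<close>, which is
    zero.\<close>
  also have "(\<Sum>x\<in>sites N. (a (?s1 x) - a x) * ?G x - (a (?s2 x) - a x) * ?G x) -
      (\<Sum>x\<in>sites N. (a (?s1 (?s2 x)) - a (?s2 x)) * ?G x) +
      (\<Sum>x\<in>sites N. (a (?s1 (?s2 x)) - a (?s1 x)) * ?G x) = 0"
    by (simp add: sum.distrib[symmetric] sum_subtractf[symmetric] algebra_simps)
  also have shift: "(\<Sum>x\<in>sites N. (a (site_add N x e) - a x) * (?h x - ?h (site_add N x e))) =
      (\<Sum>x\<in>sites N. (a (site_add N x e) + a (site_diff N x e) - 2 * a x) * ?h x)" for e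
  proof -
    have "(\<Sum>x\<in>sites N. (a (site_add N x e) - a x) * ?h (site_add N x e)) =
      (\<Sum>x\<in>sites N. (a x - a (site_diff N x e)) * ?h x)"
      by (subst sum_site_add[OF pos, symmetric, where a = e]) simp
    then show ?thesis
      by (simp add: algebra_simps sum.distrib sum_subtractf sum_distrib_left)
  qed
  finally show ?thesis
    unfolding linear_stat_def shift
    by (simp add: sum.distrib[symmetric] algebra_simps)
qed

section \<open>The carre du champ of a linear statistic\<close>

lemma gen_square:
  "gen \<alpha> N (\<lambda>\<eta>. (F \<eta>)\<^sup>2) \<eta> - 2 * F \<eta> * gen \<alpha> N F \<eta> =
     (\<Sum>(x, y)\<in>edges N. rate \<alpha> N x y \<eta> * (F (exchange \<eta> x y) - F \<eta>)\<^sup>2)"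
  unfolding gen_def sum_distrib_left sum_subtractf[symmetric]
  by (intro sum.cong refl) (auto simp: power2_eq_square algebra_simps)

lemma rate_bound:
  assumes "x \<in> sites N" "y \<in> sites N" "face_plus N x y \<in> sites N" "face_minus N x y \<in> sites N"
    and "\<bar>\<alpha>\<bar> \<le> 1" "N \<ge> 3" "\<eta> \<in> configs N"
  shows "\<bar>rate \<alpha> N x y \<eta>\<bar> \<le> 3"
proof -
  \<comment> \<open>The bound 3 consists of one for the exclusion part and one for each of the two
    faces.\<close>
  have "\<bar>face_g \<alpha> N \<eta> z\<bar> \<le> 1" for z
    using assms by (simp add: face_g_def Let_def)
  from this[of "face_plus N x y"] this[of "face_minus N x y"] show ?thesis
    using configs_01[OF assms(7,1)] configs_01[OF assms(7,2)] unfolding rate_def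
    by (auto simp: translate_fun_g assms)
qed

lemma edge_cases:
  assumes "(x, y) \<in> edges N" "N > 0"
  shows "x \<in> sites N \<and> y \<in> sites N \<and>
    (y = site_add N x e1 \<or> y = site_add N x e2 \<or> x = site_add N y e1 \<or> x = site_add N y e2)"
  using assms by (auto simp: edges_Sigma)

text \<open>There are \<open>4 * N\<^sup>2\<close> oriented edges, each with rate at most 3, and an
  exchange across an edge changes the statistic by at most \<open>K\<close>; this gives the factor
  12.\<close>

lemma square_field_bound:
  assumes N: "N \<ge> 3" and \<eta>: "\<eta> \<in> configs N" and \<alpha>: "\<bar>\<alpha>\<bar> \<le> 1"
    and a: "\<And>x y. (x, y) \<in> edges N \<Longrightarrow> \<bar>a y - a x\<bar> \<le> K"
  shows "gen \<alpha> N (\<lambda>\<eta>. (linear_stat N a \<eta>)\<^sup>2) \<eta> -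
    2 * linear_stat N a \<eta> * gen \<alpha> N (linear_stat N a) \<eta> \<le> 12 * (real N)\<^sup>2 * K\<^sup>2"
proof -
  have pos: "N > 0" using N by simp
  have "(\<Sum>(x, y)\<in>edges N. rate \<alpha> N x y \<eta> * (linear_stat N a (exchange \<eta> x y) - linear_stat N a \<eta>)\<^sup>2)
      \<le> (\<Sum>(x, y)\<in>edges N. 3 * K\<^sup>2)"
  proof (rule sum_mono, clarify)
    fix x y assume xy: "(x, y) \<in> edges N"
    note e = edge_cases[OF xy pos]
    have "face_plus N x y \<in> sites N \<and> face_minus N x y \<in> sites N"
      using e pos by (auto simp: face_step1 face_step2 N)
    then have r: "\<bar>rate \<alpha> N x y \<eta>\<bar> \<le> 3"
      using e \<alpha> N \<eta> by (intro rate_bound) auto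
    have "\<bar>real (\<eta> x) - real (\<eta> y)\<bar> \<le> 1"
      using configs_01[OF \<eta>, of x] configs_01[OF \<eta>, of y] e by auto
    then have "\<bar>(a y - a x) * (real (\<eta> x) - real (\<eta> y))\<bar> \<le> K * 1"
      unfolding abs_mult by (intro mult_mono a xy) (use a[OF xy] in auto)
    then have s: "((a y - a x) * (real (\<eta> x) - real (\<eta> y)))\<^sup>2 \<le> K\<^sup>2"
      by (metis abs_ge_zero mult.right_neutral power2_abs power_mono)
    show "rate \<alpha> N x y \<eta> * (linear_stat N a (exchange \<eta> x y) - linear_stat N a \<eta>)\<^sup>2 \<le> 3 * K\<^sup>2"
      using e r s by (simp add: linear_stat_exchange mult_mono)
  qed
  also have "\<dots> = 12 * (real N)\<^sup>2 * K\<^sup>2"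
    using sum_edges[OF N, of "\<lambda>_ _. 3 * K\<^sup>2"] by (simp add: card_sites)
  finally show ?thesis by (simp add: gen_square)
qed

section \<open>Markov semigroups on finite state spaces\<close>

locale finite_markov_semigroup =
  fixes S :: "'s set" and p :: "real \<Rightarrow> 's \<Rightarrow> 's pmf" and L :: "('s \<Rightarrow> real) \<Rightarrow> 's \<Rightarrow> real"
  assumes finite_S: "finite S"
    and semigroup: "transition_semigroup S p"
    and generator: "has_generator S p L"
begin

definition P :: "real \<Rightarrow> ('s \<Rightarrow> real) \<Rightarrow> 's \<Rightarrow> real" where
  "P t f x = measure_pmf.expectation (p t x) f"

lemma set_pmf_p: "t \<ge> 0 \<Longrightarrow> x \<in> S \<Longrightarrow> set_pmf (p t x) \<subseteq> S"
  using semigroup by (simp add: transition_semigroup_def)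

text \<open>Expectations become sums over the finite set \<open>S\<close>, so that linearity,
  monotonicity and the exchange of two averages raise no integrability question.\<close>

lemma P_sum:
  assumes "t \<ge> 0" "x \<in> S"
  shows "P t f x = (\<Sum>y\<in>S. pmf (p t x) y * f y)"
  unfolding P_def using set_pmf_p[OF assms] finite_S
  by (subst integral_measure_pmf[of S]) (auto simp: mult.commute)

lemma P_0: "x \<in> S \<Longrightarrow> P 0 f x = f x"
  using semigroup by (simp add: transition_semigroup_def P_def)

lemma P_cong:
  assumes "t \<ge> 0" "x \<in> S" "\<And>y. y \<in> S \<Longrightarrow> f y = h y"
  shows "P t f x = P t h x"
  using assms by (simp add: P_sum)

lemma P_diff:
  assumes "t \<ge> 0" "x \<in> S"
  shows "P t (\<lambda>y. f y - h y) x = P t f x - P t h x"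
  using assms by (simp add: P_sum algebra_simps sum_subtractf)

lemma P_cmult:
  assumes "t \<ge> 0" "x \<in> S"
  shows "P t (\<lambda>y. c * f y) x = c * P t f x"
  using assms by (simp add: P_sum algebra_simps sum_distrib_left)

lemma P_add:
  assumes "s \<ge> 0" "t \<ge> 0" "x \<in> S"
  shows "P (s + t) f x = P s (P t f) x"
proof -
  have bind: "p (s + t) x = bind_pmf (p s x) (p t)"
    using semigroup assms by (simp add: transition_semigroup_def)
  have "pmf (p (s + t) x) y = (\<Sum>z\<in>S. pmf (p s x) z * pmf (p t z) y)" for y
    unfolding bind pmf_bind using P_sum[OF assms(1,3), of "\<lambda>z. pmf (p t z) y"] by (simp add: P_def)
  then have "P (s + t) f x = (\<Sum>y\<in>S. (\<Sum>z\<in>S. pmf (p s x) z * pmf (p t z) y) * f y)"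
    using assms by (simp add: P_sum)
  also have "\<dots> = (\<Sum>z\<in>S. pmf (p s x) z * (\<Sum>y\<in>S. pmf (p t z) y * f y))"
    unfolding sum_distrib_left sum_distrib_right
    by (subst sum.swap) (simp add: mult.assoc)
  also have "\<dots> = P s (P t f) x"
    using assms by (simp add: P_sum)
  finally show ?thesis .
qed

lemma P_mono:
  assumes "t \<ge> 0" "x \<in> S" "\<And>y. y \<in> S \<Longrightarrow> f y \<le> h y"
  shows "P t f x \<le> P t h x"
  using assms by (auto simp: P_sum intro!: sum_mono mult_left_mono)

lemma P_const:
  assumes "t \<ge> 0" "x \<in> S"
  shows "P t (\<lambda>_. c) x = c"
  by (simp add: P_def)

lemma P_abs_bound:
  assumes "t \<ge> 0" "x \<in> S" "\<And>y. y \<in> S \<Longrightarrow> \<bar>f y\<bar> \<le> c"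
  shows "\<bar>P t f x\<bar> \<le> c"
proof -
  have "P t f x \<le> P t (\<lambda>_. c) x" "P t (\<lambda>_. - c) x \<le> P t f x"
    using assms by (force intro!: P_mono simp: abs_le_iff minus_le_iff)+
  then show ?thesis using assms by (simp add: P_const abs_le_iff)
qed

text \<open>\<open>has_generator\<close> gives a limit at each state separately. Finiteness of
  \<open>S\<close> makes it uniform, and only a uniform estimate survives averaging by
  \<open>P\<close>.\<close>

lemma generator_uniform:
  assumes "e > 0"
  shows "\<forall>\<^sub>F h in at_right 0. \<forall>x\<in>S. \<bar>(P h f x - f x) / h - L f x\<bar> < e"
  using generator assms unfolding has_generator_def P_def[symmetric]
  by (intro eventually_ball_finite finite_S ballI) (auto simp: tendsto_iff dist_real_def)

lemma strongly_continuous: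
  assumes "e > 0"
  shows "\<forall>\<^sub>F h in at_right 0. \<forall>x\<in>S. \<bar>P h f x - f x\<bar> < e"
proof (intro eventually_ball_finite finite_S ballI)
  fix x assume x: "x \<in> S"
  have "((\<lambda>h. h * ((P h f x - f x) / h)) \<longlongrightarrow> 0 * L f x) (at_right 0)"
    using generator x unfolding has_generator_def P_def[symmetric]
    by (intro tendsto_mult tendsto_ident_at) auto
  then have "\<forall>\<^sub>F h in at_right 0. \<bar>h * ((P h f x - f x) / h)\<bar> < e"
    using assms by (auto simp: tendsto_iff dist_real_def)
  moreover have "\<forall>\<^sub>F h in at_right (0::real). h > 0"
    by (simp add: eventually_at_filter)
  ultimately show "\<forall>\<^sub>F h in at_right 0. \<bar>P h f x - f x\<bar> < e"
    by eventually_elim auto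
qed

text \<open>The generator is a right derivative at time zero. The semigroup law carries it to every
  time, and strong continuity turns it into a two-sided derivative at positive times: this is the
  forward equation.\<close>

lemma P_has_derivative:
  assumes t: "t \<ge> 0" and x: "x \<in> S"
  shows "((\<lambda>t. P t f x) has_real_derivative P t (L f) x) (at t within {0..})"
  unfolding has_field_derivative_iff tendsto_iff dist_real_def
proof (intro allI impI)
  fix e :: real assume "e > 0"
  then have e: "e / 2 > 0" by simp
  from eventually_conj[OF generator_uniform[OF e, of f] strongly_continuous[OF e, of "L f"]]
  obtain d where d: "d > 0"
    and gen: "\<And>h x. 0 < h \<Longrightarrow> h < d \<Longrightarrow> x \<in> S \<Longrightarrow> \<bar>(P h f x - f x) / h - L f x\<bar> < e / 2"
    and cont: "\<And>h x. 0 < h \<Longrightarrow> h < d \<Longrightarrow> x \<in> S \<Longrightarrow> \<bar>P h (L f) x - L f x\<bar> < e / 2"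
    by (auto simp: eventually_at_right_field)
  show "\<forall>\<^sub>F s in at t within {0..}. \<bar>(P s f x - P t f x) / (s - t) - P t (L f) x\<bar> < e"
    unfolding eventually_at
  proof (intro exI[of _ "d / 2"] conjI ballI impI; (elim conjE)?)
    show "d / 2 > 0" using d by simp
    fix s assume s: "s \<in> {0..}" "s \<noteq> t" "dist s t < d / 2"
    \<comment> \<open>With the earlier time as base point, left and right difference quotients are
      both \<open>P m\<close> applied to a quotient at time zero. If \<open>s < t\<close>, the base
      point is not \<open>t\<close>, which costs the second error of \<open>e / 2\<close>.\<close>
    define m where "m = min s t"
    define h where "h = \<bar>s - t\<bar>"
    have m: "m \<ge> 0" and h: "h > 0" "h < d"
      using s t d by (auto simp: m_def h_def dist_real_def)
    have "(P s f x - P t f x) / (s - t) = (P (m + h) f x - P m f x) / h"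
      by (cases "s < t") (auto simp: m_def h_def field_simps)
    also have "\<dots> = P m (\<lambda>z. (P h f z - f z) / h) x"
      using m h x P_cmult[of m x "1 / h" "\<lambda>z. P h f z - f z"] by (simp add: P_add P_diff)
    finally have quot: "(P s f x - P t f x) / (s - t) = P m (\<lambda>z. (P h f z - f z) / h) x" .
    have "\<bar>P m (\<lambda>z. (P h f z - f z) / h - L f z) x\<bar> \<le> e / 2 "
      using gen[OF h] by (intro P_abs_bound m x) force
    then have 1: "\<bar>(P s f x - P t f x) / (s - t) - P m (L f) x\<bar> \<le> e / 2"
      unfolding quot by (simp add: P_diff m x)
    have "\<bar>P t (L f) x - P m (L f) x\<bar> < e / 2"
    proof (cases "s < t")
      case True
      then have "t = m + h" by (simp add: m_def h_def)
      then have "P t (L f) x - P m (L f) x = P m (\<lambda>z. P h (L f) z - L f z) x"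
        using m h x by (simp add: P_add P_diff)
      \<comment> \<open>Averaging yields only a weak inequality; passing through the maximum over
        the finite state space keeps the strict one.\<close>
      also have "\<bar>\<dots>\<bar> \<le> Max ((\<lambda>z. \<bar>P h (L f) z - L f z\<bar>) ` S)"
        by (intro P_abs_bound m x Max_ge) (auto simp: finite_S)
      also have "\<dots> < e / 2"
        using x cont[OF h] by (subst Max_less_iff) (auto simp: finite_S)
      finally show ?thesis .
    qed (use \<open>e > 0\<close> in \<open>simp add: m_def\<close>)
    with 1 show "\<bar>(P s f x - P t f x) / (s - t) - P t (L f) x\<bar> < e"
      by linarith
  qed
qed

lemma P_eigenfunction:
  assumes eigen: "\<And>x. x \<in> S \<Longrightarrow> L F x = - l * F x" and t: "t \<ge> 0" and x: "x \<in> S"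
  shows "P t F x = exp (- l * t) * F x"
proof -
  have "((\<lambda>s. exp (l * s) * P s F x) has_real_derivative 0) (at s within {0..})"
    if "s \<in> {0..}" for s
  proof -
    have "P s (L F) x = - l * P s F x"
      using that x P_cong[of s x "L F" "\<lambda>y. - l * F y"] P_cmult[of s x "- l" F] eigen by simp
    then show ?thesis
      using that x
      by (auto intro!: derivative_eq_intros P_has_derivative simp: algebra_simps)
  qed
  then have "\<exists>c. \<forall>s\<in>{0..}. exp (l * s) * P s F x = c"
    by (intro has_field_derivative_zero_constant convex_real_interval)
  then obtain c where c: "\<And>s. s \<in> {0..} \<Longrightarrow> exp (l * s) * P s F x = c"
    by blast
  have "exp (l * t) * P t F x = F x"
    using c[of t] c[of 0] t x by (simp add: P_0)
  then show ?thesis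
    by (simp add: exp_minus field_simps)
qed

text \<open>A Gronwall estimate. The error is left as \<open>C * t\<close> instead of the sharper
  quotient by \<open>l\<close>, so that the case \<open>l = 0\<close> of a constant mode is
  included.\<close>

lemma P_exponential_bound:
  assumes sub: "\<And>x. x \<in> S \<Longrightarrow> L G x \<le> - l * G x + C" and "l \<ge> 0" "C \<ge> 0"
    and t: "t \<ge> 0" and x: "x \<in> S"
  shows "P t G x \<le> exp (- l * t) * G x + C * t"
proof (cases "t = 0")
  case False
  \<comment> \<open>Subtracting \<open>C * s\<close> inside the integrating factor absorbs the
    constant: in the derivative only the nonpositive term \<open>- l * (C * s)\<close> is left after
    the bound on \<open>L G\<close>.\<close>
  define \<phi> where "\<phi> s = exp (l * s) * (P s G x - C * s)" for s
  define \<phi>' where "\<phi>' s = exp (l * s) * (l * P s G x + P s (L G) x - C - l * (C * s))" for s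
  have deriv: "(\<phi> has_real_derivative \<phi>' s) (at s within {0..})" if "s \<ge> 0" for s
    using that x unfolding \<phi>_def \<phi>'_def
    by (auto intro!: derivative_eq_intros P_has_derivative simp: algebra_simps)
  have neg: "\<phi>' s \<le> 0" if "s \<ge> 0" for s
  proof -
    have "P s (L G) x \<le> P s (\<lambda>x. C - l * G x) x"
      using that x sub by (intro P_mono) (auto simp: algebra_simps)
    also have "\<dots> = C - l * P s G x"
      using that x by (simp add: P_diff P_const P_cmult)
    finally have "P s (L G) x \<le> C - l * P s G x" .
    moreover have "l * (C * s) \<ge> 0"
      using assms that by simp
    ultimately show ?thesis
      unfolding \<phi>'_def by (intro mult_nonneg_nonpos) auto
  qed
  have "\<phi> t \<le> \<phi> 0"
  proof (rule DERIV_nonpos_imp_decreasing_open[where f = \<phi> and a = 0 and b = t])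
    show "0 \<le> t" using t .
    show "\<exists>y. DERIV \<phi> s :> y \<and> y \<le> 0" if "0 < s" "s < t" for s
      using deriv[of s] neg[of s] that at_within_interior[of s "{0..}"] by auto
    have "continuous_on {0..} \<phi>"
      using deriv by (auto intro: DERIV_continuous_on)
    then show "continuous_on {0..t} \<phi>"
      by (rule continuous_on_subset) auto
  qed
  then show ?thesis
    using x by (simp add: \<phi>_def P_0 exp_minus field_simps)
qed (use x in \<open>simp add: P_0\<close>)

text \<open>For an eigenfunction, the bound on the carre du champ says that \<open>F\<^sup>2\<close>
  is a subsolution with the doubled rate \<open>2 * l\<close>. Hence the second moment decays like
  the square of the mean, and the cross term completes a square: squared bias plus a variance of at
  most \<open>C * t\<close>. The centre \<open>m\<close> stays free, since the limiting coefficient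
  is inserted later.\<close>

lemma P_variance:
  assumes eigen: "\<And>x. x \<in> S \<Longrightarrow> L F x = - l * F x"
    and sub: "\<And>x. x \<in> S \<Longrightarrow> L (\<lambda>x. (F x)\<^sup>2) x - 2 * F x * L F x \<le> C"
    and "l \<ge> 0" "C \<ge> 0" and t: "t \<ge> 0" and x: "x \<in> S"
  shows "P t (\<lambda>y. (F y - m)\<^sup>2) x \<le> (exp (- l * t) * F x - m)\<^sup>2 + C * t"
proof -
  have "P t (\<lambda>y. (F y)\<^sup>2) x \<le> exp (- (2 * l) * t) * (F x)\<^sup>2 + C * t"
  proof (rule P_exponential_bound)
    fix z assume "z \<in> S"
    from sub[OF this] eigen[OF this] show "L (\<lambda>x. (F x)\<^sup>2) z \<le> - (2 * l) * (F z)\<^sup>2 + C"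
      by (simp add: power2_eq_square algebra_simps)
  qed (use assms in auto)
  moreover have "exp (- (2 * l) * t) = (exp (- l * t))\<^sup>2"
    by (simp add: power2_eq_square mult_exp_exp)
  moreover have "P t (\<lambda>y. (F y - m)\<^sup>2) x = P t (\<lambda>y. (F y)\<^sup>2) x - 2 * m * P t F x + m\<^sup>2"
  proof -
    have "P t (\<lambda>y. (F y - m)\<^sup>2) x = P t (\<lambda>y. (F y)\<^sup>2 - (2 * m * F y - m\<^sup>2)) x"
      by (intro P_cong t x) (simp add: power2_eq_square algebra_simps)
    also have "\<dots> = P t (\<lambda>y. (F y)\<^sup>2) x - (2 * m * P t F x - m\<^sup>2)"
      using t x by (simp add: P_diff P_cmult P_const)
    finally show ?thesis by simp
  qed
  moreover have "P t F x = exp (- l * t) * F x"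
    using P_eigenfunction[OF eigen t x] by simp
  ultimately show ?thesis
    by (simp add: power2_eq_square algebra_simps)
qed

end

section \<open>From the process to its semigroup\<close>

lemma subalgebra_natural_filtration_0:
  assumes "X 0 \<in> measurable M (count_space S)"
  shows "subalgebra M (natural_filtration M S X 0)"
proof -
  have "{X u -` A \<inter> space M |u A. u \<in> {0..0::real} \<and> A \<subseteq> S} \<subseteq> sets M"
    using measurable_sets[OF assms] by auto
  moreover have "{X u -` A \<inter> space M |u A. u \<in> {0..0::real} \<and> A \<subseteq> S} \<subseteq> Pow (space M)"
    by auto
  ultimately show ?thesis
    unfolding subalgebra_def natural_filtration_def
    by (auto intro: sets.sigma_sets_subset[THEN subsetD])
qed

lemma (in prob_space) integrable_finite_valued:
  fixes f :: "'s \<Rightarrow> real"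
  assumes X: "X \<in> measurable M (count_space S)" and "finite S"
  shows "integrable M (\<lambda>\<omega>. f (X \<omega>))"
proof (rule integrable_const_bound)
  show "AE \<omega> in M. norm (f (X \<omega>)) \<le> (\<Sum>x\<in>S. \<bar>f x\<bar>)"
    using measurable_space[OF X] \<open>finite S\<close>
    by (auto intro!: AE_I2 member_le_sum[of _ S "\<lambda>x. \<bar>f x\<bar>"])
  show "(\<lambda>\<omega>. f (X \<omega>)) \<in> borel_measurable M"
    by (rule measurable_compose[OF X]) simp
qed

text \<open>Averaging the Markov property between the times 0 and \<open>t\<close> removes the
  conditioning and expresses the law at time \<open>t\<close> by the initial law and the semigroup.
  The same \<open>p\<close> serves all \<open>f\<close>, so first and second moments can be
  compared.\<close>

lemma markov_process_expectation:
  assumes mp: "markov_process M S L \<mu> T X" and t: "t \<in> {0..T}" and \<mu>: "set_pmf \<mu> \<subseteq> S"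
  obtains p where "finite_markov_semigroup S p L"
    "\<And>f :: 's \<Rightarrow> real. (LINT \<omega>|M. f (X t \<omega>)) =
       measure_pmf.expectation \<mu> (\<lambda>x. measure_pmf.expectation (p t x) f)"
proof -
  from mp have M: "prob_space M" and fin: "finite S"
    and meas: "\<And>t. t \<in> {0..T} \<Longrightarrow> X t \<in> measurable M (count_space S)"
    and init: "\<And>x. x \<in> S \<Longrightarrow> measure M {\<omega> \<in> space M. X 0 \<omega> = x} = pmf \<mu> x"
    by (auto simp: markov_process_def)
  from mp obtain p where p: "transition_semigroup S p" "has_generator S p L"
    and cond: "\<And>s t f. s \<in> {0..T} \<Longrightarrow> t \<in> {s..T} \<Longrightarrow>
      AE \<omega> in M. real_cond_exp M (natural_filtration M S X s) (\<lambda>\<omega>. (f :: 's \<Rightarrow> real) (X t \<omega>)) \<omega> =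
                 measure_pmf.expectation (p (t - s) (X s \<omega>)) f"
    unfolding markov_process_def by blast
  interpret prob_space M by fact
  from t have 0: "0 \<in> {0..T}" by auto
  have integrable: "integrable M (\<lambda>\<omega>. f (X s \<omega>))" if "s \<in> {0..T}" for s and f :: "'s \<Rightarrow> real"
    by (rule integrable_finite_valued[OF meas[OF that] fin])
  interpret sub: finite_measure_subalgebra M "natural_filtration M S X 0"
    using subalgebra_natural_filtration_0[of X M S, OF meas[OF 0]]
    by unfold_locales
  have "(LINT \<omega>|M. f (X t \<omega>)) = measure_pmf.expectation \<mu> (\<lambda>x. measure_pmf.expectation (p t x) f)"
    for f :: "'s \<Rightarrow> real"
  proof -
    let ?F = "\<lambda>x. measure_pmf.expectation (p t x) f"
    have "(LINT \<omega>|M. f (X t \<omega>)) =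
        (LINT \<omega>|M. real_cond_exp M (natural_filtration M S X 0) (\<lambda>\<omega>. f (X t \<omega>)) \<omega>)"
      using sub.real_cond_exp_int(2)[OF integrable[OF t]] by simp
    also have "\<dots> = (LINT \<omega>|M. ?F (X 0 \<omega>))"
      using cond[OF 0, of t f] t integrable[OF 0, of ?F]
      by (intro integral_cong_AE) auto
    \<comment> \<open>The initial law is prescribed through the probabilities of single states, so
      the integrand is decomposed over the finitely many values of \<open>X 0\<close>.\<close>
    also have "\<dots> = (LINT \<omega>|M. (\<Sum>x\<in>S. ?F x * indicator {\<omega> \<in> space M. X 0 \<omega> = x} \<omega>))"
    proof (rule Bochner_Integration.integral_cong[OF refl])
      fix \<omega> assume \<omega>: "\<omega> \<in> space M"
      then have "(\<Sum>x\<in>S. ?F x * indicator {\<omega> \<in> space M. X 0 \<omega> = x} \<omega>) =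
          (\<Sum>x\<in>S. if X 0 \<omega> = x then ?F x else 0)"
        by (intro sum.cong) (auto simp: indicator_def)
      then show "?F (X 0 \<omega>) = (\<Sum>x\<in>S. ?F x * indicator {\<omega> \<in> space M. X 0 \<omega> = x} \<omega>)"
        using measurable_space[OF meas[OF 0] \<omega>] fin by simp
    qed
    also have "\<dots> = (\<Sum>x\<in>S. ?F x * pmf \<mu> x)"
    proof -
      have "{\<omega> \<in> space M. X 0 \<omega> = x} \<in> sets M" if "x \<in> S" for x
        using measurable_sets[OF meas[OF 0], of "{x}"] that
        by (auto simp: vimage_def Int_def conj_commute)
      then show ?thesis
        by (subst Bochner_Integration.integral_sum) (auto simp: init less_top[symmetric])
    qed
    also have "\<dots> = measure_pmf.expectation \<mu> ?F"
      using \<mu> fin by (subst integral_measure_pmf[of S]) (auto simp: mult.commute)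
    finally show ?thesis .
  qed
  moreover have "finite_markov_semigroup S p L"
    by unfold_locales (use fin p in auto)
  ultimately show ?thesis using that by blast
qed

section \<open>Fourier modes on the torus\<close>

text \<open>The free phase \<open>\<theta>\<close> covers sines as well as cosines with real-valued
  functions. The family is closed under translation, products become sums of two modes, and a
  derivative is a factor together with a phase shift by \<open>pi / 2\<close>.\<close>

definition mode :: "int \<times> int \<Rightarrow> real \<Rightarrow> real \<times> real \<Rightarrow> real" where
  "mode k \<theta> u = cos (2 * pi * (of_int (fst k) * fst u + of_int (snd k) * snd u) + \<theta>)"

lemma cos_add_2pi_int: "cos (x + 2 * pi * of_int n) = cos x"
  by (simp add: cos_add cos_int_2pin sin_int_2pin)

lemma mode_mult:
  "mode k \<theta> u * mode l \<phi> u = (1/2) * mode (k + l) (\<theta> + \<phi>) u + (1/2) * mode (k - l) (\<theta> - \<phi>) u"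
proof -
  define a where "a = 2 * pi * (of_int (fst k) * fst u + of_int (snd k) * snd u) + \<theta>"
  define b where "b = 2 * pi * (of_int (fst l) * fst u + of_int (snd l) * snd u) + \<phi>"
  have "mode (k + l) (\<theta> + \<phi>) u = cos (a + b)" "mode (k - l) (\<theta> - \<phi>) u = cos (a - b)"
    by (auto simp: mode_def a_def b_def algebra_simps intro!: arg_cong[of _ _ cos])
  then show ?thesis
    by (simp add: mode_def cos_times_cos flip: a_def b_def)
qed

lemma mode_abs_le_1: "\<bar>mode k \<theta> u\<bar> \<le> 1"
  by (simp add: mode_def)

lemma continuous_on_mode: "continuous_on A (mode k \<theta>)"
  unfolding mode_def by (intro continuous_intros)

lemma borel_measurable_mode [measurable]: "mode k \<theta> \<in> borel_measurable borel"
  by (intro borel_measurable_continuous_onI continuous_on_mode)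

inductive_set trig :: "(real \<times> real \<Rightarrow> real) set" where
  mode: "mode k \<theta> \<in> trig"
| scale: "f \<in> trig \<Longrightarrow> (\<lambda>u. c * f u) \<in> trig"
| add: "f \<in> trig \<Longrightarrow> h \<in> trig \<Longrightarrow> (\<lambda>u. f u + h u) \<in> trig"

lemma trig_const: "(\<lambda>_. c) \<in> trig"
  using trig.scale[OF trig.mode[of 0 0], of c] by (simp add: mode_def)

lemma trig_mult:
  assumes "f \<in> trig" "h \<in> trig"
  shows "(\<lambda>u. f u * h u) \<in> trig"
  using assms(1)
proof induction
  case (mode k \<theta>)
  show ?case
    using assms(2)
  proof induction
    case (mode l \<phi>)
    show ?case unfolding mode_mult by (intro trig.intros)
  next
    case (scale f c)
    then show ?case using trig.scale[of "\<lambda>u. mode k \<theta> u * f u" c] by (simp add: mult.left_commute)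
  next
    case (add f h)
    then show ?case using trig.add[of "\<lambda>u. mode k \<theta> u * f u"] by (simp add: distrib_left)
  qed
next
  case (scale f c)
  then show ?case using trig.scale[of "\<lambda>u. f u * h u" c] by (simp add: mult.assoc)
next
  case (add f1 f2)
  then show ?case using trig.add[of "\<lambda>u. f1 u * h u"] by (simp add: distrib_right)
qed

lemma continuous_on_trig: "f \<in> trig \<Longrightarrow> continuous_on A f"
  by (induction rule: trig.induct) (auto intro!: continuous_intros continuous_on_mode)

section \<open>Density of trigonometric polynomials in the continuous periodic functions\<close>

lemma periodic_of_int:
  fixes h :: "real \<Rightarrow> 'a"
  assumes "\<And>x. h (x + 1) = h x"
  shows "h (x + of_int n) = h x"
proof (induction n rule: int_induct[where k = 0])
  case (step1 i)
  then show ?case using assms[of "x + of_int i"] by (simp add: algebra_simps)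
next
  case (step2 i)
  then show ?case using assms[of "x + of_int i - 1"] by (simp add: algebra_simps)
qed simp

lemma torus_fun_of_int:
  assumes "torus_fun f"
  shows "f (x + of_int m, y + of_int n) = f (x, y)"
  using periodic_of_int[of "\<lambda>x. f (x, y + of_int n)" x m] periodic_of_int[of "\<lambda>y. f (x, y)" y n] assms
  by (simp add: torus_fun_def)

lemma torus_fun_frac:
  assumes "torus_fun f"
  shows "f (frac x, frac y) = f (x, y)"
  using torus_fun_of_int[OF assms, of x "- \<lfloor>x\<rfloor>" y "- \<lfloor>y\<rfloor>"] by (simp add: frac_def)

text \<open>The usual embedding of the torus as a product of two circles. Periodic functions live on
  the noncompact plane, whereas Stone-Weierstrass needs a compact space whose points the algebra
  separates; the range of this map is one.\<close>

definition torus_map :: "real \<times> real \<Rightarrow> complex \<times> complex" where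
  "torus_map u = (cis (2 * pi * fst u), cis (2 * pi * snd u))"

lemma continuous_on_torus_map: "continuous_on A torus_map"
  unfolding torus_map_def by (intro continuous_intros)

lemma cis_2pi_eq:
  assumes "cis (2 * pi * x) = cis (2 * pi * y)"
  obtains n :: int where "x = y + of_int n"
proof -
  have "cos (2 * pi * x) = cos (2 * pi * y)" "sin (2 * pi * x) = sin (2 * pi * y)"
    using assms by (auto simp: complex_eq_iff)
  then obtain n :: int where "2 * pi * x = 2 * pi * y + 2 * pi * of_int n"
    by (metis sin_cos_eq_iff)
  then have "2 * pi * x = 2 * pi * (y + of_int n)"
    by (simp add: distrib_left)
  then show ?thesis using that by simp
qed

lemma torus_map_eqD:
  assumes "torus_fun f" "torus_map u = torus_map v"
  shows "f u = f v"
proof -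
  from assms obtain m n :: int where "fst u = fst v + of_int m" "snd u = snd v + of_int n"
    unfolding torus_map_def prod.inject by (metis cis_2pi_eq)
  then show ?thesis
    using torus_fun_of_int[OF assms(1), of "fst v" m "snd v" n] by (metis prod.collapse)
qed


lemma torus_map_frac: "torus_map (frac x, frac y) = torus_map (x, y)"
proof -
  have "cis (2 * pi * frac x) = cis (2 * pi * x)" for x
    by (simp add: frac_def right_diff_distrib complex_eq_iff cos_diff sin_diff cos_int_2pin sin_int_2pin)
  then show ?thesis by (simp add: torus_map_def)
qed

lemma range_torus_map: "range torus_map = torus_map ` ({0..1} \<times> {0..1})"
proof -
  have "torus_map u \<in> torus_map ` ({0..1} \<times> {0..1})" for u
    using torus_map_frac[of "fst u" "snd u"] frac_lt_1[of "fst u"] frac_lt_1[of "snd u"]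
    by (intro image_eqI[of _ _ "(frac (fst u), frac (snd u))"]) auto
  then show ?thesis by auto
qed

lemma compact_range_torus_map: "compact (range torus_map)"
  unfolding range_torus_map
  by (intro compact_continuous_image continuous_on_torus_map compact_Times compact_Icc)

definition torus_factor :: "(real \<times> real \<Rightarrow> real) \<Rightarrow> complex \<times> complex \<Rightarrow> real" where
  "torus_factor f z = f (SOME u. torus_map u = z)"

lemma torus_factor:
  assumes "torus_fun f"
  shows "torus_factor f (torus_map u) = f u"
  unfolding torus_factor_def by (rule torus_map_eqD[OF assms]) (rule someI, rule refl)

text \<open>The quotient argument: the preimage of a closed set under the factor is the image of a
  closed subset of the unit square, which is compact, so it is compact and therefore closed.\<close>

lemma continuous_on_torus_factor:
  assumes "f \<in> torus_C"
  shows "continuous_on (range torus_map) (torus_factor f)"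
proof -
  have f: "torus_fun f" "continuous_on UNIV f"
    using assms by (auto simp: torus_C_def)
  have "closed (torus_factor f -` B \<inter> range torus_map)" if "closed B" for B
  proof -
    have "torus_factor f -` B \<inter> range torus_map = torus_map ` (f -` B \<inter> ({0..1} \<times> {0..1}))"
      using torus_factor[OF f(1)] by (subst range_torus_map) (auto intro!: imageI)
    moreover have "compact (f -` B \<inter> ({0..1} \<times> {0..1}))"
      using that f by (intro closed_Int_compact compact_Times compact_Icc continuous_closed_vimage)
        (auto simp: continuous_on_eq_continuous_at)
    ultimately show ?thesis
      by (auto intro!: compact_imp_closed compact_continuous_image continuous_on_torus_map)
  qed
  then show ?thesis
    using compact_imp_closed[OF compact_range_torus_map] by (subst continuous_on_closed_vimage) auto
qed

lemma trig_dense: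
  assumes f: "f \<in> torus_C" and e: "e > 0"
  obtains q where "q \<in> trig" "\<And>u. \<bar>f u - q u\<bar> < e"
proof -
  define R where "R = {h. continuous_on (range torus_map) h \<and> (\<lambda>u. h (torus_map u)) \<in> trig}"
  have coord: "(\<lambda>z. Re (fst z)) \<in> R" "(\<lambda>z. Im (fst z)) \<in> R" "(\<lambda>z. Re (snd z)) \<in> R" "(\<lambda>z. Im (snd z)) \<in> R"
  proof -
    \<comment> \<open>The four real coordinates pull back to modes, the sines through the phase
      \<open>- pi / 2\<close>. They already separate the points.\<close>
    have "(\<lambda>u. cos (2 * pi * fst u)) = mode (1, 0) 0" "(\<lambda>u. sin (2 * pi * fst u)) = mode (1, 0) (- pi / 2)"
      "(\<lambda>u. cos (2 * pi * snd u)) = mode (0, 1) 0" "(\<lambda>u. sin (2 * pi * snd u)) = mode (0, 1) (- pi / 2)"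
      by (auto simp: mode_def fun_eq_iff cos_diff)
    then show "(\<lambda>z. Re (fst z)) \<in> R" "(\<lambda>z. Im (fst z)) \<in> R" "(\<lambda>z. Re (snd z)) \<in> R" "(\<lambda>z. Im (snd z)) \<in> R"
      by (auto simp: R_def torus_map_def trig.mode intro!: continuous_intros)
  qed
  interpret function_ring_on R "range torus_map"
  proof
    show "compact (range torus_map)" by (rule compact_range_torus_map)
    show "\<exists>f\<in>R. f z \<noteq> f w" if "z \<noteq> w" for z w
      using that coord by (metis complex_eq_iff prod_eq_iff)
  qed (auto simp: R_def intro!: continuous_intros trig.add trig_mult trig_const)
  obtain h where "h \<in> R" "\<And>z. z \<in> range torus_map \<Longrightarrow> \<bar>torus_factor f z - h z\<bar> < e"
    using Stone_Weierstrass_basic[OF continuous_on_torus_factor[OF f] e] by blast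
  then have "(\<lambda>u. h (torus_map u)) \<in> trig" "\<And>u. \<bar>f u - h (torus_map u)\<bar> < e"
    using f torus_factor[of f] unfolding R_def torus_C_def by (blast, metis (mono_tags) mem_Collect_eq rangeI)
  then show ?thesis using that by blast
qed

section \<open>Integration over the fundamental cell\<close>

definition cell1 :: "real measure" where
  "cell1 = density lborel (\<lambda>x. ennreal (indicator {0..<1} x))"

text \<open>A density rather than a restriction of Lebesgue measure: the sigma algebra and the space
  remain those of the plane, so functions defined on the whole plane are measurable without
  reference to the cell.\<close>

definition cell :: "(real \<times> real) measure" where
  "cell = density lborel (\<lambda>x. ennreal (indicator torus_cell x))"

lemma sets_cell1 [simp, measurable_cong]: "sets cell1 = sets borel"
  by (simp add: cell1_def)

lemma space_cell1 [simp]: "space cell1 = UNIV"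
  by (simp add: cell1_def)

lemma sets_cell [simp, measurable_cong]: "sets cell = sets borel"
  by (simp add: cell_def)

lemma space_cell [simp]: "space cell = UNIV"
  by (simp add: cell_def)

lemma torus_cell_borel [measurable]: "torus_cell \<in> sets borel"
  unfolding torus_cell_def borel_prod[symmetric] by simp

interpretation cell1: prob_space cell1
  by standard (simp add: cell1_def emeasure_density ennreal_indicator)

lemma cell_pair: "cell = cell1 \<Otimes>\<^sub>M cell1"
proof -
  have "sigma_finite_measure (density lborel (\<lambda>x::real. ennreal (indicator {0..<1} x)))"
    using cell1.sigma_finite_measure_axioms by (simp add: cell1_def)
  moreover have "(\<lambda>(x, y). ennreal (indicator {0..<1} x) * ennreal (indicator {0..<1} y)) =
      (\<lambda>u. ennreal (indicator torus_cell u))"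
    by (auto simp: fun_eq_iff indicator_def torus_cell_def)
  ultimately show ?thesis
    unfolding cell1_def cell_def
    by (subst pair_measure_density)
       (simp_all add: lborel_prod lborel.sigma_finite_measure_axioms)
qed

interpretation cell1_pair: pair_prob_space cell1 cell1 ..

lemma prob_space_cell: "prob_space cell"
  unfolding cell_pair by (rule cell1_pair.prob_space_axioms)

lemma integrable_cell:
  fixes f :: "real \<times> real \<Rightarrow> real"
  assumes "f \<in> borel_measurable borel" "\<And>u. \<bar>f u\<bar> \<le> C"
  shows "integrable cell f"
proof -
  interpret prob_space cell by (rule prob_space_cell)
  show ?thesis using assms by (intro integrable_const_bound[of _ C]) auto
qed

lemma set_integral_cell:
  fixes f :: "real \<times> real \<Rightarrow> real"
  assumes "f \<in> borel_measurable borel"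
  shows "(LINT u:torus_cell|lborel. f u) = (LINT u|cell. f u)"
  unfolding set_lebesgue_integral_def cell_def
  using assms by (subst integral_density) auto

lemma integral_cell_iterated:
  fixes f :: "real \<times> real \<Rightarrow> real"
  assumes "f \<in> borel_measurable borel" "\<And>u. \<bar>f u\<bar> \<le> C"
  shows "(LINT u|cell. f u) = (LINT x|cell1. LINT y|cell1. f (x, y))"
    "(LINT u|cell. f u) = (LINT y|cell1. LINT x|cell1. f (x, y))"
  using cell1_pair.integral_fst'[of f] cell1_pair.integral_snd[of "\<lambda>x y. f (x, y)"] integrable_cell[OF assms]
  by (simp_all add: cell_pair)

lemma integral_cell1_shift:
  fixes h :: "real \<Rightarrow> real"
  assumes per: "\<And>x. h (x + 1) = h x" and [measurable]: "h \<in> borel_measurable borel"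
    and bound: "\<And>x. \<bar>h x\<bar> \<le> C"
  shows "(LINT x|cell1. h (x + a)) = (LINT x|cell1. h x)"
proof -
  define b where "b = frac a"
  have b: "0 \<le> b" "b < 1" by (simp_all add: b_def frac_lt_1)
  have cell1: "(LINT x|cell1. k x) = (LINT x|lborel. indicator {0..<1} x * k x)"
    if "k \<in> borel_measurable borel" for k :: "real \<Rightarrow> real"
    unfolding cell1_def using that by (subst integral_density) auto
  have int: "integrable lborel (\<lambda>x. indicator {c..<d} x * h x)" for c d
  proof (rule Bochner_Integration.integrable_bound)
    show "integrable lborel (\<lambda>x. C * indicator {c..<d} x)"
      by (cases "c \<le> d") auto
    show "AE x in lborel. norm (indicator {c..<d} x * h x) \<le> norm (C * indicator {c..<d} x)"
      using bound order_trans[OF abs_ge_self[of "C"]] 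
      by (auto simp: indicator_def intro!: AE_I2 order_trans[OF bound])
  qed measurable
  have "h (x + a) = h (x + b)" for x
    using periodic_of_int[of h "x + b" "\<lfloor>a\<rfloor>"] per by (simp add: b_def frac_def)
  then have "(LINT x|cell1. h (x + a)) = (LINT x|lborel. indicator {0..<1} x * h (x + b))"
    by (simp add: cell1)
  \<comment> \<open>The shifted period is cut at 1; periodicity moves the overhang back to the
    missing piece from 0 to \<open>b\<close>.\<close>
  also have "\<dots> = (LINT x|lborel. indicator {b..<1} x * h x + indicator {1..<1+b} x * h x)"
    by (subst lborel_integral_real_affine[where c = 1 and t = "- b"])
       (use b in \<open>auto simp: indicator_def intro!: Bochner_Integration.integral_cong\<close>)
  also have "\<dots> = (LINT x|lborel. indicator {b..<1} x * h x) + (LINT x|lborel. indicator {1..<1+b} x * h x)"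
    by (intro Bochner_Integration.integral_add int)
  also have "(LINT x|lborel. indicator {1..<1+b} x * h x) = (LINT x|lborel. indicator {0..<b} x * h x)"
    by (subst lborel_integral_real_affine[where c = 1 and t = "1"])
       (use b per in \<open>auto simp: indicator_def add.commute intro!: Bochner_Integration.integral_cong\<close>)
  also have "(LINT x|lborel. indicator {b..<1} x * h x) + \<dots> =
      (LINT x|lborel. indicator {b..<1} x * h x + indicator {0..<b} x * h x)"
    by (intro Bochner_Integration.integral_add[symmetric] int)
  also have "\<dots> = (LINT x|cell1. h x)"
    by (subst cell1) (use b in \<open>auto simp: indicator_def intro!: Bochner_Integration.integral_cong\<close>)
  finally show ?thesis .
qed

lemma integral_cell_shift:
  fixes h :: "real \<times> real \<Rightarrow> real"
  assumes per: "torus_fun h" and [measurable]: "h \<in> borel_measurable borel"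
    and bound: "\<And>u. \<bar>h u\<bar> \<le> C"
  shows "(LINT u|cell. h (u + v)) = (LINT u|cell. h u)"
proof -
  obtain a b where v: "v = (a, b)" by (cases v)
  have [measurable]: "h \<in> borel_measurable (borel \<Otimes>\<^sub>M borel)"
    by (simp add: borel_prod)
  have "(LINT u|cell. h (u + v)) = (LINT x|cell1. LINT y|cell1. h (x + a, y + b))"
    using bound by (subst integral_cell_iterated(1)[of _ C]) (auto simp: v)
  also have "\<dots> = (LINT x|cell1. LINT y|cell1. h (x + a, y))"
    using per bound
    by (intro Bochner_Integration.integral_cong refl integral_cell1_shift[of _ C]) (auto simp: torus_fun_def)
  \<comment> \<open>Folding back into a planar integral permits the opposite order of integration,
    so that the other coordinate becomes the inner one.\<close>
  also have "\<dots> = (LINT u|cell. h (u + (a, 0)))"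
    using bound by (subst integral_cell_iterated(1)[of _ C]) auto
  also have "\<dots> = (LINT y|cell1. LINT x|cell1. h (x + a, y))"
    using bound by (subst integral_cell_iterated(2)[of _ C]) auto
  also have "\<dots> = (LINT y|cell1. LINT x|cell1. h (x, y))"
    using per bound
    by (intro Bochner_Integration.integral_cong refl integral_cell1_shift[of _ C]) (auto simp: torus_fun_def)
  also have "\<dots> = (LINT u|cell. h u)"
    using bound by (subst integral_cell_iterated(2)[of _ C]) auto
  finally show ?thesis .
qed

lemma trig_bounded:
  assumes "q \<in> trig"
  shows "\<exists>B. \<forall>u. \<bar>q u\<bar> \<le> B"
  using assms
proof induction
  case (mode k \<theta>)
  then show ?case using mode_abs_le_1 by blast
next
  case (scale f c)
  then obtain B where "\<And>u. \<bar>f u\<bar> \<le> B" by blast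
  then have "\<bar>c * f u\<bar> \<le> \<bar>c\<bar> * B" for u
    by (simp add: abs_mult mult_left_mono)
  then show ?case by blast
next
  case (add f h)
  then obtain B B' where "\<And>u. \<bar>f u\<bar> \<le> B" "\<And>u. \<bar>h u\<bar> \<le> B'" by blast
  then have "\<bar>f u + h u\<bar> \<le> B + B'" for u
    by (metis abs_triangle_ineq add_mono order_trans)
  then show ?case by blast
qed

text \<open>Obtained from density: \<open>f\<close> is within distance 1 of a trigonometric
  polynomial, and those are bounded by construction.\<close>

lemma torus_C_bounded:
  assumes "f \<in> torus_C"
  obtains B where "B > 0" "\<And>u. \<bar>f u\<bar> \<le> B"
proof -
  obtain q where "q \<in> trig" and q: "\<And>u. \<bar>f u - q u\<bar> < 1"
    using trig_dense[OF assms, of 1] by auto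
  then obtain B where B: "\<And>u. \<bar>q u\<bar> \<le> B"
    using trig_bounded by blast
  have "\<bar>f u\<bar> \<le> \<bar>B\<bar> + 1" for u
    using B[of u] q[of u] by linarith
  then show ?thesis using that[of "\<bar>B\<bar> + 1"] by simp
qed

lemma torus_C_measurable: "f \<in> torus_C \<Longrightarrow> f \<in> borel_measurable borel"
  by (simp add: torus_C_def borel_measurable_continuous_onI)

lemma torus_fun_mode: "torus_fun (mode k \<theta>)"
proof -
  have "mode k \<theta> (x + 1, y) = mode k \<theta> (x, y)" for x y
    using cos_add_2pi_int[of "2 * pi * (of_int (fst k) * x + of_int (snd k) * y) + \<theta>" "fst k"]
    by (simp add: mode_def algebra_simps)
  moreover have "mode k \<theta> (x, y + 1) = mode k \<theta> (x, y)" for x y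
    using cos_add_2pi_int[of "2 * pi * (of_int (fst k) * x + of_int (snd k) * y) + \<theta>" "snd k"]
    by (simp add: mode_def algebra_simps)
  ultimately show ?thesis by (simp add: torus_fun_def)
qed

lemma mode_torus_C: "mode k \<theta> \<in> torus_C"
  by (simp add: torus_C_def torus_fun_mode continuous_on_mode)

lemma integral_cell_abs_le:
  fixes f :: "real \<times> real \<Rightarrow> real"
  assumes "\<And>u. \<bar>f u\<bar> \<le> C" "f \<in> borel_measurable borel"
  shows "\<bar>LINT u|cell. f u\<bar> \<le> C"
proof -
  interpret prob_space cell by (rule prob_space_cell)
  have "\<bar>LINT u|cell. f u\<bar> \<le> (LINT u|cell. \<bar>f u\<bar>)"
    by (rule integral_abs_bound)
  also have "\<dots> \<le> C"
    using assms integrable_cell[OF assms(2,1)] by (intro integral_le_const) auto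
  finally show ?thesis .
qed

section \<open>Bounded functions with vanishing Fourier coefficients\<close>

lemma abs_mult_le:
  fixes a b :: real
  assumes "\<bar>a\<bar> \<le> A" "\<bar>b\<bar> \<le> B"
  shows "\<bar>a * b\<bar> \<le> A * B"
  using assms unfolding abs_mult by (intro mult_mono) auto

lemma torus_C_orthogonal:
  assumes [measurable]: "D \<in> borel_measurable borel" and D: "\<And>u. \<bar>D u\<bar> \<le> C"
    and modes: "\<And>k \<theta>. (LINT u|cell. mode k \<theta> u * D u) = 0" and f: "f \<in> torus_C"
  shows "(LINT u|cell. f u * D u) = 0"
proof -
  have int: "integrable cell (\<lambda>u. h u * D u)"
    if "\<And>u. \<bar>h u\<bar> \<le> B" "h \<in> borel_measurable borel" for h :: "real \<times> real \<Rightarrow> real" and B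
    using that(2) by (intro integrable_cell[of _ "B * C"] abs_mult_le that(1) D) simp
  have trig: "integrable cell (\<lambda>u. q u * D u) \<and> (LINT u|cell. q u * D u) = 0" if "q \<in> trig" for q
    using that
  proof induction
    case (mode k \<theta>)
    then show ?case using modes int[OF mode_abs_le_1] by simp
  qed (simp_all add: mult.assoc distrib_right)
  obtain B where B: "\<And>u. \<bar>f u\<bar> \<le> B"
    using torus_C_bounded[OF f] by blast
  have C: "C \<ge> 0" using D[of 0] by linarith
  have "\<bar>LINT u|cell. f u * D u\<bar> \<le> e" if "e > 0" for e
  proof -
    \<comment> \<open>The bound \<open>C\<close> may be zero, hence the denominator
      \<open>C + 1\<close>.\<close>
    have "e / (C + 1) > 0" using C that by simp
    then obtain q where q: "q \<in> trig" "\<And>u. \<bar>f u - q u\<bar> < e / (C + 1)"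
      using trig_dense[OF f] by metis
    have q_meas: "q \<in> borel_measurable borel"
      using continuous_on_trig[OF q(1)] by (rule borel_measurable_continuous_onI)
    note f_meas = torus_C_measurable[OF f]
    have "(LINT u|cell. f u * D u) = (LINT u|cell. f u * D u - q u * D u)"
      using trig[OF q(1)] int[OF B f_meas] by simp
    also have "\<bar>\<dots>\<bar> \<le> e / (C + 1) * C"
    proof (rule integral_cell_abs_le)
      show "\<bar>f u * D u - q u * D u\<bar> \<le> e / (C + 1) * C" for u
        using abs_mult_le[OF less_imp_le[OF q(2)] D, of u u] by (simp add: left_diff_distrib)
    qed (use f_meas q_meas in measurable)
    also have "\<dots> \<le> e" using C that by (simp add: field_simps)
    finally show ?thesis .
  qed
  then have "\<bar>LINT u|cell. f u * D u\<bar> \<le> 0"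
    by (metis add_0 field_le_epsilon)
  then show ?thesis by simp
qed

text \<open>Each sine changes sign under a unit shift, so their product is periodic. On one period
  it is positive exactly between 0 and \<open>a\<close>, so scaling by \<open>n\<close> and
  truncating to the unit interval gives continuous periodic approximations of the indicator of that
  interval.\<close>

definition bump :: "nat \<Rightarrow> real \<Rightarrow> real \<Rightarrow> real" where
  "bump n a x = min 1 (real n * max 0 (sin (pi * x) * sin (pi * (a - x))))"

lemma bump_periodic: "bump n a (x + 1) = bump n a x"
  by (simp add: bump_def right_diff_distrib distrib_left sin_add sin_diff cos_add)

lemma bump_bounds: "0 \<le> bump n a x" "bump n a x \<le> 1"
  by (simp_all add: bump_def)

lemma bump_tendsto:
  assumes a: "0 \<le> a" "a \<le> 1" and x: "0 \<le> x" "x < 1"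
  shows "(\<lambda>n. bump n a x) \<longlonglongrightarrow> indicator {0<..<a} x"
proof (cases "x \<in> {0<..<a}")
  case True
  define s where "s = sin (pi * x) * sin (pi * (a - x))"
  have "s > 0"
    unfolding s_def using True a by (intro mult_pos_pos sin_gt_zero) (auto intro!: mult_less_cancel_left2[THEN iffD2])
  have "\<forall>\<^sub>F n in sequentially. real n \<ge> 1 / s"
    by (intro eventually_compose_filterlim[OF eventually_ge_at_top filterlim_real_sequentially])
  then have "\<forall>\<^sub>F n in sequentially. bump n a x = 1"
  proof eventually_elim
    case (elim n)
    then have "real n * s \<ge> 1" using \<open>s > 0\<close> by (simp add: field_simps)
    then show ?case using \<open>s > 0\<close> by (simp add: bump_def flip: s_def)
  qed
  then show ?thesis
    using True by (simp add: tendsto_eventually)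
next
  case False
  have "sin (pi * x) * sin (pi * (a - x)) \<le> 0"
  proof (cases "x = 0")
    case False
    with \<open>x \<notin> _\<close> x have "x \<ge> a" by auto
    have "sin (pi * x) \<ge> 0"
      using x by (intro sin_ge_zero) (auto simp: mult_le_cancel_left1)
    moreover have "sin (pi * (x - a)) \<ge> 0"
      using x a \<open>x \<ge> a\<close> by (intro sin_ge_zero) (auto simp: mult_le_cancel_left1)
    moreover have "sin (pi * (a - x)) = - sin (pi * (x - a))"
      by (metis minus_diff_eq mult_minus_right sin_minus)
    ultimately show ?thesis by (simp add: mult_nonneg_nonneg)
  qed simp
  then have "bump n a x = 0" for n by (simp add: bump_def max_def)
  then show ?thesis using False by simp
qed

lemma AE_cell_interior: "AE u in cell. u \<in> {0<..<1} \<times> {0<..<1} \<and> u \<in> torus_cell"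
proof -
  have "AE x in cell1. x \<in> {0<..<1}"
    unfolding cell1_def using AE_lborel_singleton[of "0::real"]
    by (subst AE_density) (auto simp: indicator_def)
  then have "AE x in cell1. AE y in cell1. (x, y) \<in> {0<..<1} \<times> {0<..<1} \<and> (x, y) \<in> torus_cell"
    by (auto simp: torus_cell_def)
  moreover have "{u \<in> space (cell1 \<Otimes>\<^sub>M cell1). u \<in> {0<..<1} \<times> {0<..<1} \<and> u \<in> torus_cell} =
      {0<..<1} \<times> {0<..<1}"
    by (auto simp: torus_cell_def space_pair_measure)
  then have "{u \<in> space (cell1 \<Otimes>\<^sub>M cell1). u \<in> {0<..<1} \<times> {0<..<1} \<and> u \<in> torus_cell}
      \<in> sets (cell1 \<Otimes>\<^sub>M cell1)"
    by simp
  ultimately show ?thesis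
    unfolding cell_pair by (intro cell1_pair.AE_pair_measure)
qed

lemma integral_box_zero:
  assumes [measurable]: "D \<in> borel_measurable borel" and D: "\<And>u. \<bar>D u\<bar> \<le> C"
    and modes: "\<And>k \<theta>. (LINT u|cell. mode k \<theta> u * D u) = 0"
    and a: "0 \<le> a" "a \<le> 1" and b: "0 \<le> b" "b \<le> 1"
  shows "(LINT u|cell. indicator ({0<..<a} \<times> {0<..<b}) u * D u) = 0"
proof -
  interpret prob_space cell by (rule prob_space_cell)
  define f where "f n u = bump n a (fst u) * bump n b (snd u)" for n u
  have f: "f n \<in> torus_C" for n
  proof -
    have "continuous_on UNIV (f n)"
      unfolding f_def bump_def by (intro continuous_intros)
    then show ?thesis by (simp add: torus_C_def torus_fun_def f_def bump_periodic)
  qed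
  note [measurable] = torus_C_measurable[OF f]
  have [measurable]: "{0<..<a} \<times> {0<..<b} \<in> sets borel"
    unfolding borel_prod[symmetric] by simp
  have "(\<lambda>n. LINT u|cell. f n u * D u) \<longlonglongrightarrow> (LINT u|cell. indicator ({0<..<a} \<times> {0<..<b}) u * D u)"
  proof (rule integral_dominated_convergence[where w = "\<lambda>_. C"])
    show "AE u in cell. (\<lambda>n. f n u * D u) \<longlonglongrightarrow> indicator ({0<..<a} \<times> {0<..<b}) u * D u"
      using AE_cell_interior
    proof eventually_elim
      case (elim u)
      have "(\<lambda>n. f n u) \<longlonglongrightarrow> indicator {0<..<a} (fst u) * indicator {0<..<b} (snd u)"
        unfolding f_def using elim a b by (intro tendsto_mult bump_tendsto) (auto simp: torus_cell_def)
      then show ?case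
        by (auto simp: indicator_times intro!: tendsto_mult)
    qed
    show "AE u in cell. norm (f n u * D u) \<le> C" for n
    proof (rule AE_I2)
      fix u
      have "\<bar>f n u\<bar> \<le> 1 * 1"
        unfolding f_def using bump_bounds[of n] by (intro abs_mult_le) (auto simp: abs_le_iff intro: order_trans[of _ 0])
      then show "norm (f n u * D u) \<le> C"
        using abs_mult_le[of "f n u" 1 "D u" C] D[of u] by simp
    qed
  qed simp_all
  moreover have "(LINT u|cell. f n u * D u) = 0" for n
    by (rule torus_C_orthogonal[OF assms(1-3) f])
  ultimately show ?thesis by (simp add: LIMSEQ_const_iff)
qed

text \<open>Vanishing coefficients kill the integrals over boxes at the origin, through
  \<open>bump\<close>. Boxes form an intersection-stable generator of the Borel sets, so the
  integral over every Borel set vanishes, and a density with this property is null.\<close>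

lemma AE_cell_zero:
  assumes [measurable]: "D \<in> borel_measurable borel" and D: "\<And>u. \<bar>D u\<bar> \<le> C"
    and modes: "\<And>k \<theta>. (LINT u|cell. mode k \<theta> u * D u) = 0"
  shows "AE u in cell. D u = 0"
proof -
  interpret prob_space cell by (rule prob_space_cell)
  define I :: "(real \<times> real) set" where "I = {0<..<1} \<times> {0<..<1}"
  have [measurable]: "I \<in> sets borel"
    unfolding borel_prod[symmetric] I_def by simp
  \<comment> \<open>Restricting to the open square turns every half-infinite box of the generator
    into a box with a vertex at the origin, after clipping its sides to the unit interval.\<close>
  define D' where "D' u = indicator I u * D u" for u
  have [measurable]: "D' \<in> borel_measurable borel" unfolding D'_def by measurable
  have int: "integrable cell D'"
    by (rule integrable_cell[of _ C]) (use D order_trans[OF abs_ge_zero D] in \<open>auto simp: D'_def indicator_def\<close>)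
  define G where "G = range (\<lambda>(a::real, b::real). {..<a} \<times> {..<b})"
  have "{x. eucl_less x a} = {..<fst a} \<times> {..<snd a}" for a :: "real \<times> real"
    by (auto simp: eucl_less_def Basis_prod_def inner_prod_def)
  then have G: "sets borel = sigma_sets UNIV G"
    unfolding G_def by (simp add: borel_eq_lessThan case_prod_beta)
  have box: "set_lebesgue_integral cell A D' = 0" if A_in: "A \<in> G" for A
  proof -
    obtain a b where A: "A = {..<a} \<times> {..<b}" using A_in unfolding G_def by fastforce
    define a' b' where "a' = max 0 (min a 1)" and "b' = max 0 (min b 1)"
    have "indicator A u * indicator I u = (indicator ({0<..<a'} \<times> {0<..<b'}) u :: real)" for u
      by (auto simp: A I_def a'_def b'_def indicator_def)
    then have "set_lebesgue_integral cell A D' =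
        (LINT u|cell. indicator ({0<..<a'} \<times> {0<..<b'}) u * D u)"
      unfolding set_lebesgue_integral_def D'_def by (simp flip: mult.assoc)
    also have "\<dots> = 0"
      by (rule integral_box_zero[OF assms]) (auto simp: a'_def b'_def)
    finally show ?thesis .
  qed
  \<comment> \<open>The box with upper corner \<open>(1, 1)\<close> contains the open square. This
    total is what the complement case of the induction subtracts from.\<close>
  have total: "(LINT u|cell. D' u) = 0"
  proof -
    have "set_lebesgue_integral cell ({..<1} \<times> {..<1}) D' = 0"
      by (rule box) (auto simp: G_def)
    moreover have "(\<lambda>u. indicator ({..<1} \<times> {..<1}) u *\<^sub>R D' u) = D'"
      by (auto simp: fun_eq_iff D'_def I_def indicator_def)
    ultimately show ?thesis by (simp only: set_lebesgue_integral_def)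
  qed
  have set_int: "set_integrable cell A D'" if "A \<in> sets borel" for A
    using that int unfolding set_integrable_def by (intro integrable_mult_indicator) auto
  have "Int_stable G"
  proof (rule Int_stableI)
    fix A B assume "A \<in> G" "B \<in> G"
    then obtain a b c d where "A = {..<a} \<times> {..<b}" "B = {..<c} \<times> {..<d}"
      unfolding G_def by fastforce
    then have "A \<inter> B = (\<lambda>(a, b). {..<a} \<times> {..<b}) (min a c, min b d)" by auto
    then show "A \<inter> B \<in> G" unfolding G_def by (metis rangeI)
  qed
  have G_Pow: "G \<subseteq> Pow UNIV" by simp
  have "set_lebesgue_integral cell A D' = 0" if "A \<in> sets borel" for A
    using \<open>Int_stable G\<close> G_Pow that[unfolded G]
  proof (induction rule: sigma_sets_induct_disjoint)
    case (basic A)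
    then show ?case by (rule box)
  next
    case (compl A)
    then have "A \<in> sets borel" by (simp add: G)
    then have "set_lebesgue_integral cell A D' + set_lebesgue_integral cell (UNIV - A) D' =
        set_lebesgue_integral cell (A \<union> (UNIV - A)) D'"
      by (intro set_integral_Un[symmetric] set_int) auto
    also have "A \<union> (UNIV - A) = UNIV" by auto
    finally show ?case using compl total by (simp add: set_lebesgue_integral_def)
  next
    case (union A)
    then have A: "A i \<in> sets borel" for i by (auto simp: G)
    have "set_lebesgue_integral cell (\<Union>i. A i) D' = (\<Sum>i. set_lebesgue_integral cell (A i) D')"
      using A union(1)
      by (intro lebesgue_integral_countable_add set_int) (auto simp: disjoint_family_on_def)
    then show ?case using union by simp
  qed (simp add: set_lebesgue_integral_def)
  then have "AE u in cell. D' u = 0"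
    by (intro density_zero int) simp
  with AE_cell_interior show ?thesis
    by eventually_elim (simp add: D'_def I_def)
qed

lemma AE_lborel_translate:
  fixes c :: "real \<times> real"
  assumes "AE u in lborel. P u" "{u. P u} \<in> sets borel"
  shows "AE u in lborel. P (c + u)"
proof -
  have "AE u in distr lborel borel ((+) c). P u"
    using assms(1) by (subst lborel_distr_plus)
  then show ?thesis
    using assms(2) by (subst (asm) AE_distr_iff) auto
qed

text \<open>Countably many integer translates of the cell cover the plane, so one common null set
  suffices for all of them.\<close>

lemma AE_lborel_torus:
  fixes D :: "real \<times> real \<Rightarrow> real"
  assumes [measurable]: "D \<in> borel_measurable borel" and per: "torus_fun D"
    and zero: "AE u in cell. D u = 0"
  shows "AE u in lborel. D u = 0"
proof -
  have "AE u in lborel. u \<in> torus_cell \<longrightarrow> D u = 0"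
    using zero unfolding cell_def by (subst (asm) AE_density) (auto simp: indicator_def)
  then have "AE u in lborel. (of_int m, of_int n) + u \<in> torus_cell \<longrightarrow> D ((of_int m, of_int n) + u) = 0"
    for m n :: int
    by (rule AE_lborel_translate) measurable
  then have "AE u in lborel. \<forall>m n :: int. (of_int m, of_int n) + u \<in> torus_cell \<longrightarrow>
      D ((of_int m, of_int n) + u) = 0"
    unfolding AE_all_countable by blast
  then show ?thesis
  proof eventually_elim
    case (elim u)
    obtain x y where u: "u = (x, y)" by (cases u)
    have "(of_int (- \<lfloor>x\<rfloor>), of_int (- \<lfloor>y\<rfloor>)) + u = (frac x, frac y)"
      by (simp add: u frac_def)
    moreover have "(frac x, frac y) \<in> torus_cell"
      by (simp add: torus_cell_def frac_lt_1)
    ultimately have "D (frac x, frac y) = 0" using elim by metis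
    then show ?case using torus_fun_frac[OF per] by (simp add: u)
  qed
qed

section \<open>Derivatives of modes and integration by parts on the torus\<close>

definition heat_rate :: "int \<times> int \<Rightarrow> real" where
  "heat_rate k = 4 * pi\<^sup>2 * ((of_int (fst k))\<^sup>2 + (of_int (snd k))\<^sup>2)"

lemma mode_has_derivative1:
  "((\<lambda>s. mode k \<theta> (s, y)) has_real_derivative (2 * pi * of_int (fst k)) * mode k (\<theta> + pi / 2) (x, y)) (at x)"
  unfolding mode_def
  by (auto intro!: derivative_eq_intros simp: cos_add sin_add algebra_simps)

lemma mode_has_derivative2:
  "((\<lambda>s. mode k \<theta> (x, s)) has_real_derivative (2 * pi * of_int (snd k)) * mode k (\<theta> + pi / 2) (x, y)) (at y)"
  unfolding mode_def
  by (auto intro!: derivative_eq_intros simp: cos_add sin_add algebra_simps)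

text \<open>The scalar \<open>c\<close> makes the class closed under differentiation, so the same
  equations also serve for second derivatives.\<close>

lemma pd_cmult_mode:
  "pd1 (\<lambda>u. c * mode k \<theta> u) = (\<lambda>u. (c * (2 * pi * of_int (fst k))) * mode k (\<theta> + pi / 2) u)"
  "pd2 (\<lambda>u. c * mode k \<theta> u) = (\<lambda>u. (c * (2 * pi * of_int (snd k))) * mode k (\<theta> + pi / 2) u)"
  unfolding pd1_def pd2_def fun_eq_iff
  using DERIV_cmult[OF mode_has_derivative1, of c k \<theta>] DERIV_cmult[OF mode_has_derivative2, of c k \<theta>]
  by (auto intro!: DERIV_imp_deriv simp: mult.assoc)

lemma C1_cmult_mode: "C1 (\<lambda>u. c * mode k \<theta> u)"
  unfolding C1_def pd_cmult_mode
proof (intro conjI allI)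
  fix u
  show "(\<lambda>s. c * mode k \<theta> (s, snd u)) differentiable at (fst u)"
    using DERIV_cmult[OF mode_has_derivative1, of c k \<theta>] unfolding real_differentiable_def by blast
  show "(\<lambda>s. c * mode k \<theta> (fst u, s)) differentiable at (snd u)"
    using DERIV_cmult[OF mode_has_derivative2, of c k \<theta>] unfolding real_differentiable_def by blast
qed (intro continuous_intros continuous_on_mode)+

lemma mode_torus_C2: "mode k \<theta> \<in> torus_C2"
  using C1_cmult_mode[of 1 k \<theta>] pd_cmult_mode[of 1 k \<theta>]
  by (simp add: torus_C2_def torus_fun_mode C1_cmult_mode)

lemma laplacian_mode: "laplacian (mode k \<theta>) u = - heat_rate k * mode k \<theta> u"
proof -
  have shift: "mode k (\<theta> + pi / 2 + pi / 2) u = - mode k \<theta> u"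
    using cos_periodic_pi[of "2 * pi * (of_int (fst k) * fst u + of_int (snd k) * snd u) + \<theta>"]
    by (simp add: mode_def algebra_simps)
  have pd: "pd1 (mode k \<theta>) = (\<lambda>u. (2 * pi * of_int (fst k)) * mode k (\<theta> + pi / 2) u)"
    "pd2 (mode k \<theta>) = (\<lambda>u. (2 * pi * of_int (snd k)) * mode k (\<theta> + pi / 2) u)"
    using pd_cmult_mode[of 1 k \<theta>] by simp_all
  show ?thesis
    unfolding laplacian_def pd pd_cmult_mode shift
    by (simp add: heat_rate_def power2_eq_square algebra_simps)
qed

lemma C1_has_derivative:
  assumes "C1 f"
  shows "((\<lambda>s. f (s, y)) has_real_derivative pd1 f (x, y)) (at x)"
    "((\<lambda>s. f (x, s)) has_real_derivative pd2 f (x, y)) (at y)"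
proof -
  have "(\<lambda>s. f (s, snd (x, y))) differentiable at (fst (x, y))"
    "(\<lambda>s. f (fst (x, y), s)) differentiable at (snd (x, y))"
    using assms unfolding C1_def by blast+
  then show "((\<lambda>s. f (s, y)) has_real_derivative pd1 f (x, y)) (at x)"
    "((\<lambda>s. f (x, s)) has_real_derivative pd2 f (x, y)) (at y)"
    by (simp_all add: pd1_def pd2_def DERIV_deriv_iff_real_differentiable)
qed

lemma deriv_periodic:
  fixes h :: "real \<Rightarrow> real"
  assumes "\<And>x. h (x + 1) = h x"
  shows "deriv h (x + 1) = deriv h x"
  unfolding deriv_def using DERIV_shift[of h _ x 1] assms by simp

lemma torus_fun_pd:
  assumes "torus_fun f"
  shows "torus_fun (pd1 f)" "torus_fun (pd2 f)"
  using assms deriv_periodic[of "\<lambda>s. f (s, y)" for y] deriv_periodic[of "\<lambda>s. f (x, s)" for x]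
  by (auto simp: torus_fun_def pd1_def pd2_def)

text \<open>\<open>C1\<close> does not mention continuity of the function itself; it follows because the partial
  derivatives, being continuous and periodic, are bounded.\<close>

lemma C1_torus_C:
  assumes f: "torus_fun f" "C1 f"
  shows "f \<in> torus_C" "pd1 f \<in> torus_C" "pd2 f \<in> torus_C"
proof -
  show pd: "pd1 f \<in> torus_C" "pd2 f \<in> torus_C"
    using f torus_fun_pd[OF f(1)] by (auto simp: torus_C_def C1_def)
  obtain B1 where B1: "B1 > 0" "\<And>u. \<bar>pd1 f u\<bar> \<le> B1" using torus_C_bounded[OF pd(1)] by blast
  obtain B2 where B2: "B2 > 0" "\<And>u. \<bar>pd2 f u\<bar> \<le> B2" using torus_C_bounded[OF pd(2)] by blast
  have "norm (f u - f v) \<le> B1 * norm (fst u - fst v) + B2 * norm (snd u - snd v)" for u v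
  proof -
    have "norm (f (fst u, snd u) - f (fst v, snd u)) \<le> B1 * norm (fst u - fst v)"
      by (rule field_differentiable_bound[of UNIV "\<lambda>s. f (s, snd u)" "\<lambda>s. pd1 f (s, snd u)"])
        (use C1_has_derivative[OF f(2)] B1 in auto)
    moreover have "norm (f (fst v, snd u) - f (fst v, snd v)) \<le> B2 * norm (snd u - snd v)"
      by (rule field_differentiable_bound[of UNIV "\<lambda>s. f (fst v, s)" "\<lambda>s. pd2 f (fst v, s)"])
        (use C1_has_derivative[OF f(2)] B2 in auto)
    ultimately show ?thesis by simp
  qed
  then have lip: "norm (f u - f v) \<le> B1 * norm (fst u - fst v) + B2 * norm (snd u - snd v)" for u v .
  have "isCont f v" for v
    unfolding isCont_def
  proof (rule LIM_zero_cancel, rule Lim_null_comparison)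
    show "\<forall>\<^sub>F u in at v. norm (f u - f v) \<le> B1 * norm (fst u - fst v) + B2 * norm (snd u - snd v)"
      using lip by (intro always_eventually allI)
    have "((\<lambda>u. B1 * norm (fst u - fst v) + B2 * norm (snd u - snd v)) \<longlongrightarrow>
        B1 * norm (fst v - fst v) + B2 * norm (snd v - snd v)) (at v)"
      by (intro tendsto_intros)
    then show "((\<lambda>u. B1 * norm (fst u - fst v) + B2 * norm (snd u - snd v)) \<longlongrightarrow> 0) (at v)"
      by simp
  qed
  then show "f \<in> torus_C"
    using f(1) by (simp add: torus_C_def continuous_at_imp_continuous_on)
qed

lemma torus_C_add: "f \<in> torus_C \<Longrightarrow> h \<in> torus_C \<Longrightarrow> (\<lambda>u. f u + h u) \<in> torus_C"
  by (auto simp: torus_C_def torus_fun_def intro: continuous_intros)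

lemma torus_C_mult: "f \<in> torus_C \<Longrightarrow> h \<in> torus_C \<Longrightarrow> (\<lambda>u. f u * h u) \<in> torus_C"
  by (auto simp: torus_C_def torus_fun_def intro: continuous_intros)

lemma torus_C_cmult: "f \<in> torus_C \<Longrightarrow> (\<lambda>u. c * f u) \<in> torus_C"
  by (auto simp: torus_C_def torus_fun_def intro: continuous_intros)

lemma torus_C2_torus_C:
  assumes "f \<in> torus_C2"
  shows "f \<in> torus_C" "pd1 (pd1 f) \<in> torus_C" "pd2 (pd2 f) \<in> torus_C" "laplacian f \<in> torus_C"
proof -
  have *: "torus_fun f" "C1 f" "C1 (pd1 f)" "C1 (pd2 f)" using assms by (auto simp: torus_C2_def)
  show "f \<in> torus_C" using C1_torus_C * by blast
  show 1: "pd1 (pd1 f) \<in> torus_C" and 2: "pd2 (pd2 f) \<in> torus_C"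
    using C1_torus_C(2,3) * torus_fun_pd by blast+
  show "laplacian f \<in> torus_C"
    using torus_C_add[OF 1 2] by (simp add: laplacian_def[abs_def])
qed

lemma cell1_FTC_periodic:
  fixes F :: "real \<Rightarrow> real"
  assumes "\<And>x. (F has_real_derivative f x) (at x)" "continuous_on UNIV f" "F 1 = F 0"
  shows "(LINT x|cell1. f x) = 0"
proof -
  have [measurable]: "f \<in> borel_measurable borel"
    using assms(2) by (rule borel_measurable_continuous_onI)
  have "(LINT x|cell1. f x) = (LINT x|lborel. indicator {0..<1} x * f x)"
    unfolding cell1_def by (subst integral_density) auto
  also have "\<dots> = (LINT x|lborel. f x * indicator {0..1} x)"
    using AE_lborel_singleton[of "1::real"]
    by (intro integral_cong_AE) (auto simp: indicator_def)
  also have "\<dots> = F 1 - F 0"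
    using assms by (intro integral_FTC_Icc_real) (auto simp: continuous_on_eq_continuous_at)
  finally show ?thesis using assms(3) by simp
qed

text \<open>Two integrations by parts in a single antiderivative,
  \<open>h' * cos + c * h * sin\<close>: the mixed terms cancel on differentiation, and the boundary
  values agree because \<open>c\<close> is an integer multiple of \<open>2 * pi\<close>.\<close>

lemma integral_second_derivative_cos:
  fixes h h' h'' :: "real \<Rightarrow> real" and n :: int
  assumes "\<And>x. (h has_real_derivative h' x) (at x)" "\<And>x. (h' has_real_derivative h'' x) (at x)"
    and "continuous_on UNIV h''" and "h 1 = h 0" "h' 1 = h' 0"
  defines "c \<equiv> 2 * pi * of_int n"
  shows "(LINT x|cell1. (h'' x + c\<^sup>2 * h x) * cos (c * x + \<phi>)) = 0"
proof (rule cell1_FTC_periodic)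
  show "((\<lambda>x. h' x * cos (c * x + \<phi>) + c * h x * sin (c * x + \<phi>)) has_real_derivative
      (h'' x + c\<^sup>2 * h x) * cos (c * x + \<phi>)) (at x)" for x
    by (auto intro!: derivative_eq_intros assms(1,2) simp: algebra_simps power2_eq_square)
  have "continuous_on UNIV h"
    using assms(1) by (auto intro: DERIV_continuous_on)
  then show "continuous_on UNIV (\<lambda>x. (h'' x + c\<^sup>2 * h x) * cos (c * x + \<phi>))"
    by (intro continuous_intros assms(3))
  show "h' 1 * cos (c * 1 + \<phi>) + c * h 1 * sin (c * 1 + \<phi>) = h' 0 * cos (c * 0 + \<phi>) + c * h 0 * sin (c * 0 + \<phi>)"
    using assms(4,5) cos_int_2pin[of n] sin_int_2pin[of n] by (simp add: c_def cos_add sin_add)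
qed

lemma integral_pd_mode:
  assumes f: "f \<in> torus_C2"
  shows "(LINT u|cell. (pd1 (pd1 f) u + (2 * pi * of_int (fst k))\<^sup>2 * f u) * mode k \<theta> u) = 0"
    "(LINT u|cell. (pd2 (pd2 f) u + (2 * pi * of_int (snd k))\<^sup>2 * f u) * mode k \<theta> u) = 0"
proof -
  have C1: "C1 f" "C1 (pd1 f)" "C1 (pd2 f)" and per: "torus_fun f" "torus_fun (pd1 f)" "torus_fun (pd2 f)"
    using f torus_fun_pd by (auto simp: torus_C2_def)
  note C = torus_C2_torus_C[OF f]
  have per01: "h (1, y) = h (0, y)" "h (y, 1) = h (y, 0)" if "torus_fun h" for h y
    using that unfolding torus_fun_def by (metis add_0)+
  define F1 where "F1 u = (pd1 (pd1 f) u + (2 * pi * of_int (fst k))\<^sup>2 * f u) * mode k \<theta> u" for u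
  define F2 where "F2 u = (pd2 (pd2 f) u + (2 * pi * of_int (snd k))\<^sup>2 * f u) * mode k \<theta> u" for u
  have F: "F1 \<in> torus_C" "F2 \<in> torus_C"
    unfolding F1_def[abs_def] F2_def[abs_def]
    by (intro torus_C_mult torus_C_add torus_C_cmult C mode_torus_C)+
  obtain B1 where B1: "\<And>u. \<bar>F1 u\<bar> \<le> B1" using torus_C_bounded[OF F(1)] by blast
  obtain B2 where B2: "\<And>u. \<bar>F2 u\<bar> \<le> B2" using torus_C_bounded[OF F(2)] by blast
  have slice: "continuous_on UNIV (\<lambda>s. h (s, y))" "continuous_on UNIV (\<lambda>s. h (y, s))"
    if "h \<in> torus_C" for h y
    using that unfolding torus_C_def
    by (auto intro!: continuous_on_compose2[of UNIV h] continuous_intros)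
  \<comment> \<open>The variable of differentiation is the inner one; the other coordinate enters
    only through the phase. For the second identity the roles are exchanged.\<close>
  have "(LINT x|cell1. F1 (x, y)) = 0" for y
    using integral_second_derivative_cos[of "\<lambda>s. f (s, y)" "\<lambda>s. pd1 f (s, y)" "\<lambda>s. pd1 (pd1 f) (s, y)"
        "fst k" "2 * pi * (of_int (snd k) * y) + \<theta>", OF C1_has_derivative(1)[OF C1(1)]
        C1_has_derivative(1)[OF C1(2)] slice(1)[OF C(2)] per01(1)[OF per(1)] per01(1)[OF per(2)]]
    by (simp add: F1_def mode_def algebra_simps)
  then show "(LINT u|cell. (pd1 (pd1 f) u + (2 * pi * of_int (fst k))\<^sup>2 * f u) * mode k \<theta> u) = 0"
    using integral_cell_iterated(2)[OF torus_C_measurable[OF F(1)] B1] by (simp add: F1_def)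
  have "(LINT y|cell1. F2 (x, y)) = 0" for x
    using integral_second_derivative_cos[of "\<lambda>s. f (x, s)" "\<lambda>s. pd2 f (x, s)" "\<lambda>s. pd2 (pd2 f) (x, s)"
        "snd k" "2 * pi * (of_int (fst k) * x) + \<theta>", OF C1_has_derivative(2)[OF C1(1)]
        C1_has_derivative(2)[OF C1(3)] slice(2)[OF C(3)] per01(2)[OF per(1)] per01(2)[OF per(3)]]
    by (simp add: F2_def mode_def algebra_simps)
  then show "(LINT u|cell. (pd2 (pd2 f) u + (2 * pi * of_int (snd k))\<^sup>2 * f u) * mode k \<theta> u) = 0"
    using integral_cell_iterated(1)[OF torus_C_measurable[OF F(2)] B2] by (simp add: F2_def)
qed

lemma integrable_torus_C: "f \<in> torus_C \<Longrightarrow> integrable cell f"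
  using torus_C_bounded[of f] torus_C_measurable[of f] integrable_cell[of f] by metis

lemma integral_laplacian_mode:
  assumes f: "f \<in> torus_C2"
  shows "(LINT u|cell. mode k \<theta> u * laplacian f u) = - heat_rate k * (LINT u|cell. mode k \<theta> u * f u)"
proof -
  note C = torus_C2_torus_C[OF f]
  let ?I = "\<lambda>h. LINT u|cell. mode k \<theta> u * h u"
  have int: "integrable cell (\<lambda>u. mode k \<theta> u * h u)" if "h \<in> torus_C" for h
    by (intro integrable_torus_C torus_C_mult mode_torus_C that)
  have split: "(LINT u|cell. (h u + c * f u) * mode k \<theta> u) = ?I h + c * ?I f" if "h \<in> torus_C" for h c
  proof -
    have "(LINT u|cell. (h u + c * f u) * mode k \<theta> u) =
        (LINT u|cell. mode k \<theta> u * h u + c * (mode k \<theta> u * f u))"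
      by (simp add: algebra_simps)
    also have "\<dots> = ?I h + c * ?I f"
      using int[OF that] int[OF C(1)] by simp
    finally show ?thesis .
  qed
  have "?I (pd1 (pd1 f)) + (2 * pi * of_int (fst k))\<^sup>2 * ?I f = 0"
    "?I (pd2 (pd2 f)) + (2 * pi * of_int (snd k))\<^sup>2 * ?I f = 0"
    using integral_pd_mode[OF f, of k \<theta>] split C by simp_all
  moreover have "?I (laplacian f) = ?I (pd1 (pd1 f)) + ?I (pd2 (pd2 f))"
    using int C by (simp add: laplacian_def distrib_left)
  ultimately show ?thesis
    by (simp add: heat_rate_def power_mult_distrib algebra_simps)
qed

section \<open>The heat equation\<close>

definition gauss :: "(real \<times> real) measure" where
  "gauss = std_normal_distribution \<Otimes>\<^sub>M std_normal_distribution"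

interpretation normal: prob_space std_normal_distribution
  by (rule prob_space_normal_density) simp

interpretation normal_pair: pair_prob_space std_normal_distribution std_normal_distribution ..

lemma sets_gauss [simp, measurable_cong]: "sets gauss = sets borel"
  unfolding gauss_def borel_prod[symmetric] by (rule sets_pair_measure_cong) simp_all

lemma space_gauss [simp]: "space gauss = UNIV"
  by (simp add: gauss_def space_pair_measure)

interpretation gauss: prob_space gauss
  unfolding gauss_def by (rule normal_pair.prob_space_axioms)

interpretation cell: prob_space cell
  by (rule prob_space_cell)

interpretation cell_gauss: pair_prob_space cell gauss ..

lemma integral_cos_normal:
  "(LINT x|std_normal_distribution. cos (c + a * x)) = exp (- (a\<^sup>2) / 2) * cos c"
proof -
  interpret real_distribution std_normal_distribution by (rule real_dist_normal_dist)
  have iexp: "iexp y = cis y" for y by (simp add: cis_conv_exp)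
  have "(LINT x|std_normal_distribution. cos (c + a * x)) =
      (LINT x|std_normal_distribution. Re (cis c * iexp (a * x)))"
    by (intro Bochner_Integration.integral_cong refl) (simp only: iexp, simp add: cos_add)
  also have "\<dots> = Re (LINT x|std_normal_distribution. cis c * iexp (a * x))"
    by (rule integral_bounded_linear[OF bounded_linear_Re])
      (intro integrable_mult_right normal.integrable_iexp, auto)
  also have "(LINT x|std_normal_distribution. cis c * iexp (a * x)) = cis c * char std_normal_distribution a"
    by (simp add: char_def)
  finally show ?thesis by (simp add: char_std_normal_distribution)
qed

text \<open>The parameter is a signed standard deviation, not a time: time \<open>t\<close> of the
  equation with the full Laplacian corresponds to \<open>sqrt (2 * t)\<close>, and the adjoint
  appears with the opposite sign.\<close>

definition heat_op :: "real \<Rightarrow> (real \<times> real \<Rightarrow> real) \<Rightarrow> real \<times> real \<Rightarrow> real" where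
  "heat_op s f u = (LINT z|gauss. f (u + s *\<^sub>R z))"

lemma heat_op_measurable:
  assumes [measurable]: "f \<in> borel_measurable borel"
  shows "(\<lambda>(s, u). heat_op s f u) \<in> borel_measurable (borel \<Otimes>\<^sub>M borel)"
proof -
  have "(\<lambda>p. LINT z|gauss. f (snd p + fst p *\<^sub>R z)) \<in> borel_measurable (borel \<Otimes>\<^sub>M borel)"
    by (rule gauss.borel_measurable_lebesgue_integral) measurable
  then show ?thesis by (simp add: heat_op_def case_prod_beta')
qed

lemma heat_op_measurable' [measurable]:
  assumes "f \<in> borel_measurable borel"
  shows "heat_op s f \<in> borel_measurable borel"
  using measurable_compose_Pair1[OF _ heat_op_measurable[OF assms], of s] by simp

lemma heat_op_bound:
  assumes "\<And>u. \<bar>f u\<bar> \<le> C" and [measurable]: "f \<in> borel_measurable borel"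
  shows "\<bar>heat_op s f u\<bar> \<le> C"
proof -
  have "integrable gauss (\<lambda>z. \<bar>f (u + s *\<^sub>R z)\<bar>)"
    by (rule gauss.integrable_const_bound[of _ C]) (use assms in auto)
  then have "(LINT z|gauss. \<bar>f (u + s *\<^sub>R z)\<bar>) \<le> C"
    using assms by (intro gauss.integral_le_const) auto
  then show ?thesis
    unfolding heat_op_def using integral_abs_bound[of gauss "\<lambda>z. f (u + s *\<^sub>R z)"] by linarith
qed

lemma heat_op_torus_fun:
  assumes "torus_fun f"
  shows "torus_fun (heat_op s f)"
proof -
  have "f (x + 1 + a, y) = f (x + a, y)" "f (x, y + 1 + a) = f (x, y + a)" for x y a
    using assms unfolding torus_fun_def by (metis add.assoc add.commute)+
  then have "f ((x + 1, y) + z) = f ((x, y) + z)" "f ((x, y + 1) + z) = f ((x, y) + z)" for x y z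
    by (cases z, simp)+
  then show ?thesis
    unfolding torus_fun_def heat_op_def by simp
qed

text \<open>The characteristic function of the normal law is applied in each coordinate, at the
  frequencies \<open>a\<close> and \<open>b\<close>; half the sum of their squares is
  \<open>s\<^sup>2 / 2\<close> times \<open>heat_rate k\<close>.\<close>

lemma heat_op_mode: "heat_op s (mode k \<theta>) u = exp (- (s\<^sup>2 / 2) * heat_rate k) * mode k \<theta> u"
proof -
  define A where "A = 2 * pi * (of_int (fst k) * fst u + of_int (snd k) * snd u) + \<theta>"
  define a where "a = 2 * pi * of_int (fst k) * s"
  define b where "b = 2 * pi * of_int (snd k) * s"
  have eq: "mode k \<theta> (u + s *\<^sub>R z) = cos (A + a * fst z + b * snd z)" for z
    by (simp add: mode_def A_def a_def b_def algebra_simps)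
  have "integrable gauss (\<lambda>z. cos (A + a * fst z + b * snd z))"
  proof (rule gauss.integrable_const_bound[of _ 1])
    show "(\<lambda>z. cos (A + a * fst z + b * snd z)) \<in> borel_measurable gauss"
      by (subst measurable_cong_sets[OF sets_gauss refl])
        (intro borel_measurable_continuous_onI continuous_intros)
  qed simp
  then have "(LINT z|gauss. cos (A + a * fst z + b * snd z)) =
      (LINT x|std_normal_distribution. LINT y|std_normal_distribution. cos (A + a * x + b * y))"
    unfolding gauss_def by (subst normal_pair.integral_fst'[symmetric]) auto
  also have "\<dots> = exp (- (b\<^sup>2) / 2) * (exp (- (a\<^sup>2) / 2) * cos A)"
    by (simp add: integral_cos_normal)
  also have "exp (- (b\<^sup>2) / 2) * (exp (- (a\<^sup>2) / 2) * cos A) = exp (- (s\<^sup>2 / 2) * heat_rate k) * cos A"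
  proof -
    have "- (b\<^sup>2) / 2 + - (a\<^sup>2) / 2 = - (s\<^sup>2 / 2) * heat_rate k"
      by (simp add: a_def b_def heat_rate_def power2_eq_square algebra_simps)
    then show ?thesis by (metis mult.assoc mult_exp_exp)
  qed
  finally show ?thesis
    unfolding heat_op_def eq by (simp add: A_def mode_def)
qed

text \<open>For a fixed Gaussian displacement this is translation invariance of the integral over a
  period; Fubini, used in both directions, averages over the displacement.\<close>

lemma heat_op_adjoint:
  assumes [measurable]: "f \<in> borel_measurable borel" "r \<in> borel_measurable borel"
    and f: "torus_fun f" "\<And>u. \<bar>f u\<bar> \<le> C" and r: "torus_fun r" "\<And>u. \<bar>r u\<bar> \<le> C'"
  shows "(LINT u|cell. f u * heat_op s r u) = (LINT u|cell. heat_op (- s) f u * r u)"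
proof -
  have int1: "integrable (cell \<Otimes>\<^sub>M gauss) (\<lambda>(u, z). f u * r (u + s *\<^sub>R z))"
    by (rule cell_gauss.integrable_const_bound[of _ "C * C'"])
      (auto intro!: abs_mult_le f(2) r(2))
  have int2: "integrable (cell \<Otimes>\<^sub>M gauss) (\<lambda>(u, z). f (u - s *\<^sub>R z) * r u)"
    by (rule cell_gauss.integrable_const_bound[of _ "C * C'"])
      (auto intro!: abs_mult_le f(2) r(2))
  have "(LINT u|cell. f u * heat_op s r u) = (LINT u|cell. LINT z|gauss. f u * r (u + s *\<^sub>R z))"
    by (simp add: heat_op_def)
  also have "\<dots> = (LINT z|gauss. LINT u|cell. f u * r (u + s *\<^sub>R z))"
    by (rule cell_gauss.Fubini_integral[OF int1, symmetric])
  also have "\<dots> = (LINT z|gauss. LINT u|cell. f (u - s *\<^sub>R z) * r u)"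
  proof (rule Bochner_Integration.integral_cong[OF refl])
    fix z
    have per: "torus_fun (\<lambda>u. f (u - s *\<^sub>R z) * r u)"
    proof -
      obtain a b where "s *\<^sub>R z = (a, b)" by fastforce
      then show ?thesis
        using f(1) r(1) unfolding torus_fun_def by (simp add: algebra_simps) (metis add_diff_eq diff_add_eq)
    qed
    show "(LINT u|cell. f u * r (u + s *\<^sub>R z)) = (LINT u|cell. f (u - s *\<^sub>R z) * r u)"
      using integral_cell_shift[OF per, of "C * C'" "s *\<^sub>R z"] abs_mult_le f(2) r(2) by simp
  qed
  also have "\<dots> = (LINT u|cell. LINT z|gauss. f (u - s *\<^sub>R z) * r u)"
    by (rule cell_gauss.Fubini_integral[OF int2])
  also have "\<dots> = (LINT u|cell. heat_op (- s) f u * r u)"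
    by (simp add: heat_op_def)
  finally show ?thesis .
qed

lemma integral_mode_heat_op:
  assumes "r \<in> borel_measurable borel" "torus_fun r" "\<And>u. \<bar>r u\<bar> \<le> C"
  shows "(LINT u|cell. mode k \<theta> u * heat_op s r u) =
    exp (- (s\<^sup>2 / 2) * heat_rate k) * (LINT u|cell. mode k \<theta> u * r u)"
  using heat_op_adjoint[OF borel_measurable_mode assms(1) torus_fun_mode mode_abs_le_1 assms(2,3)]
  by (simp add: heat_op_mode mult.assoc)

text \<open>The time integral is rewritten as integration against a finite measure
  \<open>\<tau>\<close>, so that \<open>cell\<close> times \<open>\<tau>\<close> is finite as well,
  bounded measurable functions are integrable and Fubini applies.\<close>

lemma heat_op_time_integral:
  fixes h r :: "real \<times> real \<Rightarrow> real" and t :: real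
  assumes [measurable]: "h \<in> borel_measurable borel" "r \<in> borel_measurable borel" "\<sigma> \<in> borel_measurable borel"
    and h: "\<And>u. \<bar>h u\<bar> \<le> C" and r: "\<And>u. \<bar>r u\<bar> \<le> C'" and t: "t \<ge> 0"
  defines "W \<equiv> \<lambda>u. LINT s:{0..t}|lborel. heat_op (\<sigma> s) h u"
  shows "W \<in> borel_measurable borel" "\<bar>W u\<bar> \<le> C * t"
    "(LINT u|cell. r u * W u) = (LINT s:{0..t}|lborel. LINT u|cell. r u * heat_op (\<sigma> s) h u)"
proof -
  define \<tau> where "\<tau> = density lborel (\<lambda>s. ennreal (indicator {0..t} s))"
  have [simp, measurable_cong]: "sets \<tau> = sets borel" by (simp add: \<tau>_def)
  have [simp]: "space \<tau> = UNIV" by (simp add: \<tau>_def)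
  have emeasure: "emeasure \<tau> UNIV = ennreal t"
    using t by (simp add: \<tau>_def emeasure_density ennreal_indicator)
  interpret \<tau>: finite_measure \<tau>
    by standard (simp add: emeasure)
  interpret ct: pair_sigma_finite cell \<tau> ..
  have set_int: "(LINT s:{0..t}|lborel. k s) = (LINT s|\<tau>. k s)"
    if "k \<in> borel_measurable borel" for k :: "real \<Rightarrow> real"
    unfolding \<tau>_def set_lebesgue_integral_def using that by (subst integral_density) auto
  note heat_op_measurable[OF assms(1), measurable]
  have [measurable]: "(\<lambda>p. heat_op (\<sigma> (snd p)) h (fst p)) \<in> borel_measurable (borel \<Otimes>\<^sub>M borel)"
    using measurable_compose[OF _ heat_op_measurable[OF assms(1)], of "\<lambda>p. (\<sigma> (snd p), fst p)" "borel \<Otimes>\<^sub>M borel"]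
    by simp
  have slice: "(\<lambda>s. heat_op (\<sigma> s) h u) \<in> borel_measurable borel" for u
    using measurable_compose_Pair1[of u borel "\<lambda>p. heat_op (\<sigma> (snd p)) h (fst p)" borel borel] by simp
  have W: "W u = (LINT s|\<tau>. heat_op (\<sigma> s) h u)" for u
    unfolding W_def by (rule set_int[OF slice])
  show "W \<in> borel_measurable borel"
    unfolding W[abs_def] by (rule \<tau>.borel_measurable_lebesgue_integral) measurable
  have hb: "\<bar>heat_op s h u\<bar> \<le> C" for s u
    by (rule heat_op_bound[OF h]) simp
  have "\<bar>W u\<bar> \<le> (LINT s|\<tau>. \<bar>heat_op (\<sigma> s) h u\<bar>)"
    unfolding W by (rule integral_abs_bound)
  also have "\<dots> \<le> (LINT s|\<tau>. C)"
  proof (rule integral_mono)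
    show "integrable \<tau> (\<lambda>s. \<bar>heat_op (\<sigma> s) h u\<bar>)"
      using hb slice by (intro \<tau>.integrable_const_bound[of _ C]) auto
  qed (use hb in auto)
  also have "\<dots> = C * t"
    using t by (simp add: measure_def emeasure)
  finally show "\<bar>W u\<bar> \<le> C * t" .
  have "finite_measure (cell \<Otimes>\<^sub>M \<tau>)"
    by (intro finite_measure_pair_measure \<tau>.finite_measure_axioms cell.finite_measure_axioms)
  then interpret ct: finite_measure "cell \<Otimes>\<^sub>M \<tau>" .
  have int: "integrable (cell \<Otimes>\<^sub>M \<tau>) (\<lambda>(u, s). r u * heat_op (\<sigma> s) h u)"
    by (rule ct.integrable_const_bound[of _ "C' * C"]) (auto intro!: abs_mult_le r hb simp: case_prod_beta')
  have "(LINT u|cell. r u * W u) = (LINT u|cell. LINT s|\<tau>. r u * heat_op (\<sigma> s) h u)"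
    by (simp add: W)
  also have "\<dots> = (LINT s|\<tau>. LINT u|cell. r u * heat_op (\<sigma> s) h u)"
    by (rule ct.Fubini_integral[OF int, symmetric])
  also have "\<dots> = (LINT s:{0..t}|lborel. LINT u|cell. r u * heat_op (\<sigma> s) h u)"
  proof (rule set_int[symmetric])
    show "(\<lambda>s. LINT u|cell. r u * heat_op (\<sigma> s) h u) \<in> borel_measurable borel"
      by (rule cell.borel_measurable_lebesgue_integral) measurable
  qed
  finally show "(LINT u|cell. r u * W u) = (LINT s:{0..t}|lborel. LINT u|cell. r u * heat_op (\<sigma> s) h u)" .
qed

text \<open>The factor \<open>- l\<close> stays inside the integral, so that \<open>l = 0\<close> is
  no exception.\<close>

lemma time_integral_exp:
  fixes t l c :: real
  assumes "t \<ge> 0"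
  shows "(LINT s:{0..t}|lborel. exp (- s * l) * (- l * c)) = exp (- t * l) * c - c"
proof -
  have "(LINT s|lborel. (exp (- s * l) * (- l * c)) * indicator {0..t} s) = exp (- t * l) * c - exp (- 0 * l) * c"
    by (rule integral_FTC_Icc_real[where F = "\<lambda>s. exp (- s * l) * c", OF assms]) (auto intro!: derivative_eq_intros continuous_intros)
  then show ?thesis
    by (simp add: set_lebesgue_integral_def mult.commute)
qed

lemma torus_C_D: "f \<in> torus_C \<Longrightarrow> torus_fun f"
  by (simp add: torus_C_def)

text \<open>By adjointness the weak equation for \<open>r\<close> becomes the integrated heat
  equation for the averages of the test function, paired with \<open>r\<close>. That equation is
  checked on Fourier coefficients, where it is an integral of an exponential, and therefore holds
  almost everywhere.\<close>

lemma weak_solution_heat_op: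
  assumes r [measurable]: "r \<in> borel_measurable borel" and per: "torus_fun r" and bound: "\<And>u. \<bar>r u\<bar> \<le> C"
  shows "weak_solution T r (\<lambda>t. heat_op (sqrt (2 * t)) r)"
  unfolding weak_solution_def
proof (intro conjI ballI)
  show "torus_fun (heat_op (sqrt (2 * t)) r)" for t
    by (rule heat_op_torus_fun[OF per])
  show "set_borel_measurable borel ({0..T} \<times> UNIV) (\<lambda>(t, u). heat_op (sqrt (2 * t)) r u)"
  proof -
    note heat_op_measurable[OF r, measurable]
    have "(\<lambda>p. heat_op (sqrt (2 * fst p)) r (snd p)) \<in> borel_measurable (borel \<Otimes>\<^sub>M borel)"
      using measurable_compose[OF _ heat_op_measurable[OF r], of "\<lambda>p. (sqrt (2 * fst p), snd p)" "borel \<Otimes>\<^sub>M borel"]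
      by simp
    moreover have "{0..T} \<times> UNIV \<in> sets (borel :: (real \<times> real \<times> real) measure)"
      by (intro borel_closed closed_Times closed_UNIV closed_atLeastAtMost)
    ultimately show ?thesis
      unfolding set_borel_measurable_def by (simp add: borel_prod case_prod_beta')
  qed
  show "\<exists>C. \<forall>t\<in>{0..T}. \<forall>u. \<bar>heat_op (sqrt (2 * t)) r u\<bar> \<le> C"
    using heat_op_bound[OF bound r] by blast
  fix f t assume f: "f \<in> torus_C2" and "t \<in> {0..T}"
  then have t: "t \<ge> 0" by simp
  define h where "h = laplacian f"
  have f_C: "f \<in> torus_C" and h_C: "h \<in> torus_C"
    using torus_C2_torus_C[OF f] by (auto simp: h_def)
  note [measurable] = torus_C_measurable[OF f_C] torus_C_measurable[OF h_C]
  obtain Bf where Bf: "\<And>u. \<bar>f u\<bar> \<le> Bf" using torus_C_bounded[OF f_C] by blast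
  obtain Bh where Bh: "\<And>u. \<bar>h u\<bar> \<le> Bh" using torus_C_bounded[OF h_C] by blast
  \<comment> \<open>The sign is the one that \<open>heat_op_adjoint\<close> produces when the
    average with parameter \<open>sqrt (2 * s)\<close> leaves the profile.\<close>
  define \<sigma> where "\<sigma> s = - sqrt (2 * s)" for s :: real
  have [measurable]: "\<sigma> \<in> borel_measurable borel" unfolding \<sigma>_def[abs_def] by measurable
  have \<sigma>2: "(\<sigma> s)\<^sup>2 = 2 * s" if "s \<ge> 0" for s using that by (simp add: \<sigma>_def)
  define W where "W u = (LINT s:{0..t}|lborel. heat_op (\<sigma> s) h u)" for u
  \<comment> \<open>The defect in the integrated heat equation started from \<open>f\<close>, in the
    form: evolved minus initial minus the time integral of the evolved Laplacian.\<close>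
  define D where "D u = heat_op (\<sigma> t) f u - f u - W u" for u
  have W_meas [measurable]: "W \<in> borel_measurable borel" and W_bound: "\<And>u. \<bar>W u\<bar> \<le> Bh * t"
    using heat_op_time_integral(1,2)[of h r \<sigma> Bh C t] Bh bound t by (auto simp: W_def[abs_def])
  have W_int: "(LINT u|cell. k u * W u) = (LINT s:{0..t}|lborel. LINT u|cell. k u * heat_op (\<sigma> s) h u)"
    if "k \<in> borel_measurable borel" "\<And>u. \<bar>k u\<bar> \<le> B" for k B
    unfolding W_def using that heat_op_time_integral(3)[of h k \<sigma> Bh B t] Bh t by simp
  have D_int: "(LINT u|cell. k u * D u) = (LINT u|cell. k u * heat_op (\<sigma> t) f u) -
      (LINT u|cell. k u * f u) - (LINT u|cell. k u * W u)"
    if [measurable]: "k \<in> borel_measurable borel" and k: "\<And>u. \<bar>k u\<bar> \<le> B" for k B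
  proof -
    have "integrable cell (\<lambda>u. k u * heat_op (\<sigma> t) f u)" "integrable cell (\<lambda>u. k u * f u)"
      "integrable cell (\<lambda>u. k u * W u)"
      by (rule integrable_cell, measurable, rule abs_mult_le[OF k heat_op_bound[OF Bf]], measurable,
          rule integrable_cell, measurable, rule abs_mult_le[OF k Bf],
          rule integrable_cell, measurable, rule abs_mult_le[OF k W_bound])
    then show ?thesis by (simp add: D_def algebra_simps)
  qed
  have D_zero: "AE u in cell. D u = 0"
  proof (rule AE_cell_zero)
    show "D \<in> borel_measurable borel" unfolding D_def[abs_def] by measurable
    show "\<bar>D u\<bar> \<le> Bf + Bf + Bh * t" for u
      using heat_op_bound[of f Bf "\<sigma> t" u, OF Bf] Bf[of u] W_bound[of u] unfolding D_def by auto
    fix k \<theta>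
    let ?I = "\<lambda>q. LINT u|cell. mode k \<theta> u * q u"
    have "?I W = (LINT s:{0..t}|lborel. ?I (heat_op (\<sigma> s) h))"
      by (rule W_int[OF borel_measurable_mode mode_abs_le_1])
    also have "\<dots> = (LINT s:{0..t}|lborel. exp (- s * heat_rate k) * (- heat_rate k * ?I f))"
      using integral_mode_heat_op[OF _ torus_C_D[OF h_C] Bh] integral_laplacian_mode[OF f]
      by (intro set_lebesgue_integral_cong) (auto simp: \<sigma>2 h_def[symmetric])
    also have "\<dots> = exp (- t * heat_rate k) * ?I f - ?I f"
      by (rule time_integral_exp[OF t])
    finally show "(LINT u|cell. mode k \<theta> u * D u) = 0"
      using D_int[OF borel_measurable_mode mode_abs_le_1, of k \<theta>]
        integral_mode_heat_op[OF _ torus_C_D[OF f_C] Bf, of k \<theta> "\<sigma> t"] \<sigma>2[OF t] by simp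
  qed
  have "(LINT u|cell. r u * D u) = 0"
    using D_zero by (intro integral_eq_zero_AE) auto
  then have eq: "(LINT u|cell. r u * heat_op (\<sigma> t) f u) = (LINT u|cell. r u * f u) +
      (LINT s:{0..t}|lborel. LINT u|cell. r u * heat_op (\<sigma> s) h u)"
    using D_int[OF r bound] W_int[OF r bound] by simp
  have adj: "(LINT u|cell. q u * heat_op (sqrt (2 * s)) r u) = (LINT u|cell. r u * heat_op (\<sigma> s) q u)"
    if "q \<in> torus_C" for q s
  proof -
    obtain B where B: "\<And>u. \<bar>q u\<bar> \<le> B" using torus_C_bounded[OF \<open>q \<in> torus_C\<close>] by blast
    show ?thesis
      using heat_op_adjoint[OF torus_C_measurable[OF that] r torus_C_D[OF that] B per bound, of "sqrt (2 * s)"]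
      by (simp add: \<sigma>_def mult.commute)
  qed
  have "(LINT s:{0..t}|lborel. LINT u:torus_cell|lborel. heat_op (sqrt (2 * s)) r u * laplacian f u) =
      (LINT s:{0..t}|lborel. LINT u|cell. r u * heat_op (\<sigma> s) h u)"
    using adj[OF h_C] by (simp add: set_integral_cell mult.commute flip: h_def)
  then show "(LINT u:torus_cell|lborel. f u * heat_op (sqrt (2 * t)) r u) =
      (LINT u:torus_cell|lborel. f u * r u) +
      (LINT s:{0..t}|lborel. LINT u:torus_cell|lborel. heat_op (sqrt (2 * s)) r u * laplacian f u)"
    using eq adj[OF f_C, of t] by (simp add: set_integral_cell mult.commute)
qed


section \<open>Fourier coefficients of weak solutions and uniqueness\<close>

lemma weak_solution_measurable:
  assumes "weak_solution T r \<rho>"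
  defines "R \<equiv> \<lambda>p. indicator {0..T} (fst p) * \<rho> (fst p) (snd p)"
  shows "R \<in> borel_measurable (borel \<Otimes>\<^sub>M borel)" "t \<in> {0..T} \<Longrightarrow> \<rho> t \<in> borel_measurable borel"
proof -
  have "(\<lambda>p. indicator ({0..T} \<times> UNIV) p *\<^sub>R (case p of (t, u) \<Rightarrow> \<rho> t u)) \<in> borel_measurable borel"
    using assms(1) by (simp add: weak_solution_def set_borel_measurable_def)
  moreover have "(\<lambda>p. indicator ({0..T} \<times> UNIV) p *\<^sub>R (case p of (t, u) \<Rightarrow> \<rho> t u)) = R"
    by (auto simp: R_def fun_eq_iff indicator_def)
  ultimately show R: "R \<in> borel_measurable (borel \<Otimes>\<^sub>M borel)"
    by (simp add: borel_prod)
  show "\<rho> t \<in> borel_measurable borel" if "t \<in> {0..T}"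
    using measurable_compose_Pair1[of t borel R borel borel] R that by (simp add: R_def)
qed

text \<open>Testing with a mode, an eigenfunction of the Laplacian, closes the equation into a
  scalar integral equation for the coefficient \<open>a\<close>. A priori \<open>a\<close> is only
  bounded and measurable; the equation makes it continuous, then differentiable, and an integrating
  factor solves it.\<close>

lemma weak_solution_mode:
  assumes ws: "weak_solution T r \<rho>" and t: "t \<in> {0..T}"
  shows "(LINT u|cell. mode k \<theta> u * \<rho> t u) =
    exp (- heat_rate k * t) * (LINT u:torus_cell|lborel. mode k \<theta> u * r u)"
proof -
  define l where "l = heat_rate k"
  define a where "a s = (LINT u:torus_cell|lborel. mode k \<theta> u * \<rho> s u)" for s
  define a0 where "a0 = (LINT u:torus_cell|lborel. mode k \<theta> u * r u)"
  \<comment> \<open>Joint measurability is available on the time strip only, so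
    \<open>\<rho>\<close> is cut off outside it before integrating in space.\<close>
  define R where "R p = indicator {0..T} (fst p) * \<rho> (fst p) (snd p)" for p
  have [measurable]: "R \<in> borel_measurable (borel \<Otimes>\<^sub>M borel)"
    using weak_solution_measurable(1)[OF ws] by (simp add: R_def[abs_def])
  note meas = weak_solution_measurable(2)[OF ws]
  obtain C where C: "\<And>t u. t \<in> {0..T} \<Longrightarrow> \<bar>\<rho> t u\<bar> \<le> C"
    using ws unfolding weak_solution_def by blast
  have a_cell: "a s = (LINT u|cell. mode k \<theta> u * \<rho> s u)" if "s \<in> {0..T}" for s
    unfolding a_def using meas[OF that] by (intro set_integral_cell) measurable
  have a_bound: "\<bar>a s\<bar> \<le> C" if "s \<in> {0..T}" for s
    unfolding a_cell[OF that] using abs_mult_le[OF mode_abs_le_1 C[OF that]] meas[OF that]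
    by (intro integral_cell_abs_le) simp_all
  have "(\<lambda>s. LINT u|cell. mode k \<theta> u * R (s, u)) \<in> borel_measurable borel"
    by (rule cell.borel_measurable_lebesgue_integral) measurable
  moreover have "(LINT u|cell. mode k \<theta> u * R (s, u)) = indicator {0..T} s *\<^sub>R a s" for s
    by (cases "s \<in> {0..T}") (auto simp: R_def a_cell)
  ultimately have a_meas: "(\<lambda>s. indicator {0..T} s *\<^sub>R a s) \<in> borel_measurable borel"
    by simp
  have a_int: "set_integrable lborel {0..T} a"
    unfolding set_integrable_def
  proof (rule Bochner_Integration.integrable_bound)
    show "integrable lborel (\<lambda>s. indicator {0..T} s *\<^sub>R C)"
      by (intro integrable_scaleR_left) (simp add: integrable_indicator_iff emeasure_lborel_Icc_eq)
    show "AE s in lborel. norm (indicator {0..T} s *\<^sub>R a s) \<le> norm (indicator {0..T} s *\<^sub>R C)"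
      using a_bound order_trans[OF a_bound abs_ge_self] by (auto simp: indicator_def)
  qed (use a_meas in simp)
  have a_eq: "a s = a0 - l * integral {0..s} a" if s: "s \<in> {0..T}" for s
  proof -
    have "(LINT u:torus_cell|lborel. mode k \<theta> u * \<rho> s u) =
        (LINT u:torus_cell|lborel. mode k \<theta> u * r u) +
        (LINT x:{0..s}|lborel. LINT u:torus_cell|lborel. \<rho> x u * laplacian (mode k \<theta>) u)"
      using ws s mode_torus_C2 unfolding weak_solution_def by blast
    moreover have "(LINT u:torus_cell|lborel. \<rho> x u * laplacian (mode k \<theta>) u) = - l * a x" for x
      unfolding a_def l_def set_lebesgue_integral_def laplacian_mode
      by (subst integral_mult_right_zero[symmetric]) (simp add: mult.left_commute mult.commute)
    moreover have "(LINT x:{0..s}|lborel. - l * a x) = - l * (LINT x:{0..s}|lborel. a x)"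
      unfolding set_lebesgue_integral_def
      by (subst integral_mult_right_zero[symmetric]) (simp add: mult.left_commute)
    moreover have "(LINT x:{0..s}|lborel. a x) = integral {0..s} a"
      using s by (intro set_borel_integral_eq_integral(2) set_integrable_subset[OF a_int]) auto
    ultimately show ?thesis by (simp add: a_def a0_def)
  qed
  have "continuous_on {0..T} (\<lambda>s. a0 - l * integral {0..s} a)"
    using set_borel_integral_eq_integral(1)[OF a_int]
    by (intro continuous_intros indefinite_integral_continuous_1)
  then have a_cont: "continuous_on {0..T} a"
    by (rule continuous_on_eq) (use a_eq in simp)
  have a_deriv: "(a has_real_derivative - l * a s) (at s within {0..T})" if s: "s \<in> {0..T}" for s
  proof -
    have "((\<lambda>s. a0 - l * integral {0..s} a) has_real_derivative - l * a s) (at s within {0..T})"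
      using integral_has_real_derivative[OF a_cont s]
      by (auto intro!: derivative_eq_intros)
    then show ?thesis
      unfolding has_field_derivative_def by (rule has_derivative_transform[OF s, rotated]) (rule a_eq)
  qed
  have "\<exists>c. \<forall>s\<in>{0..T}. exp (l * s) * a s = c"
  proof (rule has_field_derivative_zero_constant)
    show "((\<lambda>s. exp (l * s) * a s) has_real_derivative 0) (at s within {0..T})" if "s \<in> {0..T}" for s
      using a_deriv[OF that] by (auto intro!: derivative_eq_intros simp: algebra_simps)
  qed simp
  moreover have "0 \<in> {0..T}" "a 0 = a0" using t a_eq[of 0] by auto
  ultimately have "exp (l * t) * a t = a0" using t by (metis exp_zero mult_1 mult_zero_right)
  then show ?thesis
    using a_cell[OF t] by (simp add: l_def a0_def exp_minus field_simps)
qed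

lemma weak_solution_unique:
  assumes ws: "weak_solution T r \<rho>" "weak_solution T r \<rho>'" and t: "t \<in> {0..T}"
  shows "AE u in lborel. \<rho>' t u = \<rho> t u"
proof -
  note [measurable] = weak_solution_measurable(2)[OF ws(1) t] weak_solution_measurable(2)[OF ws(2) t]
  obtain C C' where C: "\<And>u. \<bar>\<rho> t u\<bar> \<le> C" "\<And>u. \<bar>\<rho>' t u\<bar> \<le> C'"
    using ws t unfolding weak_solution_def by metis
  have per: "torus_fun (\<rho> t)" "torus_fun (\<rho>' t)"
    using ws t unfolding weak_solution_def by blast+
  have "AE u in lborel. \<rho>' t u - \<rho> t u = 0"
  proof (rule AE_lborel_torus)
    show "torus_fun (\<lambda>u. \<rho>' t u - \<rho> t u)" using per by (simp add: torus_fun_def)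
    show "AE u in cell. \<rho>' t u - \<rho> t u = 0"
    proof (rule AE_cell_zero)
      show "\<bar>\<rho>' t u - \<rho> t u\<bar> \<le> C' + C" for u
        using C(1)[of u] C(2)[of u] by linarith
      fix k \<theta>
      have "integrable cell (\<lambda>u. mode k \<theta> u * \<rho> t u)" "integrable cell (\<lambda>u. mode k \<theta> u * \<rho>' t u)"
        by (rule integrable_cell, measurable, rule abs_mult_le[OF mode_abs_le_1 C(1)],
            rule integrable_cell, measurable, rule abs_mult_le[OF mode_abs_le_1 C(2)])
      then show "(LINT u|cell. mode k \<theta> u * (\<rho>' t u - \<rho> t u)) = 0"
        using weak_solution_mode[OF ws(1) t] weak_solution_mode[OF ws(2) t]
        by (simp add: right_diff_distrib)
    qed measurable
  qed measurable
  then show ?thesis by simp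
qed

section \<open>The hydrodynamic limit\<close>

text \<open>Integer frequencies make the modes blind to wrap-around, so lattice neighbours may be
  treated as honest displacements by \<open>1 / N\<close>.\<close>

lemma mode_embed_mod:
  assumes "N > 0"
  shows "mode k \<theta> (embed N (i mod int N, j mod int N)) = mode k \<theta> (embed N (i, j))"
proof -
  have "real_of_int (i mod int N) / real N = of_int i / real N + of_int (- (i div int N))" for i
  proof -
    have "real_of_int (i mod int N) = of_int i - real N * of_int (i div int N)"
      by (metis minus_mult_div_eq_mod of_int_diff of_int_mult of_int_of_nat_eq)
    then show ?thesis using assms by (simp add: field_simps)
  qed
  then show ?thesis
    unfolding embed_def by (simp only: fst_conv snd_conv torus_fun_of_int[OF torus_fun_mode])
qed

definition phase :: "nat \<Rightarrow> int \<times> int \<Rightarrow> real \<Rightarrow> site \<Rightarrow> real" where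
  "phase N k \<theta> x = 2 * pi * (of_int (fst k) * of_int (fst x) + of_int (snd k) * of_int (snd x)) / real N + \<theta>"

lemma mode_embed: "mode k \<theta> (embed N x) = cos (phase N k \<theta> x)"
  by (simp add: mode_def embed_def phase_def add_divide_distrib distrib_left)

lemma mode_site_add:
  assumes "N > 0"
  shows "mode k \<theta> (embed N (site_add N x e1)) = cos (phase N k \<theta> x + 2 * pi * of_int (fst k) / real N)"
    "mode k \<theta> (embed N (site_diff N x e1)) = cos (phase N k \<theta> x - 2 * pi * of_int (fst k) / real N)"
    "mode k \<theta> (embed N (site_add N x e2)) = cos (phase N k \<theta> x + 2 * pi * of_int (snd k) / real N)"
    "mode k \<theta> (embed N (site_diff N x e2)) = cos (phase N k \<theta> x - 2 * pi * of_int (snd k) / real N)"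
  unfolding site_add_def site_diff_def mode_embed_mod[OF assms] unfolding mode_embed e1_def e2_def
  by (simp_all add: phase_def add_divide_distrib diff_divide_distrib algebra_simps)

text \<open>The eigenvalue of minus \<open>N\<^sup>2\<close> times the discrete Laplacian at
  frequency \<open>k\<close>, one summand per coordinate.\<close>

definition lattice_rate :: "nat \<Rightarrow> int \<times> int \<Rightarrow> real" where
  "lattice_rate N k = (real N)\<^sup>2 * (2 - 2 * cos (2 * pi * of_int (fst k) / real N)) +
     (real N)\<^sup>2 * (2 - 2 * cos (2 * pi * of_int (snd k) / real N))"

lemma lattice_rate_nonneg: "lattice_rate N k \<ge> 0"
  unfolding lattice_rate_def by (intro add_nonneg_nonneg mult_nonneg_nonneg) simp_all

text \<open>With \<open>y = c / (2 * N)\<close> the half-angle formula turns the expression into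
  \<open>c\<^sup>2 * (sin y / y)\<^sup>2\<close>. The case \<open>c = 0\<close> is separate because
  \<open>y\<close> must not vanish.\<close>

lemma rate_limit: "(\<lambda>N. (real N)\<^sup>2 * (2 - 2 * cos (c / real N))) \<longlonglongrightarrow> c\<^sup>2"
proof (cases "c = 0")
  case False
  define y where "y N = c / (2 * real N)" for N
  have sin: "((\<lambda>h. sin h / h) \<longlongrightarrow> 1) (at (0::real))"
    using DERIV_sin[of 0] unfolding has_field_derivative_iff by simp
  have "filterlim y (at 0) sequentially"
    unfolding filterlim_at
  proof
    have "(\<lambda>N. (c / 2) * inverse (real N)) \<longlonglongrightarrow> (c / 2) * 0"
      by (intro tendsto_intros lim_inverse_n)
    then show "y \<longlonglongrightarrow> 0" by (simp add: y_def[abs_def] field_simps)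
    show "\<forall>\<^sub>F N in sequentially. y N \<in> UNIV \<and> y N \<noteq> 0"
      using eventually_gt_at_top[of 0] by eventually_elim (use False in \<open>simp add: y_def\<close>)
  qed
  from filterlim_compose[OF sin this]
  have "(\<lambda>N. c\<^sup>2 * (sin (y N) / y N)\<^sup>2) \<longlonglongrightarrow> c\<^sup>2 * 1\<^sup>2"
    by (intro tendsto_intros)
  moreover have "\<forall>\<^sub>F N in sequentially. c\<^sup>2 * (sin (y N) / y N)\<^sup>2 = (real N)\<^sup>2 * (2 - 2 * cos (c / real N))"
    using eventually_gt_at_top[of 0]
  proof eventually_elim
    case (elim N)
    have cos: "cos (c / real N) = 1 - 2 * (sin (y N))\<^sup>2"
      using cos_double_sin[of "y N"] elim by (simp add: y_def)
    show ?case
      unfolding cos using elim False by (simp add: y_def power_divide power_mult_distrib field_simps)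
  qed
  ultimately show ?thesis
    by (simp add: tendsto_cong)
qed simp

lemma lattice_rate_tendsto: "(\<lambda>N. lattice_rate N k) \<longlonglongrightarrow> heat_rate k"
proof -
  have "(\<lambda>N. lattice_rate N k) \<longlonglongrightarrow> (2 * pi * of_int (fst k))\<^sup>2 + (2 * pi * of_int (snd k))\<^sup>2"
    unfolding lattice_rate_def by (intro tendsto_add rate_limit)
  then show ?thesis by (simp add: heat_rate_def power_mult_distrib distrib_left)
qed

section \<open>Modes of the empirical measure under the dynamics\<close>

definition emp :: "nat \<Rightarrow> (real \<times> real \<Rightarrow> real) \<Rightarrow> config \<Rightarrow> real" where
  "emp N f = linear_stat N (\<lambda>x. f (embed N x) / (real N)\<^sup>2)"

lemma integral_empirical:
  assumes "f \<in> borel_measurable borel"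
  shows "(LINT u|empirical N \<eta>. f u) = emp N f \<eta>"
proof -
  have "embed N \<in> measurable (point_measure (sites N) (\<lambda>x. ennreal (real (\<eta> x) / (real N)\<^sup>2))) borel"
    by (auto simp: measurable_def space_point_measure sets_point_measure)
  then have "(LINT u|empirical N \<eta>. f u) =
      (LINT x|point_measure (sites N) (\<lambda>x. ennreal (real (\<eta> x) / (real N)\<^sup>2)). f (embed N x))"
    unfolding empirical_def using assms by (intro integral_distr)
  also have "\<dots> = emp N f \<eta>"
    unfolding emp_def linear_stat_def
    by (subst lebesgue_integral_point_measure_finite) (auto intro!: sum.cong)
  finally show ?thesis .
qed

lemma emp_add: "emp N (\<lambda>u. f u + h u) \<eta> = emp N f \<eta> + emp N h \<eta>"
  by (simp add: emp_def linear_stat_def add_divide_distrib distrib_right sum.distrib)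

lemma emp_cmult: "emp N (\<lambda>u. c * f u) \<eta> = c * emp N f \<eta>"
  by (simp add: emp_def linear_stat_def sum_distrib_left mult.assoc)

lemma emp_bound:
  assumes "\<And>u. \<bar>f u\<bar> \<le> C" "\<eta> \<in> configs N" "N > 0"
  shows "\<bar>emp N f \<eta>\<bar> \<le> C"
proof -
  have "\<bar>emp N f \<eta>\<bar> \<le> (\<Sum>x\<in>sites N. \<bar>f (embed N x) / (real N)\<^sup>2 * real (\<eta> x)\<bar>)"
    unfolding emp_def linear_stat_def by (rule sum_abs)
  also have "\<dots> \<le> (\<Sum>x\<in>sites N. C / (real N)\<^sup>2 * 1)"
  proof (intro sum_mono abs_mult_le)
    fix x assume "x \<in> sites N"
    then show "\<bar>real (\<eta> x)\<bar> \<le> 1" using configs_01[OF assms(2), of x] by auto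
  qed (use assms in \<open>auto simp: divide_right_mono\<close>)
  also have "\<dots> = C" using assms(3) by (simp add: card_sites)
  finally show ?thesis .
qed

text \<open>The sum of the cosines at opposite neighbours is twice the product of the cosine at the
  site and the cosine of the step, so a mode restricted to the lattice is an exact eigenvector of
  the discrete Laplacian.\<close>

lemma gen_emp_mode:
  assumes "N \<ge> 3" "\<eta> \<in> configs N"
  shows "(real N)\<^sup>2 * gen \<alpha> N (emp N (mode k \<theta>)) \<eta> = - lattice_rate N k * emp N (mode k \<theta>) \<eta>"
proof -
  have pos: "N > 0" using assms by simp
  have "gen \<alpha> N (emp N (mode k \<theta>)) \<eta> = linear_stat N (\<lambda>x. - (lattice_rate N k / (real N)\<^sup>2) * (mode k \<theta> (embed N x) / (real N)\<^sup>2)) \<eta>"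
    unfolding emp_def gen_linear_stat[OF assms]
  proof (intro arg_cong2[where f = "linear_stat N"] ext refl)
    fix x
    have "cos (p + q) + cos (p - q) + cos (p + r) + cos (p - r) - 4 * cos p =
        - ((2 - 2 * cos q) + (2 - 2 * cos r)) * cos p" for p q r :: real
      by (simp add: cos_add cos_diff algebra_simps)
    note * = this[of "phase N k \<theta> x" "2 * pi * of_int (fst k) / real N" "2 * pi * of_int (snd k) / real N"]
    have rate: "lattice_rate N k / (real N)\<^sup>2 =
        (2 - 2 * cos (2 * pi * of_int (fst k) / real N)) + (2 - 2 * cos (2 * pi * of_int (snd k) / real N))"
      using pos by (simp add: lattice_rate_def add_divide_distrib)
    show "mode k \<theta> (embed N (site_add N x e1)) / (real N)\<^sup>2 + mode k \<theta> (embed N (site_diff N x e1)) / (real N)\<^sup>2 +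
        mode k \<theta> (embed N (site_add N x e2)) / (real N)\<^sup>2 + mode k \<theta> (embed N (site_diff N x e2)) / (real N)\<^sup>2 -
        4 * (mode k \<theta> (embed N x) / (real N)\<^sup>2) =
        - (lattice_rate N k / (real N)\<^sup>2) * (mode k \<theta> (embed N x) / (real N)\<^sup>2)"
      unfolding mode_site_add[OF pos] mode_embed[of _ _ _ x] rate
      using * by (simp flip: add_divide_distrib diff_divide_distrib)
  qed
  also have "\<dots> = - (lattice_rate N k / (real N)\<^sup>2) * emp N (mode k \<theta>) \<eta>"
    by (simp add: emp_def linear_stat_def sum_distrib_left mult.assoc)
  finally show ?thesis using pos by simp
qed

lemma abs_cos_diff_le: "\<bar>cos (x + y) - cos x\<bar> \<le> \<bar>y :: real\<bar>"
proof -
  have "norm (cos (x + y) - cos x) \<le> 1 * norm (x + y - x)"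
    by (rule field_differentiable_bound[of UNIV cos "\<lambda>x. - sin x"]) (auto intro!: derivative_eq_intros)
  then show ?thesis by simp
qed

definition mode_const :: "int \<times> int \<Rightarrow> real" where
  "mode_const k = 12 * (2 * pi * (\<bar>of_int (fst k)\<bar> + \<bar>of_int (snd k)\<bar>))\<^sup>2"

text \<open>A mode changes by \<open>O(1/N)\<close> along an edge and carries the weight
  \<open>1 / N\<^sup>2\<close>, so a squared jump is \<open>O(1/N\<^sup>6)\<close>. The edge count
  and the time acceleration each contribute \<open>N\<^sup>2\<close>, which leaves
  \<open>mode_const k / N\<^sup>2\<close>.\<close>

lemma square_field_mode:
  assumes N: "N \<ge> 3" and \<eta>: "\<eta> \<in> configs N" and \<alpha>: "\<bar>\<alpha>\<bar> \<le> 1"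
  shows "(real N)\<^sup>2 * gen \<alpha> N (\<lambda>\<eta>. (emp N (mode k \<theta>) \<eta>)\<^sup>2) \<eta> -
    2 * emp N (mode k \<theta>) \<eta> * ((real N)\<^sup>2 * gen \<alpha> N (emp N (mode k \<theta>)) \<eta>) \<le> mode_const k / (real N)\<^sup>2"
proof -
  have pos: "N > 0" using N by simp
  define K where "K = 2 * pi * (\<bar>of_int (fst k)\<bar> + \<bar>of_int (snd k)\<bar>) / (real N)"
  define a where "a x = mode k \<theta> (embed N x) / (real N)\<^sup>2" for x
  have step: "\<bar>mode k \<theta> (embed N (site_add N x e1)) - mode k \<theta> (embed N x)\<bar> \<le> K"
    "\<bar>mode k \<theta> (embed N (site_add N x e2)) - mode k \<theta> (embed N x)\<bar> \<le> K" for x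
    unfolding mode_site_add[OF pos] mode_embed[of _ _ _ x] K_def
    by (rule order_trans[OF abs_cos_diff_le], simp add: abs_mult divide_right_mono mult_left_mono)+
  have "\<bar>a y - a x\<bar> \<le> K / (real N)\<^sup>2" if "(x, y) \<in> edges N" for x y
  proof -
    have "\<bar>mode k \<theta> (embed N y) - mode k \<theta> (embed N x)\<bar> \<le> K"
      using edge_cases[OF that pos] step[of x] step[of y] by (metis abs_minus_commute)
    then show ?thesis
      by (simp add: a_def divide_right_mono flip: diff_divide_distrib)
  qed
  from square_field_bound[OF N \<eta> \<alpha> this]
  have "(real N)\<^sup>2 * (gen \<alpha> N (\<lambda>\<eta>. (linear_stat N a \<eta>)\<^sup>2) \<eta> -
      2 * linear_stat N a \<eta> * gen \<alpha> N (linear_stat N a) \<eta>) \<le> (real N)\<^sup>2 * (12 * (real N)\<^sup>2 * (K / (real N)\<^sup>2)\<^sup>2)"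
    by (intro mult_left_mono) auto
  also have "\<dots> = mode_const k / (real N)\<^sup>2"
    using pos by (simp add: mode_const_def K_def power_divide field_simps)
  finally show ?thesis
    by (simp add: emp_def a_def[abs_def] algebra_simps)
qed

lemma finite_configs [simp]: "finite (configs N)"
  unfolding configs_def by (intro finite_PiE) auto

lemma pmf_integrable: "set_pmf \<mu> \<subseteq> configs N \<Longrightarrow> integrable (measure_pmf \<mu>) (f :: config \<Rightarrow> real)"
  by (rule integrable_measure_pmf_finite) (rule finite_subset[OF _ finite_configs])

lemma mode_variance_bound:
  assumes mp: "markov_process M (configs N) (\<lambda>F \<zeta>. (real N)\<^sup>2 * gen \<alpha> N F \<zeta>) \<mu> T X"
    and N: "N \<ge> 3" and \<alpha>: "\<bar>\<alpha>\<bar> \<le> 1" and \<mu>: "set_pmf \<mu> \<subseteq> configs N" and t: "t \<in> {0..T}"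
  shows "(LINT \<omega>|M. (emp N (mode k \<theta>) (X t \<omega>) - m)\<^sup>2) \<le>
    measure_pmf.expectation \<mu> (\<lambda>\<eta>. (exp (- lattice_rate N k * t) * emp N (mode k \<theta>) \<eta> - m)\<^sup>2) +
    mode_const k / (real N)\<^sup>2 * t"
proof -
  obtain p where p: "finite_markov_semigroup (configs N) p (\<lambda>F \<zeta>. (real N)\<^sup>2 * gen \<alpha> N F \<zeta>)"
    and law: "\<And>f :: config \<Rightarrow> real. (LINT \<omega>|M. f (X t \<omega>)) =
       measure_pmf.expectation \<mu> (\<lambda>x. measure_pmf.expectation (p t x) f)"
    using markov_process_expectation[OF mp t \<mu>] by blast
  interpret finite_markov_semigroup "configs N" p "\<lambda>F \<zeta>. (real N)\<^sup>2 * gen \<alpha> N F \<zeta>"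
    by fact
  let ?F = "emp N (mode k \<theta>)"
  have "P t (\<lambda>y. (?F y - m)\<^sup>2) \<eta> \<le> (exp (- lattice_rate N k * t) * ?F \<eta> - m)\<^sup>2 + mode_const k / (real N)\<^sup>2 * t"
    if "\<eta> \<in> configs N" for \<eta>
    using N \<alpha> t that
    by (intro P_variance gen_emp_mode square_field_mode lattice_rate_nonneg)
      (auto simp: mode_const_def)
  then have "measure_pmf.expectation \<mu> (P t (\<lambda>y. (?F y - m)\<^sup>2)) \<le> measure_pmf.expectation \<mu>
      (\<lambda>\<eta>. (exp (- lattice_rate N k * t) * ?F \<eta> - m)\<^sup>2 + mode_const k / (real N)\<^sup>2 * t)"
    using \<mu> by (intro integral_mono_AE pmf_integrable[OF \<mu>]) (auto simp: AE_measure_pmf_iff)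
  moreover have "(LINT \<omega>|M. (?F (X t \<omega>) - m)\<^sup>2) = measure_pmf.expectation \<mu> (P t (\<lambda>y. (?F y - m)\<^sup>2))"
    unfolding law[of "\<lambda>y. (?F y - m)\<^sup>2"] by (simp add: P_def[abs_def])
  ultimately show ?thesis
    by (simp add: pmf_integrable[OF \<mu>])
qed


section \<open>Second moments and the passage to the limit\<close>

lemma tendsto_zero_approx:
  fixes a :: "nat \<Rightarrow> real"
  assumes "\<And>N. N \<ge> n \<Longrightarrow> 0 \<le> a N"
    and "\<And>e. e > 0 \<Longrightarrow> \<exists>b. b \<longlonglongrightarrow> 0 \<and> (\<forall>N\<ge>n. a N \<le> e + b N)"
  shows "a \<longlonglongrightarrow> 0"
proof (rule tendstoI)
  fix e :: real assume "e > 0"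
  then obtain b where b: "b \<longlonglongrightarrow> 0" "\<And>N. N \<ge> n \<Longrightarrow> a N \<le> e / 2 + b N"
    using assms(2)[of "e / 2"] by auto
  have "\<forall>\<^sub>F N in sequentially. dist (b N) 0 < e / 2"
    using b(1) \<open>e > 0\<close> by (intro tendstoD) simp_all
  then show "\<forall>\<^sub>F N in sequentially. dist (a N) 0 < e"
    using eventually_ge_at_top[of n]
  proof eventually_elim
    case (elim N)
    then show ?case
      using b(2)[of N] assms(1)[of N] by (simp add: dist_real_def)
  qed
qed

lemma power2_sum_le: "(x + y)\<^sup>2 \<le> 2 * x\<^sup>2 + 2 * (y :: real)\<^sup>2"
  using zero_le_power2[of "x - y"] by (simp add: power2_sum power2_diff)

text \<open>Convergence in probability together with a uniform bound gives convergence in mean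
  square. The deviation never exceeds 2, hence the factor 4 on the bad event; off it the threshold
  \<open>sqrt e\<close> contributes \<open>e\<close>.\<close>

lemma initial_second_moment:
  assumes \<mu>: "\<And>N. N \<ge> 3 \<Longrightarrow> set_pmf (\<mu> N) \<subseteq> configs N"
    and prob: "\<And>\<epsilon>. \<epsilon> > 0 \<Longrightarrow> (\<lambda>N. measure_pmf.prob (\<mu> N) {\<eta>. \<bar>emp N f \<eta> - c\<bar> > \<epsilon>}) \<longlonglongrightarrow> 0"
    and f: "\<And>u. \<bar>f u\<bar> \<le> 1" and c: "\<bar>c\<bar> \<le> 1"
  shows "(\<lambda>N. measure_pmf.expectation (\<mu> N) (\<lambda>\<eta>. (emp N f \<eta> - c)\<^sup>2)) \<longlonglongrightarrow> 0"
proof (rule tendsto_zero_approx[where n = 3])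
  fix e :: real assume "e > 0"
  define A where "A N = {\<eta>. \<bar>emp N f \<eta> - c\<bar> > sqrt e}" for N
  define b where "b N = 4 * measure_pmf.prob (\<mu> N) (A N)" for N
  have "b \<longlonglongrightarrow> 4 * 0"
    unfolding b_def[abs_def] A_def using \<open>e > 0\<close> by (intro tendsto_mult_left prob) simp
  moreover have "measure_pmf.expectation (\<mu> N) (\<lambda>\<eta>. (emp N f \<eta> - c)\<^sup>2) \<le> e + b N" if N: "N \<ge> 3" for N
  proof -
    have "(emp N f \<eta> - c)\<^sup>2 \<le> e + 4 * indicator (A N) \<eta>" if "\<eta> \<in> configs N" for \<eta>
    proof (cases "\<eta> \<in> A N")
      case True
      have "\<bar>emp N f \<eta> - c\<bar> \<le> 2" using emp_bound[of f 1 \<eta> N] f c that N by force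
      then have "(emp N f \<eta> - c)\<^sup>2 \<le> 2\<^sup>2" by (metis abs_ge_zero power2_abs power_mono)
      then show ?thesis using True \<open>e > 0\<close> by simp
    next
      case False
      then have "\<bar>emp N f \<eta> - c\<bar> \<le> sqrt e" by (simp add: A_def)
      then have "(emp N f \<eta> - c)\<^sup>2 \<le> (sqrt e)\<^sup>2" by (metis abs_ge_zero power2_abs power_mono)
      then show ?thesis using False \<open>e > 0\<close> by simp
    qed
    then have "measure_pmf.expectation (\<mu> N) (\<lambda>\<eta>. (emp N f \<eta> - c)\<^sup>2) \<le>
        measure_pmf.expectation (\<mu> N) (\<lambda>\<eta>. e + 4 * indicator (A N) \<eta>)"
      using \<mu>[OF N] by (intro integral_mono_AE pmf_integrable[OF \<mu>[OF N]]) (auto simp: AE_measure_pmf_iff)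
    also have "\<dots> = e + b N"
      by (simp add: b_def pmf_integrable[OF \<mu>[OF N]])
    finally show ?thesis .
  qed
  ultimately show "\<exists>b. b \<longlonglongrightarrow> 0 \<and> (\<forall>N\<ge>3. measure_pmf.expectation (\<mu> N) (\<lambda>\<eta>. (emp N f \<eta> - c)\<^sup>2) \<le> e + b N)"
    by auto
qed simp

text \<open>The lattice rate is replaced by its limit: the difference splits into a contraction of
  the initial deviation and the deterministic error \<open>d N\<close>, which vanishes because the
  rates converge.\<close>

lemma relaxed_second_moment:
  assumes \<mu>: "\<And>N. N \<ge> 3 \<Longrightarrow> set_pmf (\<mu> N) \<subseteq> configs N"
    and conv: "(\<lambda>N. measure_pmf.expectation (\<mu> N) (\<lambda>\<eta>. (emp N (mode k \<theta>) \<eta> - c)\<^sup>2)) \<longlonglongrightarrow> 0"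
    and t: "t \<ge> 0"
  shows "(\<lambda>N. measure_pmf.expectation (\<mu> N)
    (\<lambda>\<eta>. (exp (- lattice_rate N k * t) * emp N (mode k \<theta>) \<eta> - exp (- heat_rate k * t) * c)\<^sup>2)) \<longlonglongrightarrow> 0"
proof (rule Lim_null_comparison)
  define d where "d N = (exp (- lattice_rate N k * t) - exp (- heat_rate k * t)) * c" for N
  let ?E = "\<lambda>N. measure_pmf.expectation (\<mu> N)"
  have "(\<lambda>N. 2 * ?E N (\<lambda>\<eta>. (emp N (mode k \<theta>) \<eta> - c)\<^sup>2) + 2 * (d N)\<^sup>2) \<longlonglongrightarrow>
      2 * 0 + 2 * ((exp (- heat_rate k * t) - exp (- heat_rate k * t)) * c)\<^sup>2"
    unfolding d_def by (intro tendsto_intros conv lattice_rate_tendsto)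
  then show "(\<lambda>N. 2 * ?E N (\<lambda>\<eta>. (emp N (mode k \<theta>) \<eta> - c)\<^sup>2) + 2 * (d N)\<^sup>2) \<longlonglongrightarrow> 0"
    by simp
  show "\<forall>\<^sub>F N in sequentially.
      norm (?E N (\<lambda>\<eta>. (exp (- lattice_rate N k * t) * emp N (mode k \<theta>) \<eta> - exp (- heat_rate k * t) * c)\<^sup>2))
      \<le> 2 * ?E N (\<lambda>\<eta>. (emp N (mode k \<theta>) \<eta> - c)\<^sup>2) + 2 * (d N)\<^sup>2"
    using eventually_ge_at_top[of 3]
  proof eventually_elim
    case (elim N)
    have exp_le: "exp (- lattice_rate N k * t) \<le> 1"
      using t lattice_rate_nonneg[of N k] by simp
    have "(exp (- lattice_rate N k * t) * y - exp (- heat_rate k * t) * c)\<^sup>2 \<le> 2 * (y - c)\<^sup>2 + 2 * (d N)\<^sup>2" for y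
    proof -
      have "(exp (- lattice_rate N k * t) * y - exp (- heat_rate k * t) * c)\<^sup>2 =
          (exp (- lattice_rate N k * t) * (y - c) + d N)\<^sup>2"
        by (simp add: d_def algebra_simps)
      also have "\<dots> \<le> 2 * (exp (- lattice_rate N k * t) * (y - c))\<^sup>2 + 2 * (d N)\<^sup>2"
        by (rule power2_sum_le)
      also have "(exp (- lattice_rate N k * t) * (y - c))\<^sup>2 \<le> 1 * (y - c)\<^sup>2"
        unfolding power_mult_distrib using exp_le by (intro mult_right_mono power_le_one) auto
      finally show ?thesis by simp
    qed
    then have "?E N (\<lambda>\<eta>. (exp (- lattice_rate N k * t) * emp N (mode k \<theta>) \<eta> - exp (- heat_rate k * t) * c)\<^sup>2)
        \<le> ?E N (\<lambda>\<eta>. 2 * (emp N (mode k \<theta>) \<eta> - c)\<^sup>2 + 2 * (d N)\<^sup>2)"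
      by (intro integral_mono pmf_integrable[OF \<mu>[OF elim]])
    also have "\<dots> = 2 * ?E N (\<lambda>\<eta>. (emp N (mode k \<theta>) \<eta> - c)\<^sup>2) + 2 * (d N)\<^sup>2"
      by (simp add: pmf_integrable[OF \<mu>[OF elim]])
    finally show ?case by simp
  qed
qed

lemma second_moment_trig:
  fixes X :: "nat \<Rightarrow> 'w \<Rightarrow> config"
  assumes M: "\<And>N. N \<ge> 3 \<Longrightarrow> prob_space (M N)"
    and X: "\<And>N. N \<ge> 3 \<Longrightarrow> X N \<in> measurable (M N) (count_space (configs N))"
    and \<rho>: "\<rho> \<in> borel_measurable borel" "\<And>u. \<bar>\<rho> u\<bar> \<le> C"
    and modes: "\<And>k \<theta>. (\<lambda>N. LINT \<omega>|M N. (emp N (mode k \<theta>) (X N \<omega>) - (LINT u|cell. mode k \<theta> u * \<rho> u))\<^sup>2) \<longlonglongrightarrow> 0"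
    and q: "q \<in> trig"
  shows "(\<lambda>N. LINT \<omega>|M N. (emp N q (X N \<omega>) - (LINT u|cell. q u * \<rho> u))\<^sup>2) \<longlonglongrightarrow> 0"
  using q
proof induction
  case (mode k \<theta>)
  show ?case by (rule modes)
next
  case (scale f c)
  have "(LINT \<omega>|M N. (emp N (\<lambda>u. c * f u) (X N \<omega>) - (LINT u|cell. c * f u * \<rho> u))\<^sup>2) =
      c\<^sup>2 * (LINT \<omega>|M N. (emp N f (X N \<omega>) - (LINT u|cell. f u * \<rho> u))\<^sup>2)" for N
    by (subst integral_mult_right_zero[symmetric])
      (simp add: emp_cmult mult.assoc flip: right_diff_distrib power_mult_distrib)
  then show ?case
    using tendsto_mult_left[OF scale.IH, of "c\<^sup>2"] by simp
next
  case (add f h)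
  let ?V = "\<lambda>q N. LINT \<omega>|M N. (emp N q (X N \<omega>) - (LINT u|cell. q u * \<rho> u))\<^sup>2"
  have int: "integrable cell (\<lambda>u. q u * \<rho> u)" if q: "q \<in> trig" for q
  proof -
    obtain B where "\<And>u. \<bar>q u\<bar> \<le> B" using trig_bounded[OF q] by blast
    moreover have "q \<in> borel_measurable borel"
      using continuous_on_trig[OF q] by (rule borel_measurable_continuous_onI)
    ultimately show ?thesis
      using \<rho> by (intro integrable_cell[of _ "B * C"] abs_mult_le) auto
  qed
  show ?case
  proof (rule Lim_null_comparison)
    show "(\<lambda>N. 2 * ?V f N + 2 * ?V h N) \<longlonglongrightarrow> 0"
      using tendsto_add[OF tendsto_mult_left[OF add.IH(1)] tendsto_mult_left[OF add.IH(2)], of 2 2] by simp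
    show "\<forall>\<^sub>F N in sequentially. norm (?V (\<lambda>u. f u + h u) N) \<le> 2 * ?V f N + 2 * ?V h N"
      using eventually_ge_at_top[of 3]
    proof eventually_elim
      case (elim N)
      interpret prob_space "M N" by (rule M[OF elim])
      note integrable = integrable_finite_valued[OF X[OF elim] finite_configs]
      define cf ch where "cf = (LINT u|cell. f u * \<rho> u)" and "ch = (LINT u|cell. h u * \<rho> u)"
      have c: "(LINT u|cell. (f u + h u) * \<rho> u) = cf + ch"
        using int[OF add.hyps(1)] int[OF add.hyps(2)] by (simp add: cf_def ch_def distrib_right)
      have "?V (\<lambda>u. f u + h u) N \<le>
          (LINT \<omega>|M N. 2 * (emp N f (X N \<omega>) - cf)\<^sup>2 + 2 * (emp N h (X N \<omega>) - ch)\<^sup>2)"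
        unfolding c
      proof (intro integral_mono integrable)
        show "(emp N (\<lambda>u. f u + h u) (X N \<omega>) - (cf + ch))\<^sup>2 \<le>
            2 * (emp N f (X N \<omega>) - cf)\<^sup>2 + 2 * (emp N h (X N \<omega>) - ch)\<^sup>2" for \<omega>
          using power2_sum_le[of "emp N f (X N \<omega>) - cf" "emp N h (X N \<omega>) - ch"]
          by (simp add: emp_add algebra_simps)
      qed
      also have "\<dots> = 2 * ?V f N + 2 * ?V h N"
        using integrable[of "\<lambda>y. (emp N f y - cf)\<^sup>2"] integrable[of "\<lambda>y. (emp N h y - ch)\<^sup>2"]
        by (simp add: cf_def ch_def)
      finally show ?case by simp
    qed
  qed
qed

lemma second_moment_torus_C:
  fixes X :: "nat \<Rightarrow> 'w \<Rightarrow> config"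
  assumes M: "\<And>N. N \<ge> 3 \<Longrightarrow> prob_space (M N)"
    and X: "\<And>N. N \<ge> 3 \<Longrightarrow> X N \<in> measurable (M N) (count_space (configs N))"
    and \<rho>: "\<rho> \<in> borel_measurable borel" "\<And>u. \<bar>\<rho> u\<bar> \<le> 1"
    and modes: "\<And>k \<theta>. (\<lambda>N. LINT \<omega>|M N. (emp N (mode k \<theta>) (X N \<omega>) - (LINT u|cell. mode k \<theta> u * \<rho> u))\<^sup>2) \<longlonglongrightarrow> 0"
    and f: "f \<in> torus_C"
  shows "(\<lambda>N. LINT \<omega>|M N. (emp N f (X N \<omega>) - (LINT u|cell. f u * \<rho> u))\<^sup>2) \<longlonglongrightarrow> 0"
proof (rule tendsto_zero_approx[where n = 3])
  let ?V = "\<lambda>q N. LINT \<omega>|M N. (emp N q (X N \<omega>) - (LINT u|cell. q u * \<rho> u))\<^sup>2"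
  show "0 \<le> ?V f N" for N by simp
  fix e :: real assume e: "e > 0"
  \<comment> \<open>Two errors of size \<open>\<delta>\<close> add up, the random one from the
    empirical average and the deterministic one from the limit. Squaring and the factor of
    \<open>power2_sum_le\<close> give \<open>8 * \<delta>\<^sup>2 = e\<close>.\<close>
  define \<delta> where "\<delta> = sqrt (e / 8)"
  have \<delta>: "\<delta> > 0" "8 * \<delta>\<^sup>2 = e" using e by (auto simp: \<delta>_def)
  obtain q where q: "q \<in> trig" and close: "\<And>u. \<bar>f u - q u\<bar> < \<delta>"
    using trig_dense[OF f \<delta>(1)] by blast
  obtain B where B: "\<And>u. \<bar>q u\<bar> \<le> B" using trig_bounded[OF q] by blast
  obtain B' where B': "\<And>u. \<bar>f u\<bar> \<le> B'" using torus_C_bounded[OF f] by blast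
  note [measurable] = \<rho>(1) torus_C_measurable[OF f] borel_measurable_continuous_onI[OF continuous_on_trig[OF q]]
  define cf cq where "cf = (LINT u|cell. f u * \<rho> u)" and "cq = (LINT u|cell. q u * \<rho> u)"
  have "cf - cq = (LINT u|cell. (f u - q u) * \<rho> u)"
  proof -
    have "integrable cell (\<lambda>u. f u * \<rho> u)" "integrable cell (\<lambda>u. q u * \<rho> u)"
      by (rule integrable_cell, measurable, rule abs_mult_le[OF B' \<rho>(2)],
          rule integrable_cell, measurable, rule abs_mult_le[OF B \<rho>(2)])
    then show ?thesis by (simp add: cf_def cq_def left_diff_distrib)
  qed
  also have "\<bar>\<dots>\<bar> \<le> \<delta>"
    using abs_mult_le[OF less_imp_le[OF close] \<rho>(2)] by (intro integral_cell_abs_le) auto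
  finally have c: "\<bar>cf - cq\<bar> \<le> \<delta>" .
  have "?V f N \<le> e + 2 * ?V q N" if N: "N \<ge> 3" for N
  proof -
    interpret prob_space "M N" by (rule M[OF N])
    note integrable = integrable_finite_valued[OF X[OF N] finite_configs]
    have "?V f N \<le> (LINT \<omega>|M N. e + 2 * (emp N q (X N \<omega>) - cq)\<^sup>2)"
      unfolding cf_def[symmetric]
    proof (intro integral_mono integrable)
      fix \<omega> assume "\<omega> \<in> space (M N)"
      then have \<omega>: "X N \<omega> \<in> configs N" using measurable_space[OF X[OF N]] by auto
      define y where "y = emp N (\<lambda>u. f u - q u) (X N \<omega>) - (cf - cq)"
      have "\<bar>emp N (\<lambda>u. f u - q u) (X N \<omega>)\<bar> \<le> \<delta>"
        using N \<omega> less_imp_le[OF close] by (intro emp_bound) auto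
      with c have "\<bar>y\<bar> \<le> 2 * \<delta>" unfolding y_def by linarith
      then have "y\<^sup>2 \<le> (2 * \<delta>)\<^sup>2" by (metis abs_ge_zero power2_abs power_mono)
      then have y2: "2 * y\<^sup>2 \<le> e" using \<delta>(2) by (simp add: power_mult_distrib)
      have "emp N f (X N \<omega>) = emp N (\<lambda>u. f u - q u) (X N \<omega>) + emp N q (X N \<omega>)"
        by (simp flip: emp_add)
      then have eq: "emp N f (X N \<omega>) - cf = y + (emp N q (X N \<omega>) - cq)"
        by (simp add: y_def)
      show "(emp N f (X N \<omega>) - cf)\<^sup>2 \<le> e + 2 * (emp N q (X N \<omega>) - cq)\<^sup>2"
        unfolding eq using y2 power2_sum_le[of y "emp N q (X N \<omega>) - cq"] by linarith
    qed
    also have "\<dots> = e + 2 * ?V q N"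
      using integrable[of "\<lambda>y. (emp N q y - cq)\<^sup>2"] prob_space by (simp add: cq_def)
    finally show ?thesis .
  qed
  moreover have "(\<lambda>N. 2 * ?V q N) \<longlonglongrightarrow> 0"
    using tendsto_mult_left[OF second_moment_trig[OF M X \<rho> modes q], of 2] by simp
  ultimately show "\<exists>b. b \<longlonglongrightarrow> 0 \<and> (\<forall>N\<ge>3. ?V f N \<le> e + b N)"
    by blast
qed

lemma probability_tendsto_zero:
  fixes Y :: "nat \<Rightarrow> config \<Rightarrow> real" and X :: "nat \<Rightarrow> 'w \<Rightarrow> config"
  assumes M: "\<And>N. N \<ge> 3 \<Longrightarrow> prob_space (M N)"
    and X: "\<And>N. N \<ge> 3 \<Longrightarrow> X N \<in> measurable (M N) (count_space (configs N))"
    and conv: "(\<lambda>N. LINT \<omega>|M N. (Y N (X N \<omega>))\<^sup>2) \<longlonglongrightarrow> 0" and "\<epsilon> > 0"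
  shows "(\<lambda>N. measure (M N) {\<omega> \<in> space (M N). \<bar>Y N (X N \<omega>)\<bar> > \<epsilon>}) \<longlonglongrightarrow> 0"
proof (rule Lim_null_comparison)
  show "(\<lambda>N. (LINT \<omega>|M N. (Y N (X N \<omega>))\<^sup>2) / \<epsilon>\<^sup>2) \<longlonglongrightarrow> 0"
    using tendsto_divide[OF conv tendsto_const, of "\<epsilon>\<^sup>2"] \<open>\<epsilon> > 0\<close> by simp
  show "\<forall>\<^sub>F N in sequentially. norm (measure (M N) {\<omega> \<in> space (M N). \<bar>Y N (X N \<omega>)\<bar> > \<epsilon>}) \<le>
      (LINT \<omega>|M N. (Y N (X N \<omega>))\<^sup>2) / \<epsilon>\<^sup>2"
    using eventually_ge_at_top[of 3]
  proof eventually_elim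
    case (elim N)
    interpret prob_space "M N" by (rule M[OF elim])
    have int: "integrable (M N) (\<lambda>\<omega>. (Y N (X N \<omega>))\<^sup>2)"
      using integrable_finite_valued[OF X[OF elim] finite_configs, of "\<lambda>y. (Y N y)\<^sup>2"] .
    note [measurable] = borel_measurable_integrable[OF int]
    have "\<epsilon>\<^sup>2 \<le> (Y N (X N \<omega>))\<^sup>2" if "\<bar>Y N (X N \<omega>)\<bar> > \<epsilon>" for \<omega>
      using that \<open>\<epsilon> > 0\<close> by (metis abs_le_square_iff abs_of_pos less_imp_le)
    then have "measure (M N) {\<omega> \<in> space (M N). \<bar>Y N (X N \<omega>)\<bar> > \<epsilon>} \<le>
        measure (M N) {\<omega> \<in> space (M N). (Y N (X N \<omega>))\<^sup>2 \<ge> \<epsilon>\<^sup>2}"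
      by (intro finite_measure_mono) auto
    also have "\<dots> \<le> (LINT \<omega>|M N. (Y N (X N \<omega>))\<^sup>2) / \<epsilon>\<^sup>2"
      using \<open>\<epsilon> > 0\<close> by (intro integral_Markov_inequality_measure[OF int, of "space (M N)"]) auto
    finally show ?case by simp
  qed
qed

theorem theorem3p3:
  fixes \<alpha> T :: real
    and \<rho>_star :: "real \<times> real \<Rightarrow> real"
    and \<mu> :: "nat \<Rightarrow> config pmf"
    and M :: "nat \<Rightarrow> 'w measure"
    and \<eta> :: "nat \<Rightarrow> real \<Rightarrow> 'w \<Rightarrow> config"
  assumes "\<bar>\<alpha>\<bar> < 1" and "T > 0"
    and "\<And>N. N \<ge> 3 \<Longrightarrow> set_pmf (\<mu> N) \<subseteq> configs N"
    and "\<And>N. N \<ge> 3 \<Longrightarrow>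
      markov_process (M N) (configs N) (\<lambda>F \<zeta>. (real N)\<^sup>2 * gen \<alpha> N F \<zeta>) (\<mu> N) T (\<eta> N)"
    and "torus_fun \<rho>_star" and "\<rho>_star \<in> borel_measurable borel" and "\<And>u. \<rho>_star u \<in> {0..1}"
    and "associated \<mu> \<rho>_star"
  shows "\<exists>\<rho>. weak_solution T \<rho>_star \<rho> \<and>
    (\<forall>\<rho>'. weak_solution T \<rho>_star \<rho>' \<longrightarrow> (\<forall>t\<in>{0..T}. AE u in lborel. \<rho>' t u = \<rho> t u)) \<and>
    (\<forall>t\<in>{0..T}. \<forall>f\<in>torus_C. \<forall>\<epsilon>>0.
      (\<lambda>N. measure (M N) {\<omega> \<in> space (M N).
         \<bar>(LINT u|empirical N (\<eta> N t \<omega>). f u) - (LINT u:torus_cell|lborel. f u * \<rho> t u)\<bar> > \<epsilon>})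
      \<longlonglongrightarrow> 0)"
proof -
  note [measurable] = assms(6)
  have bound: "\<bar>\<rho>_star u\<bar> \<le> 1" for u using assms(7)[of u] by auto
  \<comment> \<open>One profile is fixed in advance for all times, test functions and tolerances; it
    inherits the bound 1 from the initial profile.\<close>
  define \<rho> where "\<rho> t = heat_op (sqrt (2 * t)) \<rho>_star" for t
  have ws: "weak_solution T \<rho>_star \<rho>"
    unfolding \<rho>_def by (rule weak_solution_heat_op[OF assms(6,5) bound])
  have \<rho>: "\<rho> t \<in> borel_measurable borel" "\<bar>\<rho> t u\<bar> \<le> 1" for t u
    using heat_op_bound[OF bound assms(6)] by (auto simp: \<rho>_def)
  have M: "prob_space (M N)" if "N \<ge> 3" for N
    using assms(4)[OF that] by (simp add: markov_process_def)
  have X: "\<eta> N t \<in> measurable (M N) (count_space (configs N))" if "N \<ge> 3" "t \<in> {0..T}" for N t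
    using assms(4)[OF that(1)] that(2) by (simp add: markov_process_def)
  have "(\<lambda>N. measure (M N) {\<omega> \<in> space (M N).
      \<bar>(LINT u|empirical N (\<eta> N t \<omega>). f u) - (LINT u:torus_cell|lborel. f u * \<rho> t u)\<bar> > \<epsilon>}) \<longlonglongrightarrow> 0"
    if t: "t \<in> {0..T}" and f: "f \<in> torus_C" and "\<epsilon> > 0" for t f \<epsilon>
  proof -
    have modes: "(\<lambda>N. LINT \<omega>|M N. (emp N (mode k \<theta>) (\<eta> N t \<omega>) - (LINT u|cell. mode k \<theta> u * \<rho> t u))\<^sup>2) \<longlonglongrightarrow> 0"
      for k \<theta>
    proof -
      define c where "c = (LINT u|cell. mode k \<theta> u * \<rho>_star u)"
      have c: "\<bar>c\<bar> \<le> 1"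
        unfolding c_def using abs_mult_le[OF mode_abs_le_1 bound] by (intro integral_cell_abs_le) auto
      \<comment> \<open>The target coefficient decays with the limiting rate, so it is the centre at
        which \<open>relaxed_second_moment\<close> and \<open>mode_variance_bound\<close>
        meet.\<close>
      have m: "(LINT u|cell. mode k \<theta> u * \<rho> t u) = exp (- heat_rate k * t) * c"
        using weak_solution_mode[OF ws t] by (simp add: c_def set_integral_cell)
      have "(\<lambda>N. measure_pmf.prob (\<mu> N) {\<eta>. \<bar>emp N (mode k \<theta>) \<eta> - c\<bar> > \<epsilon>}) \<longlonglongrightarrow> 0" if "\<epsilon> > 0" for \<epsilon>
        using assms(8)[unfolded associated_def, rule_format, OF mode_torus_C that, of k \<theta>]
        by (simp add: integral_empirical set_integral_cell c_def)
      then have "(\<lambda>N. measure_pmf.expectation (\<mu> N) (\<lambda>\<eta>. (emp N (mode k \<theta>) \<eta> - c)\<^sup>2)) \<longlonglongrightarrow> 0"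
        by (intro initial_second_moment assms(3) mode_abs_le_1 c)
      then have lim: "(\<lambda>N. measure_pmf.expectation (\<mu> N)
          (\<lambda>\<eta>. (exp (- lattice_rate N k * t) * emp N (mode k \<theta>) \<eta> - exp (- heat_rate k * t) * c)\<^sup>2)) \<longlonglongrightarrow> 0"
        using t by (intro relaxed_second_moment assms(3)) auto
      have "(\<lambda>N. mode_const k * (inverse (real N))\<^sup>2 * t) \<longlonglongrightarrow> mode_const k * 0\<^sup>2 * t"
        by (intro tendsto_intros lim_inverse_n)
      then have "(\<lambda>N. mode_const k / (real N)\<^sup>2 * t) \<longlonglongrightarrow> 0"
        by (simp add: field_simps)
      from tendsto_add[OF lim this] show ?thesis
        unfolding m
      proof (rule Lim_null_comparison[rotated, OF tendsto_eq_rhs])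
        show "\<forall>\<^sub>F N in sequentially. norm (LINT \<omega>|M N. (emp N (mode k \<theta>) (\<eta> N t \<omega>) - exp (- heat_rate k * t) * c)\<^sup>2) \<le>
            measure_pmf.expectation (\<mu> N) (\<lambda>\<eta>. (exp (- lattice_rate N k * t) * emp N (mode k \<theta>) \<eta> - exp (- heat_rate k * t) * c)\<^sup>2) +
            mode_const k / (real N)\<^sup>2 * t"
          using eventually_ge_at_top[of 3]
        proof eventually_elim
          case (elim N)
          show ?case
            using mode_variance_bound[OF assms(4)[OF elim] elim _ assms(3)[OF elim] t] assms(1) by simp
        qed
      qed simp
    qed
    have "(\<lambda>N. LINT \<omega>|M N. (emp N f (\<eta> N t \<omega>) - (LINT u|cell. f u * \<rho> t u))\<^sup>2) \<longlonglongrightarrow> 0"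
      using second_moment_torus_C[where X = "\<lambda>N. \<eta> N t", OF M X[OF _ t] \<rho> modes f] .
    then have "(\<lambda>N. measure (M N) {\<omega> \<in> space (M N). \<bar>emp N f (\<eta> N t \<omega>) - (LINT u|cell. f u * \<rho> t u)\<bar> > \<epsilon>}) \<longlonglongrightarrow> 0"
      using probability_tendsto_zero[where X = "\<lambda>N. \<eta> N t" and
          Y = "\<lambda>N y. emp N f y - (LINT u|cell. f u * \<rho> t u)", OF M X[OF _ t] _ \<open>\<epsilon> > 0\<close>] by simp
    moreover have "(\<lambda>u. f u * \<rho> t u) \<in> borel_measurable borel"
      using torus_C_measurable[OF f] \<rho>(1) by simp
    ultimately show ?thesis
      by (simp add: integral_empirical torus_C_measurable[OF f] set_integral_cell)
  qed
  then show ?thesis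
    using ws weak_solution_unique[OF ws] by blast
qed

end
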